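(* Let $\mathscr{E}$ be a locally free sheaf with positive rank on a locally irreducible complex space $Y$ such that there exist a proper modification $\pi:Z\to Y$ with $Z$ normal and a coherent analytic sheaf $\mathscr{F}$ on $Z$ with $\pi_*\mathscr{F}\cong\mathscr{E}$. Then $Y$ is normal.
   Context: Complex spaces are reduced. *)

theory Defs
  imports "HOL-Analysis.Analysis" "HOL-Algebra.Module"
begin

section \<open>Spaces with a sheaf of complex-valued functions\<close>

text \<open>
  Since complex spaces are reduced, the structure sheaf is a sheaf of functions: \<open>hol X U\<close> is the
  set of sections over \<open>U\<close>. A function on \<open>U\<close> is represented by its unique representative in
  \<open>extensional U\<close>. Only the values of \<open>hol X\<close> (and later of \<open>sec F\<close>, \<open>res F\<close>) at open sets
  matter, so restricting a space or a sheaf to an open subspace only changes the topology.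
\<close>

record 'a fspace =
  ctop :: "'a topology"
  hol :: "'a set \<Rightarrow> ('a \<Rightarrow> complex) set"

definition open_subspace :: "'a fspace \<Rightarrow> 'a set \<Rightarrow> 'a fspace" where
  "open_subspace X U = X\<lparr>ctop := subtopology (ctop X) U\<rparr>"

definition function_sheaf :: "'a fspace \<Rightarrow> bool" where
  "function_sheaf X \<longleftrightarrow>
    (\<forall>U. openin (ctop X) U \<longrightarrow> hol X U \<subseteq> extensional U) \<and>
    (\<forall>U V f. openin (ctop X) U \<and> openin (ctop X) V \<and> V \<subseteq> U \<and> f \<in> hol X U
        \<longrightarrow> restrict f V \<in> hol X V) \<and>
    (\<forall>U f. openin (ctop X) U \<and> f \<in> extensional U \<and>
        (\<forall>x\<in>U. \<exists>V. openin (ctop X) V \<and> x \<in> V \<and> V \<subseteq> U \<and> restrict f V \<in> hol X V)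
        \<longrightarrow> f \<in> hol X U)"

definition preim :: "'a fspace \<Rightarrow> ('a \<Rightarrow> 'b) \<Rightarrow> 'b set \<Rightarrow> 'a set" where
  "preim X h V = {x \<in> topspace (ctop X). h x \<in> V}"

definition pullback :: "'a fspace \<Rightarrow> ('a \<Rightarrow> 'b) \<Rightarrow> 'b set \<Rightarrow> ('b \<Rightarrow> complex) \<Rightarrow> 'a \<Rightarrow> complex" where
  "pullback X h V f = (\<lambda>x\<in>preim X h V. f (h x))"

definition hol_map :: "'a fspace \<Rightarrow> 'b fspace \<Rightarrow> ('a \<Rightarrow> 'b) \<Rightarrow> bool" where
  "hol_map X Y h \<longleftrightarrow> continuous_map (ctop X) (ctop Y) h \<and>
    (\<forall>V f. openin (ctop Y) V \<and> f \<in> hol Y V \<longrightarrow> pullback X h V f \<in> hol X (preim X h V))"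

definition biholomorphic_map :: "'a fspace \<Rightarrow> 'b fspace \<Rightarrow> ('a \<Rightarrow> 'b) \<Rightarrow> bool" where
  "biholomorphic_map X Y h \<longleftrightarrow>
    (\<exists>g. homeomorphic_maps (ctop X) (ctop Y) h g \<and> hol_map X Y h \<and> hol_map Y X g)"

definition analytic_subset :: "'a fspace \<Rightarrow> 'a set \<Rightarrow> bool" where
  "analytic_subset X A \<longleftrightarrow> A \<subseteq> topspace (ctop X) \<and>
    (\<forall>x\<in>topspace (ctop X). \<exists>U S. openin (ctop X) U \<and> x \<in> U \<and> finite S \<and> S \<subseteq> hol X U \<and>
        A \<inter> U = {y \<in> U. \<forall>f\<in>S. f y = 0})"

text \<open>The reduced structure on a subset: functions locally extendable to the ambient space.\<close>

definition reduced_subspace :: "'a fspace \<Rightarrow> 'a set \<Rightarrow> 'a fspace" where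
  "reduced_subspace X A = \<lparr>ctop = subtopology (ctop X) A,
    hol = (\<lambda>V. {f \<in> extensional V. \<forall>x\<in>V. \<exists>W g. openin (ctop X) W \<and> x \<in> W \<and> g \<in> hol X W \<and>
                  (\<forall>y\<in>W \<inter> V. f y = g y)})\<rparr>"


section \<open>Reduced complex spaces\<close>

text \<open>
  Complex \<open>n\<close>-space consists of the sequences vanishing from index \<open>n\<close> on, with the topology
  induced by the product topology on all sequences. Holomorphic functions are the continuous
  functions that are holomorphic in each variable separately.
\<close>

definition complex_affine :: "nat \<Rightarrow> (nat \<Rightarrow> complex) fspace" where
  "complex_affine n = \<lparr>ctop = top_of_set {z. \<forall>i\<ge>n. z i = 0},
    hol = (\<lambda>U. {f \<in> extensional U. continuous_on U f \<and>
                 (\<forall>z\<in>U. \<forall>i<n. (\<lambda>w. f (z(i := w))) field_differentiable at (z i))})\<rparr>"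

definition complex_space :: "'a fspace \<Rightarrow> bool" where
  "complex_space X \<longleftrightarrow> Hausdorff_space (ctop X) \<and> function_sheaf X \<and>
    (\<forall>x\<in>topspace (ctop X). \<exists>U n D A h. openin (ctop X) U \<and> x \<in> U \<and>
        openin (ctop (complex_affine n)) D \<and>
        analytic_subset (open_subspace (complex_affine n) D) A \<and>
        biholomorphic_map (open_subspace X U)
          (reduced_subspace (open_subspace (complex_affine n) D) A) h)"

text \<open>
  The germ of \<open>X\<close> at \<open>x\<close> is irreducible if it is not the union of two proper analytic subgerms.
\<close>

definition irreducible_at :: "'a fspace \<Rightarrow> 'a \<Rightarrow> bool" where
  "irreducible_at X x \<longleftrightarrow>
    (\<forall>U A B. openin (ctop X) U \<and> x \<in> U \<and> analytic_subset (open_subspace X U) A \<and>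
        analytic_subset (open_subspace X U) B \<and> A \<union> B = U
      \<longrightarrow> (\<exists>W. openin (ctop X) W \<and> x \<in> W \<and> (W \<subseteq> A \<or> W \<subseteq> B)))"

definition locally_irreducible :: "'a fspace \<Rightarrow> bool" where
  "locally_irreducible X \<longleftrightarrow> (\<forall>x\<in>topspace (ctop X). irreducible_at X x)"

definition proper_modification :: "'a fspace \<Rightarrow> 'b fspace \<Rightarrow> ('a \<Rightarrow> 'b) \<Rightarrow> bool" where
  "proper_modification Z Y p \<longleftrightarrow> hol_map Z Y p \<and> proper_map (ctop Z) (ctop Y) p \<and>
    p ` topspace (ctop Z) = topspace (ctop Y) \<and>
    (\<exists>S. analytic_subset Y S \<and> ctop Y interior_of S = {} \<and>
         ctop Z interior_of (preim Z p S) = {} \<and>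
         biholomorphic_map (open_subspace Z (topspace (ctop Z) - preim Z p S))
                           (open_subspace Y (topspace (ctop Y) - S)) p)"


section \<open>Normality\<close>

definition germ :: "'a fspace \<Rightarrow> 'a \<Rightarrow> 'a set \<Rightarrow> ('a \<Rightarrow> complex) \<Rightarrow> ('a set \<times> ('a \<Rightarrow> complex)) set" where
  "germ X x U f = {(V, g). openin (ctop X) V \<and> x \<in> V \<and> g \<in> hol X V \<and>
     (\<exists>W. openin (ctop X) W \<and> x \<in> W \<and> W \<subseteq> U \<inter> V \<and> (\<forall>y\<in>W. f y = g y))}"

definition stalk :: "'a fspace \<Rightarrow> 'a \<Rightarrow> ('a set \<times> ('a \<Rightarrow> complex)) set ring" where
  "stalk X x = \<lparr>carrier = {germ X x U f | U f. openin (ctop X) U \<and> x \<in> U \<and> f \<in> hol X U},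
    monoid.mult = (\<lambda>a b. \<Union>(U, f)\<in>a. \<Union>(V, g)\<in>b. germ X x (U \<inter> V) (\<lambda>y\<in>U \<inter> V. f y * g y)),
    one = germ X x (topspace (ctop X)) (\<lambda>y\<in>topspace (ctop X). 1),
    zero = germ X x (topspace (ctop X)) (\<lambda>y\<in>topspace (ctop X). 0),
    add = (\<lambda>a b. \<Union>(U, f)\<in>a. \<Union>(V, g)\<in>b. germ X x (U \<inter> V) (\<lambda>y\<in>U \<inter> V. f y + g y))\<rparr>"

definition non_zero_divisors :: "('a, 'b) ring_scheme \<Rightarrow> 'a set" where
  "non_zero_divisors R =
    {b \<in> carrier R. \<forall>a\<in>carrier R. a \<otimes>\<^bsub>R\<^esub> b = \<zero>\<^bsub>R\<^esub> \<longrightarrow> a = \<zero>\<^bsub>R\<^esub>}"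

text \<open>The fraction \<open>a / b\<close> is the class of all pairs \<open>(c, d)\<close> with \<open>a d = c b\<close>.\<close>

definition ring_fraction :: "('a, 'b) ring_scheme \<Rightarrow> 'a \<Rightarrow> 'a \<Rightarrow> ('a \<times> 'a) set" where
  "ring_fraction R a b = {(c, d). c \<in> carrier R \<and> d \<in> non_zero_divisors R \<and> a \<otimes>\<^bsub>R\<^esub> d = c \<otimes>\<^bsub>R\<^esub> b}"

definition total_fraction_ring :: "('a, 'b) ring_scheme \<Rightarrow> ('a \<times> 'a) set ring" where
  "total_fraction_ring R =
    \<lparr>carrier = {ring_fraction R a b | a b. a \<in> carrier R \<and> b \<in> non_zero_divisors R},
     monoid.mult = (\<lambda>p q. \<Union>(a, b)\<in>p. \<Union>(c, d)\<in>q. ring_fraction R (a \<otimes>\<^bsub>R\<^esub> c) (b \<otimes>\<^bsub>R\<^esub> d)),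
     one = ring_fraction R \<one>\<^bsub>R\<^esub> \<one>\<^bsub>R\<^esub>,
     zero = ring_fraction R \<zero>\<^bsub>R\<^esub> \<one>\<^bsub>R\<^esub>,
     add = (\<lambda>p q. \<Union>(a, b)\<in>p. \<Union>(c, d)\<in>q.
              ring_fraction R (a \<otimes>\<^bsub>R\<^esub> d \<oplus>\<^bsub>R\<^esub> c \<otimes>\<^bsub>R\<^esub> b) (b \<otimes>\<^bsub>R\<^esub> d))\<rparr>"

definition integral_over :: "('q, 'b) ring_scheme \<Rightarrow> 'q set \<Rightarrow> 'q \<Rightarrow> bool" where
  "integral_over Q K q \<longleftrightarrow> (\<exists>(n::nat) a. (\<forall>i<n. a i \<in> K) \<and>
     q [^]\<^bsub>Q\<^esub> n \<oplus>\<^bsub>Q\<^esub> (\<Oplus>\<^bsub>Q\<^esub>i\<in>{..<n}. a i \<otimes>\<^bsub>Q\<^esub> q [^]\<^bsub>Q\<^esub> i) = \<zero>\<^bsub>Q\<^esub>)"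

definition integrally_closed :: "('a, 'b) ring_scheme \<Rightarrow> bool" where
  "integrally_closed R \<longleftrightarrow>
    (let K = (\<lambda>a. ring_fraction R a \<one>\<^bsub>R\<^esub>) ` carrier R in
     \<forall>q\<in>carrier (total_fraction_ring R). integral_over (total_fraction_ring R) K q \<longrightarrow> q \<in> K)"

definition normal_complex_space :: "'a fspace \<Rightarrow> bool" where
  "normal_complex_space X \<longleftrightarrow> (\<forall>x\<in>topspace (ctop X). integrally_closed (stalk X x))"


section \<open>Sheaves of modules\<close>

definition hol_ring :: "'a fspace \<Rightarrow> 'a set \<Rightarrow> ('a \<Rightarrow> complex) ring" where
  "hol_ring X U = \<lparr>carrier = hol X U, monoid.mult = (\<lambda>f g. \<lambda>x\<in>U. f x * g x), one = (\<lambda>x\<in>U. 1),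
     zero = (\<lambda>x\<in>U. 0), add = (\<lambda>f g. \<lambda>x\<in>U. f x + g x)\<rparr>"

record ('a, 'm) msheaf =
  sec :: "'a set \<Rightarrow> ('a \<Rightarrow> complex, 'm) module"
  res :: "'a set \<Rightarrow> 'a set \<Rightarrow> 'm \<Rightarrow> 'm"

definition module_sheaf :: "'a fspace \<Rightarrow> ('a, 'm) msheaf \<Rightarrow> bool" where
  "module_sheaf X F \<longleftrightarrow>
    (\<forall>U. openin (ctop X) U \<longrightarrow> Module.module (hol_ring X U) (sec F U)) \<and>
    (\<forall>U V. openin (ctop X) U \<and> openin (ctop X) V \<and> V \<subseteq> U \<longrightarrow>
       (\<forall>s\<in>carrier (sec F U). res F U V s \<in> carrier (sec F V)) \<and>
       (\<forall>s\<in>carrier (sec F U). \<forall>t\<in>carrier (sec F U).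
          res F U V (s \<oplus>\<^bsub>sec F U\<^esub> t) = res F U V s \<oplus>\<^bsub>sec F V\<^esub> res F U V t) \<and>
       (\<forall>f\<in>hol X U. \<forall>s\<in>carrier (sec F U).
          res F U V (f \<odot>\<^bsub>sec F U\<^esub> s) = restrict f V \<odot>\<^bsub>sec F V\<^esub> res F U V s)) \<and>
    (\<forall>U. openin (ctop X) U \<longrightarrow> (\<forall>s\<in>carrier (sec F U). res F U U s = s)) \<and>
    (\<forall>U V W. openin (ctop X) U \<and> openin (ctop X) V \<and> openin (ctop X) W \<and> W \<subseteq> V \<and> V \<subseteq> U \<longrightarrow>
       (\<forall>s\<in>carrier (sec F U). res F V W (res F U V s) = res F U W s)) \<and>
    (\<forall>\<U> s. (\<forall>U\<in>\<U>. openin (ctop X) U \<and> s U \<in> carrier (sec F U)) \<and>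
       (\<forall>U\<in>\<U>. \<forall>V\<in>\<U>. res F U (U \<inter> V) (s U) = res F V (U \<inter> V) (s V)) \<longrightarrow>
       (\<exists>!t. t \<in> carrier (sec F (\<Union>\<U>)) \<and> (\<forall>U\<in>\<U>. res F (\<Union>\<U>) U t = s U)))"

definition sheaf_hom ::
  "'a fspace \<Rightarrow> ('a, 'm) msheaf \<Rightarrow> ('a, 'n) msheaf \<Rightarrow> ('a set \<Rightarrow> 'm \<Rightarrow> 'n) \<Rightarrow> bool" where
  "sheaf_hom X F G \<phi> \<longleftrightarrow>
    (\<forall>U. openin (ctop X) U \<longrightarrow>
       (\<forall>s\<in>carrier (sec F U). \<phi> U s \<in> carrier (sec G U)) \<and>
       (\<forall>s\<in>carrier (sec F U). \<forall>t\<in>carrier (sec F U).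
          \<phi> U (s \<oplus>\<^bsub>sec F U\<^esub> t) = \<phi> U s \<oplus>\<^bsub>sec G U\<^esub> \<phi> U t) \<and>
       (\<forall>f\<in>hol X U. \<forall>s\<in>carrier (sec F U). \<phi> U (f \<odot>\<^bsub>sec F U\<^esub> s) = f \<odot>\<^bsub>sec G U\<^esub> \<phi> U s)) \<and>
    (\<forall>U V. openin (ctop X) U \<and> openin (ctop X) V \<and> V \<subseteq> U \<longrightarrow>
       (\<forall>s\<in>carrier (sec F U). \<phi> V (res F U V s) = res G U V (\<phi> U s)))"

definition sheaf_isomorphic :: "'a fspace \<Rightarrow> ('a, 'm) msheaf \<Rightarrow> ('a, 'n) msheaf \<Rightarrow> bool" where
  "sheaf_isomorphic X F G \<longleftrightarrow> (\<exists>\<phi>. sheaf_hom X F G \<phi> \<and>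
    (\<forall>U. openin (ctop X) U \<longrightarrow> bij_betw (\<phi> U) (carrier (sec F U)) (carrier (sec G U))))"

definition sheaf_epi ::
  "'a fspace \<Rightarrow> ('a, 'm) msheaf \<Rightarrow> ('a, 'n) msheaf \<Rightarrow> ('a set \<Rightarrow> 'm \<Rightarrow> 'n) \<Rightarrow> bool" where
  "sheaf_epi X F G \<phi> \<longleftrightarrow> sheaf_hom X F G \<phi> \<and>
    (\<forall>U t x. openin (ctop X) U \<and> t \<in> carrier (sec G U) \<and> x \<in> U \<longrightarrow>
      (\<exists>V s. openin (ctop X) V \<and> x \<in> V \<and> V \<subseteq> U \<and> s \<in> carrier (sec F V) \<and>
             \<phi> V s = res G U V t))"

definition sheaf_kernel ::
  "('a, 'm) msheaf \<Rightarrow> ('a, 'n) msheaf \<Rightarrow> ('a set \<Rightarrow> 'm \<Rightarrow> 'n) \<Rightarrow> ('a, 'm) msheaf" where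
  "sheaf_kernel F G \<phi> =
    \<lparr>sec = (\<lambda>U. (sec F U)\<lparr>carrier := {s \<in> carrier (sec F U). \<phi> U s = \<zero>\<^bsub>sec G U\<^esub>}\<rparr>), res = res F\<rparr>"

text \<open>
  The module record extends the ring record; the multiplicative structure of a module is
  irrelevant and left \<open>undefined\<close>.
\<close>

definition free_sheaf :: "'a fspace \<Rightarrow> nat \<Rightarrow> ('a, nat \<Rightarrow> 'a \<Rightarrow> complex) msheaf" where
  "free_sheaf X r =
    \<lparr>sec = (\<lambda>U. \<lparr>carrier = {..<r} \<rightarrow>\<^sub>E hol X U, monoid.mult = undefined, one = undefined,
              zero = (\<lambda>i\<in>{..<r}. \<lambda>x\<in>U. 0),
              add = (\<lambda>s t. \<lambda>i\<in>{..<r}. \<lambda>x\<in>U. s i x + t i x),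
              smult = (\<lambda>f s. \<lambda>i\<in>{..<r}. \<lambda>x\<in>U. f x * s i x)\<rparr>),
     res = (\<lambda>U V s. \<lambda>i\<in>{..<r}. restrict (s i) V)\<rparr>"

definition finite_type :: "'a fspace \<Rightarrow> ('a, 'm) msheaf \<Rightarrow> bool" where
  "finite_type X F \<longleftrightarrow> (\<forall>x\<in>topspace (ctop X). \<exists>U r \<phi>. openin (ctop X) U \<and> x \<in> U \<and>
     sheaf_epi (open_subspace X U) (free_sheaf (open_subspace X U) r) F \<phi>)"

definition coherent_sheaf :: "'a fspace \<Rightarrow> ('a, 'm) msheaf \<Rightarrow> bool" where
  "coherent_sheaf X F \<longleftrightarrow> module_sheaf X F \<and> finite_type X F \<and>
    (\<forall>U r \<phi>. openin (ctop X) U \<and>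
        sheaf_hom (open_subspace X U) (free_sheaf (open_subspace X U) r) F \<phi> \<longrightarrow>
        finite_type (open_subspace X U) (sheaf_kernel (free_sheaf (open_subspace X U) r) F \<phi>))"

definition locally_free_positive_rank :: "'a fspace \<Rightarrow> ('a, 'm) msheaf \<Rightarrow> bool" where
  "locally_free_positive_rank X F \<longleftrightarrow> module_sheaf X F \<and>
    (\<forall>x\<in>topspace (ctop X). \<exists>U r. openin (ctop X) U \<and> x \<in> U \<and> 0 < r \<and>
       sheaf_isomorphic (open_subspace X U) F (free_sheaf (open_subspace X U) r))"

definition direct_image :: "'a fspace \<Rightarrow> ('a \<Rightarrow> 'b) \<Rightarrow> ('a, 'm) msheaf \<Rightarrow> ('b, 'm) msheaf" where
  "direct_image X h F =
    \<lparr>sec = (\<lambda>V. let M = sec F (preim X h V) in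
              \<lparr>carrier = carrier M, monoid.mult = monoid.mult M, one = one M, zero = zero M,
               add = add M, smult = (\<lambda>f s. pullback X h V f \<odot>\<^bsub>M\<^esub> s)\<rparr>),
     res = (\<lambda>V W. res F (preim X h V) (preim X h W))\<rparr>"

end

theory Submission
  imports Defs
begin

text \<open>
  Let \<open>f / g\<close> be a fraction of germs at a point of \<open>Y\<close> that satisfies an integral equation. On a
  neighbourhood \<open>U\<close> of the point the direct image of \<open>F\<close> is a free sheaf of positive rank, so that sections
  of \<open>F\<close> over the preimage of an open \<open>V \<subseteq> U\<close> are tuples of holomorphic functions on \<open>V\<close>. Let \<open>e\<close>
  be the section over the preimage \<open>P\<close> of \<open>U\<close> that corresponds to the first basis vector. Suppose that
  there is a holomorphic function \<open>h\<close> on \<open>P\<close> with \<open>h (g \<circ> p) = f \<circ> p\<close>. There is no reason for a function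
  on \<open>P\<close> to descend to \<open>U\<close>, but \<open>h\<close> acts on \<open>F\<close>: the product \<open>h e\<close> is a section of \<open>F\<close>, its first
  component \<open>b\<close> is holomorphic on \<open>U\<close>, and \<open>(g \<circ> p) (h e) = (f \<circ> p) e\<close> says that \<open>g b = f\<close>. So
  \<open>f / g\<close> is the germ of \<open>b\<close> (\<open>integral_equation_solvable\<close>).

  The function \<open>h\<close> comes from the normality of \<open>Z\<close>, since \<open>f \<circ> p\<close> and \<open>g \<circ> p\<close> satisfy the same integral
  equation. The obstacle is that \<open>q = g \<circ> p\<close> may be a zero divisor at some points of \<open>P\<close>. It is overcome
  by a dichotomy (\<open>zero_or_nonzero_densely\<close>): near every point, \<open>q\<close> either vanishes identically or vanishes
  on no nonempty open set. In the first case \<open>f \<circ> p\<close> vanishes as well and \<open>h = 0\<close> will do; in the second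
  case \<open>q\<close> is not a zero divisor and \<open>h\<close> exists and is unique; hence the local solutions glue
  (\<open>divide_integral\<close>).

  The dichotomy would follow from the fact that normal local rings are domains. That fact rests on a
  finiteness property of the local ring, of which only one instance is needed: the annihilator of \<open>q\<close> is
  locally finitely generated. Given generators, a generic linear combination \<open>b\<close> of them makes \<open>q + b\<close> a
  non-zero-divisor, and the idempotent \<open>b / (q + b)\<close> is holomorphic by normality, hence locally constant,
  with value \<open>1\<close> where \<open>q\<close> vanishes and \<open>0\<close> where it is regular.

  The coherence of \<open>F\<close> provides the finiteness (\<open>annihilator_locally_finitely_generated\<close>). As \<open>p\<close> is
  biholomorphic off a nowhere dense set and functions on reduced spaces are determined off such sets, no
  nonzero function kills \<open>e\<close>. So the annihilator of \<open>q\<close> is the kernel of the homomorphism from the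
  structure sheaf to \<open>F\<close> that sends \<open>1\<close> to \<open>q e\<close>, and this kernel is of finite type.
\<close>

section \<open>Integral closedness in the total fraction ring\<close>

lemma UN_pairs_constant:
  assumes "(a, b) \<in> A" "(c, d) \<in> B"
    and "\<And>a' b' c' d'. (a', b') \<in> A \<Longrightarrow> (c', d') \<in> B \<Longrightarrow> G a' b' c' d' = H"
  shows "(\<Union>(a', b')\<in>A. \<Union>(c', d')\<in>B. G a' b' c' d') = H"
proof
  show "(\<Union>(a', b')\<in>A. \<Union>(c', d')\<in>B. G a' b' c' d') \<subseteq> H"
    using assms(3) by (intro UN_least) auto
  show "H \<subseteq> (\<Union>(a', b')\<in>A. \<Union>(c', d')\<in>B. G a' b' c' d')"
    using assms(3)[OF assms(1,2)] assms(1,2) by blast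
qed

lemma (in cring) non_zero_divisors_closed:
  "b \<in> non_zero_divisors R \<Longrightarrow> b \<in> carrier R"
  by (simp add: non_zero_divisors_def)

lemma (in cring) one_non_zero_divisor: "\<one> \<in> non_zero_divisors R"
  by (simp add: non_zero_divisors_def)

lemma (in cring) non_zero_divisors_mult:
  assumes "b \<in> non_zero_divisors R" "d \<in> non_zero_divisors R"
  shows "b \<otimes> d \<in> non_zero_divisors R"
proof -
  have cl: "b \<in> carrier R" "d \<in> carrier R" using assms by (auto simp: non_zero_divisors_def)
  have "a = \<zero>" if "a \<in> carrier R" "a \<otimes> (b \<otimes> d) = \<zero>" for a
  proof -
    have "(a \<otimes> b) \<otimes> d = \<zero>" using that cl by (simp add: m_assoc)
    then have "a \<otimes> b = \<zero>" using assms(2) that cl unfolding non_zero_divisors_def by blast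
    then show ?thesis using assms(1) that unfolding non_zero_divisors_def by blast
  qed
  then show ?thesis using cl by (simp add: non_zero_divisors_def)
qed

lemma (in cring) non_zero_divisors_pow:
  "b \<in> non_zero_divisors R \<Longrightarrow> b [^] (n::nat) \<in> non_zero_divisors R"
  by (induction n) (auto simp: one_non_zero_divisor non_zero_divisors_mult)

lemma (in cring) non_zero_divisor_cancel:
  assumes "b \<in> non_zero_divisors R" "x \<in> carrier R" "y \<in> carrier R" "x \<otimes> b = y \<otimes> b"
  shows "x = y"
proof -
  have b: "b \<in> carrier R" using assms(1) by (rule non_zero_divisors_closed)
  have "(x \<ominus> y) \<otimes> b = \<zero>"
    using assms b by (simp add: a_minus_def l_distr l_minus r_neg)
  moreover have "x \<ominus> y \<in> carrier R" using assms by simp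
  ultimately have "x \<ominus> y = \<zero>"
    using assms(1) by (auto simp: non_zero_divisors_def)
  moreover have "x = (x \<ominus> y) \<oplus> y"
    using assms by (simp add: a_minus_def a_assoc l_neg)
  ultimately show ?thesis using assms by simp
qed

text \<open>
  Fractions are classes of pairs under \<open>a d = c b\<close>. Transitivity of this relation is where it matters
  that denominators can be cancelled.
\<close>

lemma (in cring) ring_fraction_eq_iff:
  assumes "a \<in> carrier R" "c \<in> carrier R" "b \<in> non_zero_divisors R" "d \<in> non_zero_divisors R"
  shows "ring_fraction R a b = ring_fraction R c d \<longleftrightarrow> a \<otimes> d = c \<otimes> b"
proof
  assume eq: "ring_fraction R a b = ring_fraction R c d"
  have "(c, d) \<in> ring_fraction R a b"
    unfolding eq using assms by (simp add: ring_fraction_def)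
  then show "a \<otimes> d = c \<otimes> b" by (simp add: ring_fraction_def)
next
  have swap: "x \<otimes> v = u \<otimes> y"
    if "x' \<otimes> y = x \<otimes> y'" "x' \<otimes> v = u \<otimes> y'" "x \<in> carrier R" "x' \<in> carrier R"
      "y \<in> non_zero_divisors R" "y' \<in> non_zero_divisors R" "u \<in> carrier R" "v \<in> carrier R"
    for x x' y y' u v
  proof (rule non_zero_divisor_cancel[OF that(6)])
    have y: "y \<in> carrier R" "y' \<in> carrier R" using that non_zero_divisors_closed by auto
    have "x \<otimes> v \<otimes> y' = (x \<otimes> y') \<otimes> v" using that y by (simp add: m_ac)
    also have "\<dots> = (x' \<otimes> v) \<otimes> y" using that(3-) y unfolding that(1)[symmetric] by (simp add: m_ac)
    also have "\<dots> = (u \<otimes> y') \<otimes> y" by (simp only: that(2))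
    also have "\<dots> = u \<otimes> y \<otimes> y'" using that y by (simp add: m_ac)
    finally show "x \<otimes> v \<otimes> y' = u \<otimes> y \<otimes> y'" .
    show "x \<otimes> v \<in> carrier R" "u \<otimes> y \<in> carrier R" using that y by auto
  qed
  assume eq: "a \<otimes> d = c \<otimes> b"
  have "a \<otimes> v = u \<otimes> b \<longleftrightarrow> c \<otimes> v = u \<otimes> d"
    if "u \<in> carrier R" "v \<in> non_zero_divisors R" for u v
    using swap[where x = a and y = b and x' = c and y' = d and u = u and v = v]
      swap[where x = c and y = d and x' = a and y' = b and u = u and v = v]
      eq assms that non_zero_divisors_closed[of v] by auto
  then show "ring_fraction R a b = ring_fraction R c d"
    unfolding ring_fraction_def by blast
qed

lemma (in cring) ring_fraction_mem_iff:
  "(c, d) \<in> ring_fraction R a b \<longleftrightarrow>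
    c \<in> carrier R \<and> d \<in> non_zero_divisors R \<and> a \<otimes> d = c \<otimes> b"
  by (simp add: ring_fraction_def)

lemma (in cring) ring_fraction_self:
  assumes "a \<in> carrier R" "b \<in> non_zero_divisors R"
  shows "(a, b) \<in> ring_fraction R a b"
  using assms by (simp add: ring_fraction_def)

lemma (in cring) ring_fraction_mult:
  assumes "a \<in> carrier R" "c \<in> carrier R" "b \<in> non_zero_divisors R" "d \<in> non_zero_divisors R"
  shows "ring_fraction R a b \<otimes>\<^bsub>total_fraction_ring R\<^esub> ring_fraction R c d =
    ring_fraction R (a \<otimes> c) (b \<otimes> d)"
proof -
  have eq: "ring_fraction R (a' \<otimes> c') (b' \<otimes> d') = ring_fraction R (a \<otimes> c) (b \<otimes> d)"
    if "(a', b') \<in> ring_fraction R a b" "(c', d') \<in> ring_fraction R c d" for a' b' c' d'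
  proof -
    have h: "a' \<in> carrier R" "b' \<in> non_zero_divisors R" "a \<otimes> b' = a' \<otimes> b"
      "c' \<in> carrier R" "d' \<in> non_zero_divisors R" "c \<otimes> d' = c' \<otimes> d"
      using that by (auto simp: ring_fraction_mem_iff)
    have cl: "b \<in> carrier R" "d \<in> carrier R" "b' \<in> carrier R" "d' \<in> carrier R"
      using h assms non_zero_divisors_closed by auto
    have "(a' \<otimes> c') \<otimes> (b \<otimes> d) = (a' \<otimes> b) \<otimes> (c' \<otimes> d)" using h cl by (simp add: m_ac)
    also have "\<dots> = (a \<otimes> b') \<otimes> (c \<otimes> d')" using h by simp
    also have "\<dots> = (a \<otimes> c) \<otimes> (b' \<otimes> d')" using assms cl by (simp add: m_ac)
    finally show ?thesis
      using h assms by (subst ring_fraction_eq_iff) (auto intro: non_zero_divisors_mult)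
  qed
  have "ring_fraction R a b \<otimes>\<^bsub>total_fraction_ring R\<^esub> ring_fraction R c d =
    (\<Union>(a', b')\<in>ring_fraction R a b. \<Union>(c', d')\<in>ring_fraction R c d.
      ring_fraction R (a' \<otimes> c') (b' \<otimes> d'))"
    by (simp add: total_fraction_ring_def)
  also have "\<dots> = ring_fraction R (a \<otimes> c) (b \<otimes> d)"
    using eq assms by (intro UN_pairs_constant) (rule ring_fraction_self; simp)+
  finally show ?thesis .
qed

lemma (in cring) ring_fraction_add:
  assumes "a \<in> carrier R" "c \<in> carrier R" "b \<in> non_zero_divisors R" "d \<in> non_zero_divisors R"
  shows "ring_fraction R a b \<oplus>\<^bsub>total_fraction_ring R\<^esub> ring_fraction R c d =
    ring_fraction R (a \<otimes> d \<oplus> c \<otimes> b) (b \<otimes> d)"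
proof -
  have eq: "ring_fraction R (a' \<otimes> d' \<oplus> c' \<otimes> b') (b' \<otimes> d') = ring_fraction R (a \<otimes> d \<oplus> c \<otimes> b) (b \<otimes> d)"
    if "(a', b') \<in> ring_fraction R a b" "(c', d') \<in> ring_fraction R c d" for a' b' c' d'
  proof -
    have h: "a' \<in> carrier R" "b' \<in> non_zero_divisors R" "a \<otimes> b' = a' \<otimes> b"
      "c' \<in> carrier R" "d' \<in> non_zero_divisors R" "c \<otimes> d' = c' \<otimes> d"
      using that by (auto simp: ring_fraction_mem_iff)
    have cl: "b \<in> carrier R" "d \<in> carrier R" "b' \<in> carrier R" "d' \<in> carrier R"
      using h assms non_zero_divisors_closed by auto
    have "(a' \<otimes> d' \<oplus> c' \<otimes> b') \<otimes> (b \<otimes> d) = (a' \<otimes> b) \<otimes> (d \<otimes> d') \<oplus> (c' \<otimes> d) \<otimes> (b \<otimes> b')"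
      using h cl by (simp add: m_ac a_ac l_distr r_distr)
    also have "\<dots> = (a \<otimes> b') \<otimes> (d \<otimes> d') \<oplus> (c \<otimes> d') \<otimes> (b \<otimes> b')" using h by simp
    also have "\<dots> = (a \<otimes> d \<oplus> c \<otimes> b) \<otimes> (b' \<otimes> d')" using assms cl by (simp add: m_ac a_ac l_distr r_distr)
    finally show ?thesis
      using h assms cl by (subst ring_fraction_eq_iff) (auto intro: non_zero_divisors_mult)
  qed
  have "ring_fraction R a b \<oplus>\<^bsub>total_fraction_ring R\<^esub> ring_fraction R c d =
    (\<Union>(a', b')\<in>ring_fraction R a b. \<Union>(c', d')\<in>ring_fraction R c d.
      ring_fraction R (a' \<otimes> d' \<oplus> c' \<otimes> b') (b' \<otimes> d'))"
    by (simp add: total_fraction_ring_def)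
  also have "\<dots> = ring_fraction R (a \<otimes> d \<oplus> c \<otimes> b) (b \<otimes> d)"
    using eq assms by (intro UN_pairs_constant) (rule ring_fraction_self; simp)+
  finally show ?thesis .
qed

lemma (in cring) ring_fraction_carrier:
  "a \<in> carrier R \<Longrightarrow> b \<in> non_zero_divisors R \<Longrightarrow>
    ring_fraction R a b \<in> carrier (total_fraction_ring R)"
  by (auto simp: total_fraction_ring_def)

lemma (in cring) carrier_total_fraction_ringE:
  assumes "q \<in> carrier (total_fraction_ring R)"
  obtains a b where "a \<in> carrier R" "b \<in> non_zero_divisors R" "q = ring_fraction R a b"
  using assms by (auto simp: total_fraction_ring_def)

lemma (in cring) ring_fraction_add_same:
  assumes "a \<in> carrier R" "c \<in> carrier R" "d \<in> non_zero_divisors R"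
  shows "ring_fraction R a d \<oplus>\<^bsub>total_fraction_ring R\<^esub> ring_fraction R c d =
    ring_fraction R (a \<oplus> c) d"
proof -
  have d: "d \<in> carrier R" using assms non_zero_divisors_closed by blast
  have "(a \<otimes> d \<oplus> c \<otimes> d) \<otimes> d = (a \<oplus> c) \<otimes> (d \<otimes> d)"
    using assms d by (simp add: l_distr r_distr m_ac)
  then show ?thesis
    using assms d
    by (simp add: ring_fraction_add ring_fraction_eq_iff non_zero_divisors_mult)
qed

lemma (in cring) ring_fraction_zero:
  "d \<in> non_zero_divisors R \<Longrightarrow> ring_fraction R \<zero> d = \<zero>\<^bsub>total_fraction_ring R\<^esub>"
  using non_zero_divisors_closed
  by (simp add: total_fraction_ring_def ring_fraction_eq_iff one_non_zero_divisor)

lemma (in cring) abelian_monoid_total_fraction_ring: "abelian_monoid (total_fraction_ring R)"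
proof (rule abelian_monoidI)
  let ?Q = "total_fraction_ring R"
  note [simp] = ring_fraction_add non_zero_divisors_mult non_zero_divisors_closed
    ring_fraction_carrier one_non_zero_divisor
  show zero: "\<zero>\<^bsub>?Q\<^esub> \<in> carrier ?Q"
    by (simp flip: ring_fraction_zero[OF one_non_zero_divisor])
  fix x assume "x \<in> carrier ?Q"
  then obtain a b where x: "a \<in> carrier R" "b \<in> non_zero_divisors R" "x = ring_fraction R a b"
    by (rule carrier_total_fraction_ringE)
  show "\<zero>\<^bsub>?Q\<^esub> \<oplus>\<^bsub>?Q\<^esub> x = x"
    using x by (simp flip: ring_fraction_zero[OF one_non_zero_divisor])
  fix y assume "y \<in> carrier ?Q"
  then obtain c d where y: "c \<in> carrier R" "d \<in> non_zero_divisors R" "y = ring_fraction R c d"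
    by (rule carrier_total_fraction_ringE)
  show "x \<oplus>\<^bsub>?Q\<^esub> y \<in> carrier ?Q"
    using x y by simp
  show "x \<oplus>\<^bsub>?Q\<^esub> y = y \<oplus>\<^bsub>?Q\<^esub> x"
    using x y by (simp add: m_comm a_comm)
  fix z assume "z \<in> carrier ?Q"
  then obtain e f where z: "e \<in> carrier R" "f \<in> non_zero_divisors R" "z = ring_fraction R e f"
    by (rule carrier_total_fraction_ringE)
  show "(x \<oplus>\<^bsub>?Q\<^esub> y) \<oplus>\<^bsub>?Q\<^esub> z = x \<oplus>\<^bsub>?Q\<^esub> (y \<oplus>\<^bsub>?Q\<^esub> z)"
    using x y z by (simp add: l_distr r_distr m_ac a_ac)
qed

lemma (in cring) ring_fraction_pow:
  assumes "a \<in> carrier R" "b \<in> non_zero_divisors R"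
  shows "ring_fraction R a b [^]\<^bsub>total_fraction_ring R\<^esub> (n::nat) = ring_fraction R (a [^] n) (b [^] n)"
proof (induction n)
  case 0
  show ?case by (simp add: total_fraction_ring_def)
next
  case (Suc n)
  then show ?case using assms by (simp add: ring_fraction_mult non_zero_divisors_pow)
qed

lemma (in cring) ring_fraction_finsum:
  assumes "\<And>i. i < n \<Longrightarrow> u i \<in> carrier R" "d \<in> non_zero_divisors R"
  shows "(\<Oplus>\<^bsub>total_fraction_ring R\<^esub>i\<in>{..<n::nat}. ring_fraction R (u i) d) =
    ring_fraction R (\<Oplus>i\<in>{..<n}. u i) d"
  using assms(1)
proof (induction n)
  case 0
  interpret Q: abelian_monoid "total_fraction_ring R" by (rule abelian_monoid_total_fraction_ring)
  show ?case using assms(2) by (simp add: ring_fraction_zero)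
next
  case (Suc n)
  interpret Q: abelian_monoid "total_fraction_ring R" by (rule abelian_monoid_total_fraction_ring)
  show ?case
    using Suc assms(2)
    by (simp add: lessThan_Suc Q.finsum_insert finsum_insert Pi_def
        ring_fraction_carrier ring_fraction_add_same)
qed

text \<open>
  Clearing denominators: multiplying an integral equation of degree \<open>n\<close> for \<open>a / b\<close> by \<open>b\<^sup>n\<close> gives a
  homogeneous equation in \<open>R\<close> itself, and no information is lost because \<open>b\<^sup>n\<close> is not a zero divisor.
\<close>

lemma (in cring) integral_over_ring_fraction_iff:
  assumes a: "a \<in> carrier R" and b: "b \<in> non_zero_divisors R"
  shows "integral_over (total_fraction_ring R) ((\<lambda>a. ring_fraction R a \<one>) ` carrier R)
      (ring_fraction R a b) \<longleftrightarrow>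
    (\<exists>(n::nat) u. (\<forall>i<n. u i \<in> carrier R) \<and>
      a [^] n \<oplus> (\<Oplus>i\<in>{..<n}. u i \<otimes> (a [^] i \<otimes> b [^] (n - i))) = \<zero>)"
proof -
  let ?Q = "total_fraction_ring R"
  interpret Q: abelian_monoid ?Q by (rule abelian_monoid_total_fraction_ring)
  have bc: "b \<in> carrier R" using b by (rule non_zero_divisors_closed)
  have key: "ring_fraction R a b [^]\<^bsub>?Q\<^esub> n \<oplus>\<^bsub>?Q\<^esub>
      (\<Oplus>\<^bsub>?Q\<^esub>i\<in>{..<n}. ring_fraction R (u i) \<one> \<otimes>\<^bsub>?Q\<^esub> ring_fraction R a b [^]\<^bsub>?Q\<^esub> i) = \<zero>\<^bsub>?Q\<^esub>
    \<longleftrightarrow> a [^] n \<oplus> (\<Oplus>i\<in>{..<n}. u i \<otimes> (a [^] i \<otimes> b [^] (n - i))) = \<zero>"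
    if u: "\<forall>i<n. u i \<in> carrier R" for n :: nat and u
  proof -
    have summand: "ring_fraction R (u i) \<one> \<otimes>\<^bsub>?Q\<^esub> ring_fraction R a b [^]\<^bsub>?Q\<^esub> i =
        ring_fraction R (u i \<otimes> (a [^] i \<otimes> b [^] (n - i))) (b [^] n)" if i: "i < n" for i
    proof -
      have bn: "b [^] n = b [^] (n - i) \<otimes> b [^] i"
        using bc i by (simp add: nat_pow_mult)
      have "ring_fraction R (u i) \<one> \<otimes>\<^bsub>?Q\<^esub> ring_fraction R a b [^]\<^bsub>?Q\<^esub> i =
          ring_fraction R (u i \<otimes> a [^] i) (b [^] i)"
        using i u a b bc
        by (simp add: ring_fraction_pow ring_fraction_mult one_non_zero_divisor
            non_zero_divisors_pow)
      also have "\<dots> = ring_fraction R (u i \<otimes> (a [^] i \<otimes> b [^] (n - i))) (b [^] n)"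
        using i u a b bc
        by (subst ring_fraction_eq_iff) (auto simp: non_zero_divisors_pow non_zero_divisors_mult bn m_ac)
      finally show ?thesis .
    qed
    have "(\<Oplus>\<^bsub>?Q\<^esub>i\<in>{..<n}. ring_fraction R (u i) \<one> \<otimes>\<^bsub>?Q\<^esub> ring_fraction R a b [^]\<^bsub>?Q\<^esub> i) =
      (\<Oplus>\<^bsub>?Q\<^esub>i\<in>{..<n}. ring_fraction R (u i \<otimes> (a [^] i \<otimes> b [^] (n - i))) (b [^] n))"
      using u a b bc
      by (intro Q.finsum_cong') (auto simp: summand ring_fraction_carrier non_zero_divisors_pow)
    also have "\<dots> = ring_fraction R (\<Oplus>i\<in>{..<n}. u i \<otimes> (a [^] i \<otimes> b [^] (n - i))) (b [^] n)"
      using u a b bc by (intro ring_fraction_finsum) (auto simp: non_zero_divisors_pow)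
    finally have sum: "(\<Oplus>\<^bsub>?Q\<^esub>i\<in>{..<n}. ring_fraction R (u i) \<one> \<otimes>\<^bsub>?Q\<^esub> ring_fraction R a b [^]\<^bsub>?Q\<^esub> i) =
      ring_fraction R (\<Oplus>i\<in>{..<n}. u i \<otimes> (a [^] i \<otimes> b [^] (n - i))) (b [^] n)" .
    have sc: "(\<Oplus>i\<in>{..<n}. u i \<otimes> (a [^] i \<otimes> b [^] (n - i))) \<in> carrier R"
      using u a bc by (intro finsum_closed) auto
    have nz: "x \<otimes> \<one> = \<zero> \<otimes> b [^] n \<longleftrightarrow> x = \<zero>" if "x \<in> carrier R" for x
      using that bc by simp
    show ?thesis
      unfolding sum unfolding ring_fraction_pow[OF a b]
      using a b bc sc
      by (simp add: ring_fraction_add_same non_zero_divisors_pow ring_fraction_eq_iff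
          one_non_zero_divisor nz flip: ring_fraction_zero[OF one_non_zero_divisor])
  qed
  show ?thesis
  proof
    assume "integral_over ?Q ((\<lambda>a. ring_fraction R a \<one>) ` carrier R) (ring_fraction R a b)"
    then obtain n :: nat and v
      where v: "\<forall>i<n. v i \<in> (\<lambda>a. ring_fraction R a \<one>) ` carrier R"
        and eq: "ring_fraction R a b [^]\<^bsub>?Q\<^esub> n \<oplus>\<^bsub>?Q\<^esub>
          (\<Oplus>\<^bsub>?Q\<^esub>i\<in>{..<n}. v i \<otimes>\<^bsub>?Q\<^esub> ring_fraction R a b [^]\<^bsub>?Q\<^esub> i) = \<zero>\<^bsub>?Q\<^esub>"
      unfolding integral_over_def by blast
    from v have "\<forall>i. \<exists>w. i < n \<longrightarrow> w \<in> carrier R \<and> v i = ring_fraction R w \<one>" by blast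
    then obtain u where u: "\<forall>i. i < n \<longrightarrow> u i \<in> carrier R \<and> v i = ring_fraction R (u i) \<one>"
      by metis
    have "(\<Oplus>\<^bsub>?Q\<^esub>i\<in>{..<n}. v i \<otimes>\<^bsub>?Q\<^esub> ring_fraction R a b [^]\<^bsub>?Q\<^esub> i) =
        (\<Oplus>\<^bsub>?Q\<^esub>i\<in>{..<n}. ring_fraction R (u i) \<one> \<otimes>\<^bsub>?Q\<^esub> ring_fraction R a b [^]\<^bsub>?Q\<^esub> i)"
      using u a b by (intro Q.finsum_cong')
        (auto simp: ring_fraction_pow ring_fraction_mult ring_fraction_carrier
          non_zero_divisors_pow one_non_zero_divisor non_zero_divisors_closed)
    then have "a [^] n \<oplus> (\<Oplus>i\<in>{..<n}. u i \<otimes> (a [^] i \<otimes> b [^] (n - i))) = \<zero>"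
      using eq key[of n u] u by simp
    then show "\<exists>(n::nat) u. (\<forall>i<n. u i \<in> carrier R) \<and>
      a [^] n \<oplus> (\<Oplus>i\<in>{..<n}. u i \<otimes> (a [^] i \<otimes> b [^] (n - i))) = \<zero>"
      using u by blast
  next
    assume "\<exists>(n::nat) u. (\<forall>i<n. u i \<in> carrier R) \<and>
      a [^] n \<oplus> (\<Oplus>i\<in>{..<n}. u i \<otimes> (a [^] i \<otimes> b [^] (n - i))) = \<zero>"
    then obtain n :: nat and u where u: "\<forall>i<n. u i \<in> carrier R"
      and "a [^] n \<oplus> (\<Oplus>i\<in>{..<n}. u i \<otimes> (a [^] i \<otimes> b [^] (n - i))) = \<zero>"
      by blast
    then show "integral_over ?Q ((\<lambda>a. ring_fraction R a \<one>) ` carrier R) (ring_fraction R a b)"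
      unfolding integral_over_def using key[OF u]
      by (intro exI[of _ n] exI[of _ "\<lambda>i. ring_fraction R (u i) \<one>"]) auto
  qed
qed

text \<open>
  Both the integral equation and the conclusion \<open>a / b \<in> R\<close> become statements about elements of
  \<open>R\<close>, so that total fractions can be forgotten from here on.
\<close>

lemma (in cring) integrally_closed_iff:
  "integrally_closed R \<longleftrightarrow>
    (\<forall>a\<in>carrier R. \<forall>b\<in>non_zero_divisors R. \<forall>(n::nat) u. (\<forall>i<n. u i \<in> carrier R) \<longrightarrow>
      a [^] n \<oplus> (\<Oplus>i\<in>{..<n}. u i \<otimes> (a [^] i \<otimes> b [^] (n - i))) = \<zero> \<longrightarrow>
      (\<exists>c\<in>carrier R. a = c \<otimes> b))"
  (is "_ \<longleftrightarrow> ?rhs")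
proof -
  have mem: "ring_fraction R a b \<in> (\<lambda>a. ring_fraction R a \<one>) ` carrier R \<longleftrightarrow>
      (\<exists>c\<in>carrier R. a = c \<otimes> b)"
    if "a \<in> carrier R" "b \<in> non_zero_divisors R" for a b
    using that by (auto simp: image_iff ring_fraction_eq_iff one_non_zero_divisor)
  have "integrally_closed R \<longleftrightarrow> (\<forall>a\<in>carrier R. \<forall>b\<in>non_zero_divisors R.
      integral_over (total_fraction_ring R) ((\<lambda>a. ring_fraction R a \<one>) ` carrier R)
        (ring_fraction R a b) \<longrightarrow> (\<exists>c\<in>carrier R. a = c \<otimes> b))"
    (is "_ \<longleftrightarrow> ?mid")
  proof
    assume "integrally_closed R"
    then show ?mid
      unfolding integrally_closed_def Let_def using mem ring_fraction_carrier by blast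
  next
    assume ?mid
    show "integrally_closed R"
      unfolding integrally_closed_def Let_def
    proof (intro ballI impI)
      fix q assume q: "q \<in> carrier (total_fraction_ring R)"
        and int: "integral_over (total_fraction_ring R) ((\<lambda>a. ring_fraction R a \<one>) ` carrier R) q"
      from q obtain a b where "a \<in> carrier R" "b \<in> non_zero_divisors R" "q = ring_fraction R a b"
        by (rule carrier_total_fraction_ringE)
      then show "q \<in> (\<lambda>a. ring_fraction R a \<one>) ` carrier R"
        using \<open>?mid\<close> int mem[of a b] by blast
    qed
  qed
  also have "\<dots> \<longleftrightarrow> (\<forall>a\<in>carrier R. \<forall>b\<in>non_zero_divisors R.
      (\<exists>(n::nat) u. (\<forall>i<n. u i \<in> carrier R) \<and>
        a [^] n \<oplus> (\<Oplus>i\<in>{..<n}. u i \<otimes> (a [^] i \<otimes> b [^] (n - i))) = \<zero>) \<longrightarrow>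
      (\<exists>c\<in>carrier R. a = c \<otimes> b))"
    by (intro ball_cong refl) (simp only: integral_over_ring_fraction_iff)
  also have "\<dots> \<longleftrightarrow> ?rhs" by blast
  finally show ?thesis .
qed


section \<open>Sheaves of algebras of continuous functions\<close>

text \<open>
  These are the closure properties of the sheaf of holomorphic functions that survive when charts are
  forgotten. The operations are stated for arbitrary \<open>f\<close> whose restriction to \<open>U\<close> is holomorphic,
  because then they compose without normalising the values outside \<open>U\<close> at each step.
\<close>

locale holomorphic_space =
  fixes X :: "'a fspace"
  assumes sheaf: "function_sheaf X"
    and const_hol: "\<And>U c. openin (ctop X) U \<Longrightarrow> (\<lambda>x\<in>U. c) \<in> hol X U"
    and add_hol: "\<And>U f g. openin (ctop X) U \<Longrightarrow> restrict f U \<in> hol X U \<Longrightarrow>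
      restrict g U \<in> hol X U \<Longrightarrow> (\<lambda>x\<in>U. f x + g x) \<in> hol X U"
    and mult_hol: "\<And>U f g. openin (ctop X) U \<Longrightarrow> restrict f U \<in> hol X U \<Longrightarrow>
      restrict g U \<in> hol X U \<Longrightarrow> (\<lambda>x\<in>U. f x * g x) \<in> hol X U"
    and open_preimage: "\<And>U f T. openin (ctop X) U \<Longrightarrow> f \<in> hol X U \<Longrightarrow> open T \<Longrightarrow>
      openin (ctop X) {x \<in> U. f x \<in> T}"
begin

lemma hol_extensional: "openin (ctop X) U \<Longrightarrow> f \<in> hol X U \<Longrightarrow> f \<in> extensional U"
  using sheaf unfolding function_sheaf_def by blast

lemma restrict_hol_eq: "openin (ctop X) U \<Longrightarrow> f \<in> hol X U \<Longrightarrow> restrict f U = f"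
  by (simp add: hol_extensional extensional_restrict)

lemma restrict_hol:
  "openin (ctop X) U \<Longrightarrow> openin (ctop X) V \<Longrightarrow> V \<subseteq> U \<Longrightarrow> f \<in> hol X U \<Longrightarrow> restrict f V \<in> hol X V"
proof -
  from sheaf have "\<forall>U V f. openin (ctop X) U \<and> openin (ctop X) V \<and> V \<subseteq> U \<and> f \<in> hol X U
      \<longrightarrow> restrict f V \<in> hol X V"
    unfolding function_sheaf_def by (elim conjE)
  then show "openin (ctop X) U \<Longrightarrow> openin (ctop X) V \<Longrightarrow> V \<subseteq> U \<Longrightarrow> f \<in> hol X U \<Longrightarrow>
      restrict f V \<in> hol X V"
    by simp
qed

lemma restrict_hol_self: "openin (ctop X) U \<Longrightarrow> f \<in> hol X U \<Longrightarrow> restrict f U \<in> hol X U"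
  by (simp add: restrict_hol_eq)

lemma hol_if_locally_hol:
  assumes "openin (ctop X) U" "f \<in> extensional U"
    and "\<And>x. x \<in> U \<Longrightarrow> \<exists>V. openin (ctop X) V \<and> x \<in> V \<and> V \<subseteq> U \<and> restrict f V \<in> hol X V"
  shows "f \<in> hol X U"
proof -
  from sheaf have "\<forall>U f. openin (ctop X) U \<and> f \<in> extensional U \<and>
      (\<forall>x\<in>U. \<exists>V. openin (ctop X) V \<and> x \<in> V \<and> V \<subseteq> U \<and> restrict f V \<in> hol X V) \<longrightarrow> f \<in> hol X U"
    unfolding function_sheaf_def by (elim conjE)
  from this[THEN spec[of _ U], THEN spec[of _ f]] show ?thesis using assms by blast
qed

lemma pow_hol:
  "openin (ctop X) U \<Longrightarrow> restrict f U \<in> hol X U \<Longrightarrow> (\<lambda>x\<in>U. f x ^ n) \<in> hol X U"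
proof (induction n)
  case 0
  then show ?case using const_hol[of U 1] by (simp only: power_0)
next
  case (Suc n)
  then show ?case using mult_hol[of U f "\<lambda>x. f x ^ n"] by (simp only: power_Suc)
qed

lemma uminus_hol:
  "openin (ctop X) U \<Longrightarrow> restrict f U \<in> hol X U \<Longrightarrow> (\<lambda>x\<in>U. - f x) \<in> hol X U"
  using mult_hol[of U f "\<lambda>_. - 1"] const_hol[of U "- 1"] by (simp only: mult_minus1_right)

lemma diff_hol:
  "openin (ctop X) U \<Longrightarrow> restrict f U \<in> hol X U \<Longrightarrow> restrict g U \<in> hol X U \<Longrightarrow>
    (\<lambda>x\<in>U. f x - g x) \<in> hol X U"
  using add_hol[of U f "\<lambda>x. - g x"] uminus_hol[of U g] by (simp only: add_uminus_conv_diff)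

lemma sum_hol:
  assumes "openin (ctop X) U" "\<And>i. i < n \<Longrightarrow> restrict (f i) U \<in> hol X U"
  shows "(\<lambda>x\<in>U. \<Sum>i<(n::nat). f i x) \<in> hol X U"
  using assms(2)
proof (induction n)
  case 0
  then show ?case using const_hol[of U 0] assms(1) by (simp only: lessThan_0 sum.empty)
next
  case (Suc n)
  have "(\<lambda>x\<in>U. \<Sum>i<n. f i x) \<in> hol X U" by (rule Suc.IH) (rule Suc.prems[OF less_SucI])
  moreover have "restrict (f n) U \<in> hol X U" by (rule Suc.prems[OF lessI])
  ultimately show ?case using add_hol[OF assms(1), of "\<lambda>x. \<Sum>i<n. f i x" "f n"]
    by (simp only: sum.lessThan_Suc)
qed

lemma open_nonzero:
  assumes "openin (ctop X) U" "f \<in> hol X U"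
  shows "openin (ctop X) {x \<in> U. f x \<noteq> c}"
  using open_preimage[OF assms open_Compl[OF closed_singleton[of c]]] by simp

text \<open>
  The set where \<open>f\<close> does not vanish is open. Functions are compared off nowhere dense sets in this way.
\<close>

lemma zero_if_zero_densely:
  assumes "openin (ctop X) U" "f \<in> hol X U"
    and "\<And>W. openin (ctop X) W \<Longrightarrow> W \<subseteq> U \<Longrightarrow> W \<noteq> {} \<Longrightarrow> \<exists>w\<in>W. f w = 0"
    and "x \<in> U"
  shows "f x = 0"
proof (rule ccontr)
  assume "f x \<noteq> 0"
  then have "{x \<in> U. f x \<noteq> 0} \<noteq> {}" using assms(4) by blast
  then show False using assms(3)[OF open_nonzero[OF assms(1,2), of 0]] by blast
qed

end


section \<open>Normality in terms of functions\<close>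

text \<open>
  This is the condition that the germ of \<open>g\<close> at \<open>x\<close> is not a zero divisor in the stalk, with the
  germs replaced by functions on neighbourhoods.
\<close>

definition regular_germ :: "'a fspace \<Rightarrow> 'a \<Rightarrow> 'a set \<Rightarrow> ('a \<Rightarrow> complex) \<Rightarrow> bool" where
  "regular_germ X x U g \<longleftrightarrow>
    (\<forall>W c. openin (ctop X) W \<longrightarrow> x \<in> W \<longrightarrow> W \<subseteq> U \<longrightarrow> c \<in> hol X W \<longrightarrow> (\<forall>y\<in>W. c y * g y = 0) \<longrightarrow>
      (\<exists>W'. openin (ctop X) W' \<and> x \<in> W' \<and> W' \<subseteq> W \<and> (\<forall>y\<in>W'. c y = 0)))"

locale holomorphic_space_point = holomorphic_space X for X :: "'a fspace" +
  fixes x :: 'a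
  assumes point: "x \<in> topspace (ctop X)"
begin

abbreviation nbhd :: "'a set \<Rightarrow> bool" where
  "nbhd U \<equiv> openin (ctop X) U \<and> x \<in> U"

lemma nbhd_topspace: "nbhd (topspace (ctop X))"
  using point by simp

lemma germ_mem_iff:
  "(V, g) \<in> germ X x U f \<longleftrightarrow> nbhd V \<and> g \<in> hol X V \<and>
    (\<exists>W. nbhd W \<and> W \<subseteq> U \<and> W \<subseteq> V \<and> (\<forall>y\<in>W. f y = g y))"
  unfolding germ_def by simp

lemma germ_mem_hol:
  "(V, g) \<in> germ X x U f \<Longrightarrow> nbhd V \<and> g \<in> hol X V"
  by (simp add: germ_mem_iff)

lemma germ_mem_agree:
  assumes "(V, g) \<in> germ X x U f"
  obtains W where "nbhd W" "W \<subseteq> U" "W \<subseteq> V" "\<forall>y\<in>W. f y = g y"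
  using assms unfolding germ_mem_iff by (elim conjE exE) simp

lemma germ_self: "nbhd U \<Longrightarrow> f \<in> hol X U \<Longrightarrow> (U, f) \<in> germ X x U f"
  unfolding germ_mem_iff by (intro conjI exI[of _ U]) simp_all

lemma germ_subset_if_agree:
  assumes W: "nbhd W" "W \<subseteq> V" "\<forall>y\<in>W. f y = g y"
  shows "germ X x U f \<subseteq> germ X x V g"
proof
  fix p assume p: "p \<in> germ X x U f"
  obtain V' k where pk: "p = (V', k)" by fastforce
  then have k: "nbhd V'" "k \<in> hol X V'" using p germ_mem_hol by blast+
  obtain T where T: "nbhd T" "T \<subseteq> U" "T \<subseteq> V'" "\<forall>y\<in>T. f y = k y"
    using p unfolding pk by (rule germ_mem_agree)
  have "nbhd (T \<inter> W)" "T \<inter> W \<subseteq> V" "T \<inter> W \<subseteq> V'" "\<forall>y\<in>T \<inter> W. g y = k y"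
    using T W by auto
  then show "p \<in> germ X x V g"
    unfolding pk germ_mem_iff using k by (intro conjI exI[of _ "T \<inter> W"]) simp_all
qed

lemma germ_eq_iff:
  assumes "nbhd U" "f \<in> hol X U" "nbhd V" "g \<in> hol X V"
  shows "germ X x U f = germ X x V g \<longleftrightarrow> (\<exists>W. nbhd W \<and> W \<subseteq> U \<inter> V \<and> (\<forall>y\<in>W. f y = g y))"
proof
  assume eq: "germ X x U f = germ X x V g"
  have "(V, g) \<in> germ X x U f"
    unfolding eq using assms germ_self by simp
  then obtain W where "nbhd W" "W \<subseteq> U" "W \<subseteq> V" "\<forall>y\<in>W. f y = g y" by (rule germ_mem_agree)
  then show "\<exists>W. nbhd W \<and> W \<subseteq> U \<inter> V \<and> (\<forall>y\<in>W. f y = g y)"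
    by (intro exI[of _ W]) simp
next
  assume "\<exists>W. nbhd W \<and> W \<subseteq> U \<inter> V \<and> (\<forall>y\<in>W. f y = g y)"
  then obtain W where W: "nbhd W" "W \<subseteq> U" "W \<subseteq> V" "\<forall>y\<in>W. f y = g y" by auto
  then have "\<forall>y\<in>W. g y = f y" by simp
  with W show "germ X x U f = germ X x V g"
    using germ_subset_if_agree[of W V f g U] germ_subset_if_agree[of W U g f V] by blast
qed

lemma germ_restrict:
  assumes "nbhd U" "f \<in> hol X U" "nbhd V" "V \<subseteq> U"
  shows "germ X x V (restrict f V) = germ X x U f"
  using assms by (subst germ_eq_iff) (auto simp: restrict_hol intro!: exI[of _ V])

lemma germ_carrier: "nbhd U \<Longrightarrow> f \<in> hol X U \<Longrightarrow> germ X x U f \<in> carrier (stalk X x)"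
  unfolding stalk_def by auto

lemma carrier_stalkE:
  assumes "a \<in> carrier (stalk X x)"
  obtains U f where "nbhd U" "f \<in> hol X U" "a = germ X x U f"
  using assms unfolding stalk_def by auto

lemma germ_add:
  assumes U: "nbhd U" and f: "f \<in> hol X U" and g: "g \<in> hol X U"
  shows "germ X x U f \<oplus>\<^bsub>stalk X x\<^esub> germ X x U g = germ X x U (\<lambda>y\<in>U. f y + g y)"
proof -
  have "(\<Union>(V, f')\<in>germ X x U f. \<Union>(W, g')\<in>germ X x U g.
      germ X x (V \<inter> W) (\<lambda>y\<in>V \<inter> W. f' y + g' y)) = germ X x U (\<lambda>y\<in>U. f y + g y)"
  proof (rule UN_pairs_constant)
    show "(U, f) \<in> germ X x U f" "(U, g) \<in> germ X x U g" using assms germ_self by auto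
    fix V f' W g' assume p: "(V, f') \<in> germ X x U f" "(W, g') \<in> germ X x U g"
    then have h: "nbhd (V \<inter> W)" "restrict f' (V \<inter> W) \<in> hol X (V \<inter> W)" "restrict g' (V \<inter> W) \<in> hol X (V \<inter> W)"
      using germ_mem_hol[OF p(1)] germ_mem_hol[OF p(2)]
      by (auto intro: restrict_hol[of V] restrict_hol[of W])
    from p(1) obtain S where S: "nbhd S" "S \<subseteq> U" "S \<subseteq> V" "\<forall>y\<in>S. f y = f' y" by (rule germ_mem_agree)
    from p(2) obtain T where T: "nbhd T" "T \<subseteq> U" "T \<subseteq> W" "\<forall>y\<in>T. g y = g' y" by (rule germ_mem_agree)
    have "\<exists>R. nbhd R \<and> R \<subseteq> (V \<inter> W) \<inter> U \<and> (\<forall>y\<in>R. (\<lambda>y\<in>V \<inter> W. f' y + g' y) y = (\<lambda>y\<in>U. f y + g y) y)"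
      using S T by (intro exI[of _ "S \<inter> T"]) auto
    then show "germ X x (V \<inter> W) (\<lambda>y\<in>V \<inter> W. f' y + g' y) = germ X x U (\<lambda>y\<in>U. f y + g y)"
      using h assms by (subst germ_eq_iff) (auto intro!: add_hol simp: restrict_hol_eq)
  qed
  then show ?thesis by (simp add: stalk_def)
qed

lemma germ_mult:
  assumes U: "nbhd U" and f: "f \<in> hol X U" and g: "g \<in> hol X U"
  shows "germ X x U f \<otimes>\<^bsub>stalk X x\<^esub> germ X x U g = germ X x U (\<lambda>y\<in>U. f y * g y)"
proof -
  have "(\<Union>(V, f')\<in>germ X x U f. \<Union>(W, g')\<in>germ X x U g.
      germ X x (V \<inter> W) (\<lambda>y\<in>V \<inter> W. f' y * g' y)) = germ X x U (\<lambda>y\<in>U. f y * g y)"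
  proof (rule UN_pairs_constant)
    show "(U, f) \<in> germ X x U f" "(U, g) \<in> germ X x U g" using assms germ_self by auto
    fix V f' W g' assume p: "(V, f') \<in> germ X x U f" "(W, g') \<in> germ X x U g"
    then have h: "nbhd (V \<inter> W)" "restrict f' (V \<inter> W) \<in> hol X (V \<inter> W)" "restrict g' (V \<inter> W) \<in> hol X (V \<inter> W)"
      using germ_mem_hol[OF p(1)] germ_mem_hol[OF p(2)]
      by (auto intro: restrict_hol[of V] restrict_hol[of W])
    from p(1) obtain S where S: "nbhd S" "S \<subseteq> U" "S \<subseteq> V" "\<forall>y\<in>S. f y = f' y" by (rule germ_mem_agree)
    from p(2) obtain T where T: "nbhd T" "T \<subseteq> U" "T \<subseteq> W" "\<forall>y\<in>T. g y = g' y" by (rule germ_mem_agree)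
    have "\<exists>R. nbhd R \<and> R \<subseteq> (V \<inter> W) \<inter> U \<and> (\<forall>y\<in>R. (\<lambda>y\<in>V \<inter> W. f' y * g' y) y = (\<lambda>y\<in>U. f y * g y) y)"
      using S T by (intro exI[of _ "S \<inter> T"]) auto
    then show "germ X x (V \<inter> W) (\<lambda>y\<in>V \<inter> W. f' y * g' y) = germ X x U (\<lambda>y\<in>U. f y * g y)"
      using h assms by (subst germ_eq_iff) (auto intro!: mult_hol simp: restrict_hol_eq)
  qed
  then show ?thesis by (simp add: stalk_def)
qed

lemma germ_const:
  assumes "nbhd U"
  shows "germ X x (topspace (ctop X)) (\<lambda>y\<in>topspace (ctop X). c) = germ X x U (\<lambda>y\<in>U. c)"
  using assms nbhd_topspace openin_subset[of "ctop X" U]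
  by (subst germ_eq_iff) (auto intro!: const_hol exI[of _ U])

lemma germ_one: "nbhd U \<Longrightarrow> \<one>\<^bsub>stalk X x\<^esub> = germ X x U (\<lambda>y\<in>U. 1)"
  using germ_const[of U 1] by (simp add: stalk_def)

lemma germ_zero: "nbhd U \<Longrightarrow> \<zero>\<^bsub>stalk X x\<^esub> = germ X x U (\<lambda>y\<in>U. 0)"
  using germ_const[of U 0] by (simp add: stalk_def)

text \<open>
  An integral equation involves finitely many germs, whose domains have a common neighbourhood.
\<close>

lemma stalk_common_nbhd:
  assumes "\<And>i. i < n \<Longrightarrow> a i \<in> carrier (stalk X x)"
  obtains U f where "nbhd U" "\<forall>i<(n::nat). f i \<in> hol X U \<and> a i = germ X x U (f i)"
proof -
  have "\<exists>U f. nbhd U \<and> (\<forall>i<n. f i \<in> hol X U \<and> a i = germ X x U (f i))"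
    using assms
  proof (induction n)
    case 0
    then show ?case using nbhd_topspace by blast
  next
    case (Suc n)
    then obtain U f where U: "nbhd U" and f: "\<forall>i<n. f i \<in> hol X U \<and> a i = germ X x U (f i)"
      by fastforce
    from Suc.prems[OF lessI] obtain V g where V: "nbhd V" and g: "g \<in> hol X V" "a n = germ X x V g"
      by (rule carrier_stalkE)
    let ?W = "U \<inter> V" and ?f = "\<lambda>i. if i = n then g else f i"
    have W: "nbhd ?W" using U V by auto
    have "restrict (?f i) ?W \<in> hol X ?W \<and> a i = germ X x ?W (restrict (?f i) ?W)" if "i < Suc n" for i
    proof (cases "i = n")
      case True
      then show ?thesis using g V W by (auto simp: germ_restrict intro!: restrict_hol[of V])
    next
      case False
      then have "f i \<in> hol X U" "a i = germ X x U (f i)" using f that by auto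
      then show ?thesis using False U W by (auto simp: germ_restrict intro!: restrict_hol[of U])
    qed
    then show ?case using W by (intro exI[of _ ?W] exI[of _ "\<lambda>i. restrict (?f i) ?W"]) blast
  qed
  then show ?thesis using that by blast
qed

lemma stalk_common_nbhd3:
  assumes "a \<in> carrier (stalk X x)" "b \<in> carrier (stalk X x)" "c \<in> carrier (stalk X x)"
  obtains U f g h where "nbhd U" "f \<in> hol X U" "g \<in> hol X U" "h \<in> hol X U"
    "a = germ X x U f" "b = germ X x U g" "c = germ X x U h"
proof -
  let ?a = "\<lambda>i. if i = 0 then a else if i = 1 then b else c"
  have "\<And>i. i < (3::nat) \<Longrightarrow> ?a i \<in> carrier (stalk X x)" using assms by simp
  then obtain U f where "nbhd U" "\<forall>i<3::nat. f i \<in> hol X U \<and> ?a i = germ X x U (f i)"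
    by (rule stalk_common_nbhd) blast
  from this(1) this(2)[rule_format, of 0] this(2)[rule_format, of 1] this(2)[rule_format, of 2]
  show ?thesis using that[of U "f 0" "f 1" "f 2"] by simp
qed

text \<open>
  The ring axioms hold for functions on a common neighbourhood and are carried over by taking germs.
\<close>

lemma cring_stalk: "cring (stalk X x)"
proof (rule cringI)
  let ?R = "stalk X x"
  have A: "(\<lambda>y\<in>U. f y + g y) \<in> hol X U" if "nbhd U" "f \<in> hol X U" "g \<in> hol X U" for U f g
    using that by (auto intro!: add_hol simp: restrict_hol_eq)
  have M: "(\<lambda>y\<in>U. f y * g y) \<in> hol X U" if "nbhd U" "f \<in> hol X U" "g \<in> hol X U" for U f g
    using that by (auto intro!: mult_hol simp: restrict_hol_eq)
  have C: "(\<lambda>y\<in>U. c) \<in> hol X U" if "nbhd U" for U c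
    using that const_hol by blast
  show "abelian_group ?R"
  proof (rule abelian_groupI)
    fix a b c assume "a \<in> carrier ?R" "b \<in> carrier ?R" "c \<in> carrier ?R"
    then obtain U f g h where U: "nbhd U" "f \<in> hol X U" "g \<in> hol X U" "h \<in> hol X U"
      "a = germ X x U f" "b = germ X x U g" "c = germ X x U h" by (rule stalk_common_nbhd3)
    show "a \<oplus>\<^bsub>?R\<^esub> b \<in> carrier ?R" using U by (simp only: germ_add A germ_carrier)
    show "(a \<oplus>\<^bsub>?R\<^esub> b) \<oplus>\<^bsub>?R\<^esub> c = a \<oplus>\<^bsub>?R\<^esub> (b \<oplus>\<^bsub>?R\<^esub> c)"
      using U by (simp only: germ_add A)
        (rule arg_cong[where f = "germ X x U"], rule restrict_ext, simp)
    show "a \<oplus>\<^bsub>?R\<^esub> b = b \<oplus>\<^bsub>?R\<^esub> a"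
      using U by (simp only: germ_add)
        (rule arg_cong[where f = "germ X x U"], rule restrict_ext, simp)
  next
    show "\<zero>\<^bsub>?R\<^esub> \<in> carrier ?R"
      unfolding germ_zero[OF nbhd_topspace] by (rule germ_carrier[OF nbhd_topspace C[OF nbhd_topspace]])
    fix a assume "a \<in> carrier ?R"
    then obtain U f where U: "nbhd U" "f \<in> hol X U" "a = germ X x U f"
      by (rule carrier_stalkE)
    show "\<zero>\<^bsub>?R\<^esub> \<oplus>\<^bsub>?R\<^esub> a = a"
      unfolding germ_zero[OF U(1)] U(3) germ_add[OF U(1) C[OF U(1)] U(2)]
      by (rule arg_cong[where f = "germ X x U"], subst (3) restrict_hol_eq[symmetric])
        (use U in \<open>auto intro: restrict_ext\<close>)
    have m: "(\<lambda>y\<in>U. - f y) \<in> hol X U" using U by (auto intro!: uminus_hol simp: restrict_hol_eq)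
    have "germ X x U (\<lambda>y\<in>U. - f y) \<oplus>\<^bsub>?R\<^esub> a = \<zero>\<^bsub>?R\<^esub>"
      unfolding germ_zero[OF U(1)] U(3) germ_add[OF U(1) m U(2)]
      by (rule arg_cong[where f = "germ X x U"], rule restrict_ext, simp)
    then show "\<exists>b\<in>carrier ?R. b \<oplus>\<^bsub>?R\<^esub> a = \<zero>\<^bsub>?R\<^esub>"
      using germ_carrier[OF U(1) m] by blast
  qed
  show "comm_monoid ?R"
  proof (rule comm_monoidI)
    fix a b c assume "a \<in> carrier ?R" "b \<in> carrier ?R" "c \<in> carrier ?R"
    then obtain U f g h where U: "nbhd U" "f \<in> hol X U" "g \<in> hol X U" "h \<in> hol X U"
      "a = germ X x U f" "b = germ X x U g" "c = germ X x U h" by (rule stalk_common_nbhd3)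
    show "a \<otimes>\<^bsub>?R\<^esub> b \<in> carrier ?R" using U by (simp only: germ_mult M germ_carrier)
    show "(a \<otimes>\<^bsub>?R\<^esub> b) \<otimes>\<^bsub>?R\<^esub> c = a \<otimes>\<^bsub>?R\<^esub> (b \<otimes>\<^bsub>?R\<^esub> c)"
      using U by (simp only: germ_mult M)
        (rule arg_cong[where f = "germ X x U"], rule restrict_ext, simp)
    show "a \<otimes>\<^bsub>?R\<^esub> b = b \<otimes>\<^bsub>?R\<^esub> a"
      using U by (simp only: germ_mult)
        (rule arg_cong[where f = "germ X x U"], rule restrict_ext, simp)
  next
    show "\<one>\<^bsub>?R\<^esub> \<in> carrier ?R"
      unfolding germ_one[OF nbhd_topspace] by (rule germ_carrier[OF nbhd_topspace C[OF nbhd_topspace]])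
    fix a assume "a \<in> carrier ?R"
    then obtain U f where U: "nbhd U" "f \<in> hol X U" "a = germ X x U f"
      by (rule carrier_stalkE)
    show "\<one>\<^bsub>?R\<^esub> \<otimes>\<^bsub>?R\<^esub> a = a"
      unfolding germ_one[OF U(1)] U(3) germ_mult[OF U(1) C[OF U(1)] U(2)]
      by (rule arg_cong[where f = "germ X x U"], subst (3) restrict_hol_eq[symmetric])
        (use U in \<open>auto intro: restrict_ext\<close>)
  qed
  fix a b c assume "a \<in> carrier ?R" "b \<in> carrier ?R" "c \<in> carrier ?R"
  then obtain U f g h where U: "nbhd U" "f \<in> hol X U" "g \<in> hol X U" "h \<in> hol X U"
    "a = germ X x U f" "b = germ X x U g" "c = germ X x U h" by (rule stalk_common_nbhd3)
  show "(a \<oplus>\<^bsub>?R\<^esub> b) \<otimes>\<^bsub>?R\<^esub> c = a \<otimes>\<^bsub>?R\<^esub> c \<oplus>\<^bsub>?R\<^esub> b \<otimes>\<^bsub>?R\<^esub> c"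
    using U by (simp only: germ_add germ_mult A M)
      (rule arg_cong[where f = "germ X x U"], rule restrict_ext, simp add: distrib_right)
qed

lemma germ_pow:
  assumes "nbhd U" "f \<in> hol X U"
  shows "germ X x U f [^]\<^bsub>stalk X x\<^esub> (n::nat) = germ X x U (\<lambda>y\<in>U. f y ^ n)"
proof (induction n)
  case 0
  show ?case unfolding nat_pow_0 power_0 by (rule germ_one[OF assms(1)])
next
  case (Suc n)
  have p: "(\<lambda>y\<in>U. f y ^ n) \<in> hol X U" using assms by (auto intro!: pow_hol simp: restrict_hol_eq)
  have "(\<lambda>y\<in>U. (\<lambda>y\<in>U. f y ^ n) y * f y) = (\<lambda>y\<in>U. f y ^ Suc n)"
    by (rule restrict_ext) (simp add: mult.commute)
  then show ?case
    unfolding nat_pow_Suc Suc.IH germ_mult[OF assms(1) p assms(2)] by (rule arg_cong)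
qed

lemma germ_finsum:
  assumes U: "nbhd U" and "\<And>i. i < (n::nat) \<Longrightarrow> f i \<in> hol X U"
  shows "(\<Oplus>\<^bsub>stalk X x\<^esub>i\<in>{..<n}. germ X x U (f i)) = germ X x U (\<lambda>y\<in>U. \<Sum>i<n. f i y)"
  using assms(2)
proof (induction n)
  case 0
  interpret R: cring "stalk X x" by (rule cring_stalk)
  show ?case using germ_zero[OF U] by (simp only: lessThan_0 R.finsum_empty sum.empty)
next
  case (Suc n)
  interpret R: cring "stalk X x" by (rule cring_stalk)
  have s: "(\<lambda>y\<in>U. \<Sum>i<n. f i y) \<in> hol X U"
    using U Suc.prems by (intro sum_hol) (simp_all only: restrict_hol_eq less_Suc_eq simp_thms)
  have fn: "f n \<in> hol X U" using Suc.prems by simp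
  have IH: "(\<Oplus>\<^bsub>stalk X x\<^esub>i\<in>{..<n}. germ X x U (f i)) = germ X x U (\<lambda>y\<in>U. \<Sum>i<n. f i y)"
    by (rule Suc.IH) (rule Suc.prems[OF less_SucI])
  have "(\<Oplus>\<^bsub>stalk X x\<^esub>i\<in>{..<Suc n}. germ X x U (f i)) =
      germ X x U (f n) \<oplus>\<^bsub>stalk X x\<^esub> (\<Oplus>\<^bsub>stalk X x\<^esub>i\<in>{..<n}. germ X x U (f i))"
    unfolding lessThan_Suc using U Suc.prems
    by (intro R.finsum_insert) (auto simp: germ_carrier)
  also have "\<dots> = germ X x U (\<lambda>y\<in>U. f n y + (\<lambda>y\<in>U. \<Sum>i<n. f i y) y)"
    unfolding IH by (rule germ_add[OF U fn s])
  also have "(\<lambda>y\<in>U. f n y + (\<lambda>y\<in>U. \<Sum>i<n. f i y) y) = (\<lambda>y\<in>U. \<Sum>i<Suc n. f i y)"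
    by (rule restrict_ext) simp
  finally show ?case .
qed

lemma germ_non_zero_divisor_iff:
  assumes U: "nbhd U" and g: "g \<in> hol X U"
  shows "germ X x U g \<in> non_zero_divisors (stalk X x) \<longleftrightarrow> regular_germ X x U g"
proof
  let ?R = "stalk X x"
  assume nzd: "germ X x U g \<in> non_zero_divisors ?R"
  show "regular_germ X x U g"
    unfolding regular_germ_def
  proof (intro allI impI)
    fix W c assume W: "openin (ctop X) W" "x \<in> W" "W \<subseteq> U" and c: "c \<in> hol X W"
      and eq: "\<forall>y\<in>W. c y * g y = 0"
    have gW: "germ X x U g = germ X x W (restrict g W)" "restrict g W \<in> hol X W"
      using germ_restrict[of U g W] restrict_hol[of U W g] U g W by simp_all
    have "germ X x W c \<otimes>\<^bsub>?R\<^esub> germ X x U g = germ X x W (\<lambda>y\<in>W. c y * restrict g W y)"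
      using W c gW by (simp add: germ_mult)
    also have "(\<lambda>y\<in>W. c y * restrict g W y) = (\<lambda>y\<in>W. 0)" using eq by (auto intro!: restrict_ext)
    finally have "germ X x W c \<otimes>\<^bsub>?R\<^esub> germ X x U g = \<zero>\<^bsub>?R\<^esub>"
      using W germ_zero[of W] by (simp only: simp_thms)
    then have "germ X x W c = \<zero>\<^bsub>?R\<^esub>"
      using nzd germ_carrier[of W c] W c unfolding non_zero_divisors_def by simp
    then have "germ X x W c = germ X x W (\<lambda>y\<in>W. 0)" using W germ_zero[of W] by (simp only: simp_thms)
    then obtain W' where "nbhd W'" "W' \<subseteq> W" "\<forall>y\<in>W'. c y = (\<lambda>y\<in>W. 0) y"
      unfolding germ_eq_iff[OF conjI[OF W(1,2)] c conjI[OF W(1,2)] const_hol[OF W(1), of 0]]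
      by (elim exE conjE) simp
    then show "\<exists>W'. openin (ctop X) W' \<and> x \<in> W' \<and> W' \<subseteq> W \<and> (\<forall>y\<in>W'. c y = 0)"
      by (intro exI[of _ W']) (simp add: subset_iff)
  qed
next
  let ?R = "stalk X x"
  assume reg: "regular_germ X x U g"
  have "a = \<zero>\<^bsub>?R\<^esub>" if a: "a \<in> carrier ?R" "a \<otimes>\<^bsub>?R\<^esub> germ X x U g = \<zero>\<^bsub>?R\<^esub>" for a
  proof -
    obtain V c where V: "nbhd V" and c: "c \<in> hol X V" and ac: "a = germ X x V c"
      using a(1) by (rule carrier_stalkE)
    let ?W = "U \<inter> V"
    have W: "nbhd ?W" using U V by auto
    have cW: "restrict c ?W \<in> hol X ?W" "restrict g ?W \<in> hol X ?W"
      using U V c g W by (auto intro: restrict_hol[of V] restrict_hol[of U])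
    have "germ X x ?W (\<lambda>y\<in>?W. restrict c ?W y * restrict g ?W y) =
        germ X x ?W (restrict c ?W) \<otimes>\<^bsub>?R\<^esub> germ X x ?W (restrict g ?W)"
      by (rule germ_mult[OF W cW, symmetric])
    also have "\<dots> = a \<otimes>\<^bsub>?R\<^esub> germ X x U g"
      unfolding ac germ_restrict[OF V c W Int_lower2] germ_restrict[OF U g W Int_lower1] ..
    also have "\<dots> = germ X x ?W (\<lambda>y\<in>?W. 0)"
      unfolding a(2) by (rule germ_zero[OF W])
    finally have "germ X x ?W (\<lambda>y\<in>?W. restrict c ?W y * restrict g ?W y) = germ X x ?W (\<lambda>y\<in>?W. 0)" .
    moreover have "(\<lambda>y\<in>?W. restrict c ?W y * restrict g ?W y) \<in> hol X ?W"
      using W cW by (intro mult_hol) (simp_all only: restrict_hol_eq)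
    moreover have "(\<lambda>y\<in>?W. 0) \<in> hol X ?W" using W const_hol by blast
    ultimately have "\<exists>S. nbhd S \<and> S \<subseteq> ?W \<inter> ?W \<and>
        (\<forall>y\<in>S. (\<lambda>y\<in>?W. restrict c ?W y * restrict g ?W y) y = (\<lambda>y\<in>?W. 0) y)"
      by (intro germ_eq_iff[OF W _ W, THEN iffD1])
    then obtain S where S: "nbhd S" "S \<subseteq> ?W \<inter> ?W"
        "\<forall>y\<in>S. (\<lambda>y\<in>?W. restrict c ?W y * restrict g ?W y) y = (\<lambda>y\<in>?W. 0) y"
      by (elim exE conjE) simp
    have cg: "c y * g y = 0" if "y \<in> S" for y
      using S(3)[rule_format, OF that] subsetD[OF S(2) that] by simp
    have "restrict c S \<in> hol X S" using S V c by (auto intro!: restrict_hol[of V])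
    moreover have "\<forall>y\<in>S. restrict c S y * g y = 0" using cg by simp
    moreover have "S \<subseteq> U" using S by blast
    ultimately obtain T where T: "nbhd T" "T \<subseteq> S" "\<forall>y\<in>T. restrict c S y = 0"
      using reg[unfolded regular_germ_def, rule_format, of S "restrict c S"] S(1) by blast
    have "T \<subseteq> V \<inter> V" using T(2) S(2) by blast
    moreover have "c y = (\<lambda>y\<in>V. 0) y" if "y \<in> T" for y
      using T(3)[rule_format, OF that] subsetD[OF T(2) that] subsetD[OF S(2)] by simp
    moreover have "(\<lambda>y\<in>V. 0) \<in> hol X V" using V const_hol by blast
    ultimately have "germ X x V c = germ X x V (\<lambda>y\<in>V. 0)"
      using T(1) by (subst germ_eq_iff[OF V c V]) (assumption, intro exI[of _ T], simp)
    then show ?thesis using ac germ_zero[OF V] by (simp only:)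
  qed
  then show "germ X x U g \<in> non_zero_divisors ?R"
    using germ_carrier[OF U g] by (auto simp: non_zero_divisors_def)
qed

lemma germ_integral_equation_iff:
  assumes "nbhd U" "f \<in> hol X U" "g \<in> hol X U" "\<And>i. i < n \<Longrightarrow> u i \<in> hol X U"
  shows "germ X x U f [^]\<^bsub>stalk X x\<^esub> n \<oplus>\<^bsub>stalk X x\<^esub>
      (\<Oplus>\<^bsub>stalk X x\<^esub>i\<in>{..<n}. germ X x U (u i) \<otimes>\<^bsub>stalk X x\<^esub>
        (germ X x U f [^]\<^bsub>stalk X x\<^esub> i \<otimes>\<^bsub>stalk X x\<^esub> germ X x U g [^]\<^bsub>stalk X x\<^esub> (n - i))) = \<zero>\<^bsub>stalk X x\<^esub> \<longleftrightarrow>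
    (\<exists>W. nbhd W \<and> W \<subseteq> U \<and>
      (\<forall>y\<in>W. f y ^ n + (\<Sum>i<(n::nat). u i y * (f y ^ i * g y ^ (n - i))) = 0))"
proof -
  let ?R = "stalk X x"
  interpret R: cring ?R by (rule cring_stalk)
  let ?t = "\<lambda>i. \<lambda>y\<in>U. u i y * (f y ^ i * g y ^ (n - i))"
  have t: "?t i \<in> hol X U" if "i < n" for i
    using assms that by (auto intro!: mult_hol pow_hol simp: restrict_hol_eq)
  have s: "(\<lambda>y\<in>U. \<Sum>i<n. ?t i y) \<in> hol X U"
    using assms(1) t by (intro sum_hol) (simp_all only: restrict_hol_eq)
  have "(\<Oplus>\<^bsub>?R\<^esub>i\<in>{..<n}. germ X x U (u i) \<otimes>\<^bsub>?R\<^esub> (germ X x U f [^]\<^bsub>?R\<^esub> i \<otimes>\<^bsub>?R\<^esub> germ X x U g [^]\<^bsub>?R\<^esub> (n - i)))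
      = (\<Oplus>\<^bsub>?R\<^esub>i\<in>{..<n}. germ X x U (?t i))"
  proof (rule R.finsum_cong')
    show "(\<lambda>i. germ X x U (?t i)) \<in> {..<n} \<rightarrow> carrier ?R"
      using assms t by (auto simp: germ_carrier)
    fix i assume i: "i \<in> {..<n}"
    have "(\<lambda>y\<in>U. f y ^ i) \<in> hol X U" "(\<lambda>y\<in>U. g y ^ (n - i)) \<in> hol X U"
      "(\<lambda>y\<in>U. f y ^ i * g y ^ (n - i)) \<in> hol X U"
      using assms by (auto intro!: mult_hol pow_hol simp: restrict_hol_eq)
    then show "germ X x U (u i) \<otimes>\<^bsub>?R\<^esub> (germ X x U f [^]\<^bsub>?R\<^esub> i \<otimes>\<^bsub>?R\<^esub> germ X x U g [^]\<^bsub>?R\<^esub> (n - i)) = germ X x U (?t i)"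
      using assms i by (simp add: germ_pow germ_mult cong: restrict_cong)
  qed simp
  also have "\<dots> = germ X x U (\<lambda>y\<in>U. \<Sum>i<n. ?t i y)"
    using assms t by (intro germ_finsum) auto
  finally have sum: "(\<Oplus>\<^bsub>?R\<^esub>i\<in>{..<n}. germ X x U (u i) \<otimes>\<^bsub>?R\<^esub>
      (germ X x U f [^]\<^bsub>?R\<^esub> i \<otimes>\<^bsub>?R\<^esub> germ X x U g [^]\<^bsub>?R\<^esub> (n - i))) = germ X x U (\<lambda>y\<in>U. \<Sum>i<n. ?t i y)" .
  have p: "(\<lambda>y\<in>U. f y ^ n) \<in> hol X U" using assms by (auto intro!: pow_hol simp: restrict_hol_eq)
  have ps: "(\<lambda>y\<in>U. (\<lambda>y\<in>U. f y ^ n) y + (\<lambda>y\<in>U. \<Sum>i<n. ?t i y) y) \<in> hol X U"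
    using assms(1) p s by (intro add_hol) (simp_all only: restrict_hol_eq)
  have z: "(\<lambda>y\<in>U. 0) \<in> hol X U" using assms(1) const_hol by blast
  show ?thesis
    unfolding sum
    unfolding germ_pow[OF assms(1,2)] germ_add[OF assms(1) p s] germ_zero[OF assms(1)]
      germ_eq_iff[OF assms(1) ps assms(1) z]
    by (rule arg_cong[where f = Ex], rule ext) (auto simp: subset_iff)
qed

text \<open>
  Integral equations, fractions and zero divisors of germs are spelled out in terms of functions on
  neighbourhoods: finitely many germs live on a common neighbourhood, and a shrinking of it turns an
  equation between germs into an equation between functions.
\<close>

lemma integrally_closed_stalk_iff:
  "integrally_closed (stalk X x) \<longleftrightarrow>
    (\<forall>U f g (n::nat) u. nbhd U \<longrightarrow> f \<in> hol X U \<longrightarrow> g \<in> hol X U \<longrightarrow> (\<forall>i<n. u i \<in> hol X U) \<longrightarrow>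
      regular_germ X x U g \<longrightarrow>
      (\<forall>y\<in>U. f y ^ n + (\<Sum>i<n. u i y * (f y ^ i * g y ^ (n - i))) = 0) \<longrightarrow>
      (\<exists>W h. nbhd W \<and> W \<subseteq> U \<and> h \<in> hol X W \<and> (\<forall>y\<in>W. f y = h y * g y)))"
  (is "_ \<longleftrightarrow> ?rhs")
proof
  let ?R = "stalk X x"
  interpret R: cring ?R by (rule cring_stalk)
  {
    assume ic: "integrally_closed ?R"
    show ?rhs
    proof (intro allI impI)
      fix U f g u and n :: nat
      assume U: "nbhd U" and f: "f \<in> hol X U" and g: "g \<in> hol X U" and u: "\<forall>i<n. u i \<in> hol X U"
        and reg: "regular_germ X x U g"
        and eq: "\<forall>y\<in>U. f y ^ n + (\<Sum>i<n. u i y * (f y ^ i * g y ^ (n - i))) = 0"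
      have "germ X x U f [^]\<^bsub>?R\<^esub> n \<oplus>\<^bsub>?R\<^esub> (\<Oplus>\<^bsub>?R\<^esub>i\<in>{..<n}. germ X x U (u i) \<otimes>\<^bsub>?R\<^esub>
          (germ X x U f [^]\<^bsub>?R\<^esub> i \<otimes>\<^bsub>?R\<^esub> germ X x U g [^]\<^bsub>?R\<^esub> (n - i))) = \<zero>\<^bsub>?R\<^esub>"
        using u eq U
        by (subst germ_integral_equation_iff[OF U f g]) (simp, intro exI[of _ U], simp)
      then have "\<exists>c\<in>carrier ?R. germ X x U f = c \<otimes>\<^bsub>?R\<^esub> germ X x U g"
        by (rule ic[unfolded R.integrally_closed_iff, rule_format, OF germ_carrier[OF U f], rotated -1])
          (use germ_non_zero_divisor_iff[OF U g] reg U u germ_carrier in simp_all)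
      then obtain c where "c \<in> carrier ?R" and c: "germ X x U f = c \<otimes>\<^bsub>?R\<^esub> germ X x U g"
        by (elim bexE)
      from this(1) obtain V h where V: "nbhd V" and h: "h \<in> hol X V" and "c = germ X x V h"
        by (rule carrier_stalkE)
      then have fh: "germ X x U f = germ X x V h \<otimes>\<^bsub>?R\<^esub> germ X x U g" using c by simp
      let ?W = "U \<inter> V"
      have W: "nbhd ?W" using U V by auto
      have hW: "restrict h ?W \<in> hol X ?W" "restrict g ?W \<in> hol X ?W"
        using U V h g W by (auto intro: restrict_hol[of V] restrict_hol[of U])
      have "germ X x U f = germ X x ?W (restrict h ?W) \<otimes>\<^bsub>?R\<^esub> germ X x ?W (restrict g ?W)"
        unfolding fh germ_restrict[OF V h W Int_lower2] germ_restrict[OF U g W Int_lower1] ..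
      also have "\<dots> = germ X x ?W (\<lambda>y\<in>?W. restrict h ?W y * restrict g ?W y)"
        by (rule germ_mult[OF W hW])
      finally have "germ X x U f = germ X x ?W (\<lambda>y\<in>?W. restrict h ?W y * restrict g ?W y)" .
      moreover have "(\<lambda>y\<in>?W. restrict h ?W y * restrict g ?W y) \<in> hol X ?W"
        using W hW by (intro mult_hol) (simp_all only: restrict_hol_eq)
      ultimately have "\<exists>S. nbhd S \<and> S \<subseteq> U \<inter> ?W \<and>
          (\<forall>y\<in>S. f y = (\<lambda>y\<in>?W. restrict h ?W y * restrict g ?W y) y)"
        by (intro germ_eq_iff[OF U f W, THEN iffD1])
      then obtain S where S: "nbhd S" "S \<subseteq> U \<inter> ?W"
          "\<forall>y\<in>S. f y = (\<lambda>y\<in>?W. restrict h ?W y * restrict g ?W y) y"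
        by (elim exE conjE) simp
      have hS: "restrict h S \<in> hol X S" using S V h by (auto intro!: restrict_hol[of V])
      have "f y = restrict h S y * g y" if "y \<in> S" for y
        using S(3)[rule_format, OF that] subsetD[OF S(2) that] that by simp
      then show "\<exists>W h. nbhd W \<and> W \<subseteq> U \<and> h \<in> hol X W \<and> (\<forall>y\<in>W. f y = h y * g y)"
        using S(1,2) hS by (intro exI[of _ S] exI[of _ "restrict h S"]) simp
    qed
  next
    assume crit: ?rhs
    show "integrally_closed ?R"
      unfolding R.integrally_closed_iff
    proof (intro ballI allI impI)
      fix a b v and n :: nat
      assume a: "a \<in> carrier ?R" and b: "b \<in> non_zero_divisors ?R" and v: "\<forall>i<n. v i \<in> carrier ?R"
        and eq: "a [^]\<^bsub>?R\<^esub> n \<oplus>\<^bsub>?R\<^esub> (\<Oplus>\<^bsub>?R\<^esub>i\<in>{..<n}. v i \<otimes>\<^bsub>?R\<^esub> (a [^]\<^bsub>?R\<^esub> i \<otimes>\<^bsub>?R\<^esub> b [^]\<^bsub>?R\<^esub> (n - i))) = \<zero>\<^bsub>?R\<^esub>"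
      \<comment> \<open>The indices \<open>n\<close> and \<open>Suc n\<close> carry the numerator and the denominator.\<close>
      let ?a = "\<lambda>i. if i < n then v i else if i = n then a else b"
      have "\<And>i. i < Suc (Suc n) \<Longrightarrow> ?a i \<in> carrier ?R"
        using a v R.non_zero_divisors_closed[OF b] by simp
      then obtain U w where U: "nbhd U" and
          w: "\<forall>i<Suc (Suc n). w i \<in> hol X U \<and> ?a i = germ X x U (w i)"
        by (rule stalk_common_nbhd) blast
      define f where "f = w n"
      define g where "g = w (Suc n)"
      have fg: "f \<in> hol X U" "g \<in> hol X U" "a = germ X x U f" "b = germ X x U g"
        using w[rule_format, of n] w[rule_format, of "Suc n"] by (auto simp: f_def g_def)
      have vw: "w i \<in> hol X U" "v i = germ X x U (w i)" if "i < n" for i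
        using w[rule_format, of i] that by auto
      have sum_eq: "(\<Oplus>\<^bsub>?R\<^esub>i\<in>{..<n}. v i \<otimes>\<^bsub>?R\<^esub> (a [^]\<^bsub>?R\<^esub> i \<otimes>\<^bsub>?R\<^esub> b [^]\<^bsub>?R\<^esub> (n - i))) =
          (\<Oplus>\<^bsub>?R\<^esub>i\<in>{..<n}. germ X x U (w i) \<otimes>\<^bsub>?R\<^esub> (a [^]\<^bsub>?R\<^esub> i \<otimes>\<^bsub>?R\<^esub> b [^]\<^bsub>?R\<^esub> (n - i)))"
        using v a R.non_zero_divisors_closed[OF b]
        by (intro R.finsum_cong') (auto simp: Pi_def simp flip: vw(2))
      have "germ X x U f [^]\<^bsub>?R\<^esub> n \<oplus>\<^bsub>?R\<^esub> (\<Oplus>\<^bsub>?R\<^esub>i\<in>{..<n}. germ X x U (w i) \<otimes>\<^bsub>?R\<^esub>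
          (germ X x U f [^]\<^bsub>?R\<^esub> i \<otimes>\<^bsub>?R\<^esub> germ X x U g [^]\<^bsub>?R\<^esub> (n - i))) = \<zero>\<^bsub>?R\<^esub>"
        using eq unfolding sum_eq unfolding fg(3,4) .
      then have "\<exists>W. nbhd W \<and> W \<subseteq> U \<and>
          (\<forall>y\<in>W. f y ^ n + (\<Sum>i<n. w i y * (f y ^ i * g y ^ (n - i))) = 0)"
        by (rule germ_integral_equation_iff[OF U fg(1,2) vw(1), THEN iffD1, rotated -1])
      then obtain W where W: "nbhd W" "W \<subseteq> U"
        and eqW: "\<forall>y\<in>W. f y ^ n + (\<Sum>i<n. w i y * (f y ^ i * g y ^ (n - i))) = 0"
        by (elim exE conjE) simp
      have rW: "restrict f W \<in> hol X W" "restrict g W \<in> hol X W"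
          "\<forall>i<n. restrict (w i) W \<in> hol X W"
        using U W fg vw by (auto intro!: restrict_hol[of U])
      have "germ X x W (restrict g W) \<in> non_zero_divisors ?R"
        using germ_restrict[OF U fg(2) W] b fg by simp
      then have "regular_germ X x W (restrict g W)"
        using germ_non_zero_divisor_iff[OF W(1) rW(2)] by blast
      moreover have "\<forall>y\<in>W. restrict f W y ^ n +
          (\<Sum>i<n. restrict (w i) W y * (restrict f W y ^ i * restrict g W y ^ (n - i))) = 0"
        using eqW by simp
      ultimately have "\<exists>S h. nbhd S \<and> S \<subseteq> W \<and> h \<in> hol X S \<and>
          (\<forall>y\<in>S. restrict f W y = h y * restrict g W y)"
        using crit[THEN spec[of _ W], THEN spec[of _ "restrict f W"], THEN spec[of _ "restrict g W"],
            THEN spec[of _ n], THEN spec[of _ "\<lambda>i. restrict (w i) W"]] W(1) rW by (elim impE)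
      then obtain S h where S: "nbhd S" "S \<subseteq> W" and h: "h \<in> hol X S"
          and fh: "\<forall>y\<in>S. restrict f W y = h y * restrict g W y"
        by (elim exE conjE) simp
      have gS: "restrict g S \<in> hol X S" using U S W fg by (auto intro!: restrict_hol[of U])
      have SU: "S \<subseteq> U" using S W by blast
      have "germ X x S h \<otimes>\<^bsub>?R\<^esub> b = germ X x S h \<otimes>\<^bsub>?R\<^esub> germ X x S (restrict g S)"
        unfolding germ_restrict[OF U fg(2) S(1) SU] fg(4) ..
      also have "\<dots> = germ X x S (\<lambda>y\<in>S. h y * restrict g S y)"
        by (rule germ_mult[OF S(1) h gS])
      also have "(\<lambda>y\<in>S. h y * restrict g S y) = restrict f S"
        using fh S(2) by (intro restrict_ext) (simp add: subset_iff)
      also have "germ X x S (restrict f S) = a"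
        unfolding germ_restrict[OF U fg(1) S(1) SU] fg(3) ..
      finally show "\<exists>c\<in>carrier ?R. a = c \<otimes>\<^bsub>?R\<^esub> b"
        using germ_carrier[OF S(1) h] by blast
    qed
  }
qed

end


section \<open>Vanishing and division on normal spaces\<close>

text \<open>
  Countable density is tested on open subsets of \<open>N\<close>, so that it passes to smaller sets \<open>N\<close> even
  when \<open>D\<close> is not contained in them.
\<close>

definition countably_dense_in :: "'a set \<Rightarrow> 'a topology \<Rightarrow> 'a set \<Rightarrow> bool" where
  "countably_dense_in D T N \<longleftrightarrow>
    countable D \<and> (\<forall>W. openin T W \<longrightarrow> W \<noteq> {} \<longrightarrow> W \<subseteq> N \<longrightarrow> W \<inter> D \<noteq> {})"

lemma countably_dense_in_subset:
  "countably_dense_in D T N \<Longrightarrow> N' \<subseteq> N \<Longrightarrow> countably_dense_in D T N'"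
  unfolding countably_dense_in_def by (meson order_trans)

context holomorphic_space
begin

text \<open>
  At a point where some \<open>a i\<close> does not vanish, the polynomial \<open>\<Sum>i<r. a i y * t ^ i\<close> in \<open>t\<close> has
  only finitely many roots. As a countable dense set has to be considered only, all but countably many
  \<open>t\<close> avoid all these roots.
\<close>

lemma generic_combination:
  fixes r :: nat
  assumes N: "openin (ctop X) N" and a: "\<forall>i<r. a i \<in> hol X N"
    and D: "countably_dense_in D (ctop X) N"
  obtains t :: complex where "\<And>V i y. openin (ctop X) V \<Longrightarrow> V \<subseteq> N \<Longrightarrow>
    \<forall>y\<in>V. (\<Sum>i<r. a i y * t ^ i) = 0 \<Longrightarrow> i < r \<Longrightarrow> y \<in> V \<Longrightarrow> a i y = 0"
proof -
  define D' where "D' = {d \<in> D. \<exists>i<r. a i d \<noteq> 0}"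
  define bad where "bad = (\<Union>d\<in>D'. {t. (\<Sum>i<r. a i d * t ^ i) = 0})"
  have "finite {t. (\<Sum>i<r. a i d * t ^ i) = 0}" if "d \<in> D'" for d
  proof -
    from that obtain k where k: "k < r" "a k d \<noteq> 0" unfolding D'_def by blast
    then obtain m where m: "r = Suc m" using less_imp_Suc_add by blast
    have "finite {t. (\<Sum>i\<le>m. a i d * t ^ i) = 0}"
      using k m polyfun_finite_roots[of "\<lambda>i. a i d" m] by (auto simp: less_Suc_eq_le)
    then show ?thesis unfolding m lessThan_Suc_atMost .
  qed
  moreover have "countable D'"
    using D unfolding D'_def countably_dense_in_def by (simp add: countable_Collect)
  ultimately have "countable bad"
    unfolding bad_def by (intro countable_UN) (auto intro: countable_finite)
  then have "bad \<noteq> UNIV" using uncountable_UNIV_complex by metis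
  then obtain t where t: "t \<notin> bad" by blast
  show ?thesis
  proof (rule that[of t], rule ccontr)
    fix V i y
    assume V: "openin (ctop X) V" "V \<subseteq> N" and z: "\<forall>y\<in>V. (\<Sum>i<r. a i y * t ^ i) = 0"
      and i: "i < r" and y: "y \<in> V" "a i y \<noteq> 0"
    let ?W = "V \<inter> {y \<in> N. a i y \<noteq> 0}"
    have "openin (ctop X) ?W" using V N a i open_nonzero by blast
    moreover have "?W \<noteq> {}" "?W \<subseteq> N" using V y by blast+
    ultimately have "?W \<inter> D \<noteq> {}" using D unfolding countably_dense_in_def by simp
    then obtain d where d: "d \<in> D" "d \<in> V" "a i d \<noteq> 0" by blast
    then have "t \<in> bad" using z i unfolding bad_def D'_def by blast
    then show False using t by contradiction
  qed
qed

text \<open>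
  Normality separates the part of the space where \<open>q\<close> vanishes from the rest. The functions \<open>a i\<close>
  generate the annihilator of \<open>q\<close>, and \<open>b\<close> is a generic combination of them. Then \<open>p = q + b\<close> is not a
  zero divisor at \<open>z\<close>: if \<open>c p = 0\<close>, then \<open>c q = c b = 0\<close>, so that \<open>c\<close> is a combination of the \<open>a i\<close>
  and \<open>b\<close> vanishes where \<open>c\<close> does not; there all \<open>a i\<close> vanish by genericity, and \<open>c\<close> with them.
  As \<open>q b = 0\<close>, the fraction \<open>b / p\<close> is a root of \<open>T\<^sup>2 - T\<close>, hence holomorphic by normality, and by
  continuity it is constantly \<open>1\<close> or \<open>0\<close> near \<open>z\<close>. In the first case \<open>q = 0\<close>; in the second
  \<open>b = 0\<close>, so the annihilator of \<open>q\<close> is trivial.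
\<close>

lemma zero_or_nonzero_densely:
  fixes r :: nat
  assumes normal: "integrally_closed (stalk X z)"
    and N: "openin (ctop X) N" and zN: "z \<in> N"
    and q: "q \<in> hol X N" and a: "\<forall>i<r. a i \<in> hol X N"
    and aq: "\<forall>i<r. \<forall>y\<in>N. a i y * q y = 0"
    and gen: "\<And>V c y. openin (ctop X) V \<Longrightarrow> V \<subseteq> N \<Longrightarrow> c \<in> hol X V \<Longrightarrow>
      \<forall>y\<in>V. c y * q y = 0 \<Longrightarrow> y \<in> V \<Longrightarrow>
      \<exists>W s. openin (ctop X) W \<and> y \<in> W \<and> W \<subseteq> V \<and> (\<forall>w\<in>W. c w = (\<Sum>i<r. s i w * a i w))"
    and D: "countably_dense_in D (ctop X) N"
  obtains N' where "openin (ctop X) N'" "z \<in> N'" "N' \<subseteq> N"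
    "(\<forall>y\<in>N'. q y = 0) \<or>
     (\<forall>W. openin (ctop X) W \<longrightarrow> W \<noteq> {} \<longrightarrow> W \<subseteq> N' \<longrightarrow> (\<exists>w\<in>W. q w \<noteq> 0))"
proof -
  have "z \<in> topspace (ctop X)" using openin_subset[OF N] zN by blast
  then interpret Z: holomorphic_space_point X z by unfold_locales
  obtain t :: complex where t: "\<And>V i y. openin (ctop X) V \<Longrightarrow> V \<subseteq> N \<Longrightarrow>
      \<forall>y\<in>V. (\<Sum>i<r. a i y * t ^ i) = 0 \<Longrightarrow> i < r \<Longrightarrow> y \<in> V \<Longrightarrow> a i y = 0"
    using generic_combination[OF N a D] by blast
  define b where "b = (\<lambda>y\<in>N. \<Sum>i<r. a i y * t ^ i)"
  define p where "p = (\<lambda>y\<in>N. q y + b y)"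
  have b: "b \<in> hol X N"
    unfolding b_def
  proof (rule sum_hol[OF N])
    fix i assume "i < r"
    then have "restrict (a i) N \<in> hol X N" using a N by (simp only: restrict_hol_eq)
    then show "(\<lambda>y\<in>N. a i y * t ^ i) \<in> hol X N" using N const_hol by (intro mult_hol)
  qed
  have p: "p \<in> hol X N" unfolding p_def using N q b by (intro add_hol) (simp_all only: restrict_hol_eq)
  have b_eq: "b y = (\<Sum>i<r. a i y * t ^ i)" if "y \<in> N" for y
    using that by (simp add: b_def)
  have p_eq: "p y = q y + b y" if "y \<in> N" for y using that by (simp add: p_def)
  have bq: "b y * q y = 0" if "y \<in> N" for y
  proof -
    have "b y * q y = (\<Sum>i<r. (a i y * q y) * t ^ i)"
      using that by (simp add: b_eq sum_distrib_right sum_distrib_left mult_ac)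
    then show ?thesis using aq that by simp
  qed
  have a_zero: "a i y = 0" if "openin (ctop X) V" "V \<subseteq> N" "\<forall>y\<in>V. b y = 0" "i < r" "y \<in> V" for V i y
  proof (rule t[OF that(1,2) _ that(4,5)])
    show "\<forall>y\<in>V. (\<Sum>i<r. a i y * t ^ i) = 0"
      using that(2,3) b_eq by (metis subsetD)
  qed
  \<comment> \<open>A function killing \<open>p\<close> kills \<open>q\<close> and \<open>b\<close>, as the supports of these are disjoint.\<close>
  have zero_if_p: "\<exists>W'. openin (ctop X) W' \<and> z \<in> W' \<and> W' \<subseteq> W \<and> (\<forall>y\<in>W'. c y = 0)"
    if W: "openin (ctop X) W" "z \<in> W" "W \<subseteq> N" and c: "c \<in> hol X W" and cp: "\<forall>y\<in>W. c y * p y = 0" for W c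
  proof -
    have cq: "\<forall>y\<in>W. c y * q y = 0 \<and> c y * b y = 0"
    proof
      fix y assume y: "y \<in> W"
      then have "c y * (q y + b y) = 0" "b y * q y = 0" using cp W p_eq bq by (auto simp: subset_iff)
      then show "c y * q y = 0 \<and> c y * b y = 0" by auto
    qed
    then have "\<forall>y\<in>W. c y * q y = 0" by blast
    from gen[OF W(1) W(3) c this W(2)] obtain W' s
      where W': "openin (ctop X) W'" "z \<in> W'" "W' \<subseteq> W"
        and s: "\<forall>w\<in>W'. c w = (\<Sum>i<r. s i w * a i w)"
      by blast
    let ?V = "W' \<inter> {y \<in> W. c y \<noteq> 0}"
    have V: "openin (ctop X) ?V" "?V \<subseteq> N" using W'(1) open_nonzero[OF W(1) c] W(3) by auto
    have "\<forall>y\<in>?V. b y = 0" using cq by auto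
    note aV = a_zero[OF V this]
    have "c y = 0" if y: "y \<in> W'" for y
    proof (rule ccontr)
      assume "c y \<noteq> 0"
      then have "y \<in> ?V" using y W'(3) by blast
      then have "\<forall>i<r. a i y = 0" using aV by blast
      then have "c y = 0" using s y by simp
      with \<open>c y \<noteq> 0\<close> show False by contradiction
    qed
    then show ?thesis using W' by blast
  qed
  then have reg: "regular_germ X z N p" unfolding regular_germ_def by blast
  \<comment> \<open>The function \<open>b / p\<close> is idempotent, hence integral over the local ring.\<close>
  define u where "u = (\<lambda>i::nat. if i = 1 then (\<lambda>y\<in>N. - 1) else (\<lambda>y\<in>N. 0 :: complex))"
  have u: "\<forall>i<2. u i \<in> hol X N" unfolding u_def using N const_hol by simp
  have eq: "b y ^ 2 + (\<Sum>i<2. u i y * (b y ^ i * p y ^ (2 - i))) = 0" if "y \<in> N" for y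
    using bq[OF that] p_eq[OF that] that
    by (simp add: u_def numeral_2_eq_2 algebra_simps)
  obtain W e where W: "openin (ctop X) W" "z \<in> W" "W \<subseteq> N" and e: "e \<in> hol X W"
    and be: "\<forall>y\<in>W. b y = e y * p y"
    using Z.integrally_closed_stalk_iff[THEN iffD1, OF normal, rule_format, OF conjI[OF N zN] b p _ reg, of 2 u]
      u eq by blast
  define d where "d = (\<lambda>y\<in>W. e y * e y - e y)"
  have d: "d \<in> hol X W"
    unfolding d_def using W(1) e by (intro diff_hol mult_hol) (simp_all only: restrict_hol_eq)
  have "\<forall>y\<in>W. d y * p y = 0"
  proof
    fix y assume y: "y \<in> W"
    then have yN: "y \<in> N" and b': "b y = e y * p y" using W be by auto
    have "(e y * e y - e y) * p y = 0"
    proof (cases "b y = 0")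
      case True
      then show ?thesis using b' by auto
    next
      case False
      then have "q y = 0" using bq[OF yN] by simp
      then have "p y = b y" using p_eq[OF yN] by simp
      then have "e y = 1" using b' False by simp
      then show ?thesis by simp
    qed
    then show "d y * p y = 0" using y by (simp add: d_def)
  qed
  from zero_if_p[OF W d this] obtain W' where W': "openin (ctop X) W'" "z \<in> W'" "W' \<subseteq> W"
    "\<forall>y\<in>W'. d y = 0" by blast
  have idem: "e y = 0 \<or> e y = 1" if "y \<in> W'" for y
  proof -
    have "e y * (e y - 1) = 0"
      using that W'(3,4) by (auto simp: d_def algebra_simps subset_iff)
    then show ?thesis by simp
  qed
  show ?thesis
  proof (cases "e z = 1")
    case True
    let ?N = "W' \<inter> {y \<in> W. e y \<noteq> 0}"
    have "openin (ctop X) ?N" using W'(1) open_nonzero[OF W(1) e] by blast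
    moreover have "z \<in> ?N" using True W'(2) W(2) by simp
    moreover have "?N \<subseteq> N" using W(3) by blast
    moreover have "\<forall>y\<in>?N. q y = 0"
    proof
      fix y assume y: "y \<in> ?N"
      then have "e y = 1" using idem by auto
      then have "b y = p y" using be y by simp
      then show "q y = 0" using p_eq y W(3) by auto
    qed
    ultimately show ?thesis by (intro that[of ?N] disjI1)
  next
    case False
    let ?N = "W' \<inter> {y \<in> W. e y \<noteq> 1}"
    have N': "openin (ctop X) ?N" using W'(1) open_nonzero[OF W(1) e] by blast
    moreover have "z \<in> ?N" using False W'(2) W(2) by simp
    moreover have sub: "?N \<subseteq> N" using W(3) by blast
    moreover have "\<forall>V. openin (ctop X) V \<longrightarrow> V \<noteq> {} \<longrightarrow> V \<subseteq> ?N \<longrightarrow> (\<exists>w\<in>V. q w \<noteq> 0)"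
    proof (intro allI impI)
      fix V assume V: "openin (ctop X) V" "V \<noteq> {}" "V \<subseteq> ?N"
      have "\<forall>y\<in>?N. b y = 0"
      proof
        fix y assume y: "y \<in> ?N"
        then have "e y = 0" using idem by auto
        then show "b y = 0" using be y by simp
      qed
      note a0 = a_zero[OF N' sub this]
      show "\<exists>w\<in>V. q w \<noteq> 0"
      proof (rule ccontr)
        assume "\<not> (\<exists>w\<in>V. q w \<noteq> 0)"
        then have "\<forall>y\<in>V. (\<lambda>y\<in>V. 1) y * q y = 0" by simp
        moreover obtain y where y: "y \<in> V" using V(2) by blast
        moreover have "V \<subseteq> N" using V(3) sub by blast
        ultimately obtain W'' s where "y \<in> W''" "W'' \<subseteq> V"
          and s: "\<forall>w\<in>W''. (\<lambda>y\<in>V. 1) w = (\<Sum>i<r. s i w * a i w)"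
          using gen[OF V(1) _ const_hol[OF V(1)], of 1 y] by blast
        then have "(1::complex) = (\<Sum>i<r. s i y * a i y)" using y by auto
        also have "\<dots> = 0" using a0 y V(3) by (intro sum.neutral) auto
        finally show False by simp
      qed
    qed
    ultimately show ?thesis by (intro that[of ?N] disjI2)
  qed
qed

text \<open>
  Where \<open>q\<close> is not a zero divisor, normality gives a local quotient. Where \<open>q\<close> vanishes identically,
  the integral equation forces \<open>f = 0\<close>, and \<open>0\<close> is chosen as the quotient. Quotients that are normalised
  to be \<open>0\<close> on the interior \<open>I\<close> of the zero set of \<open>q\<close> agree on overlaps, so that they glue.
\<close>

lemma divide_integral:
  fixes n :: nat
  assumes normal: "\<And>z. z \<in> P \<Longrightarrow> integrally_closed (stalk X z)"
    and P: "openin (ctop X) P" and f: "f \<in> hol X P" and q: "q \<in> hol X P"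
    and u: "\<forall>i<n. u i \<in> hol X P"
    and eq: "\<forall>y\<in>P. f y ^ n + (\<Sum>i<n. u i y * (f y ^ i * q y ^ (n - i))) = 0"
    and dich: "\<And>z. z \<in> P \<Longrightarrow> \<exists>N. openin (ctop X) N \<and> z \<in> N \<and> N \<subseteq> P \<and>
      ((\<forall>y\<in>N. q y = 0) \<or>
       (\<forall>W. openin (ctop X) W \<longrightarrow> W \<noteq> {} \<longrightarrow> W \<subseteq> N \<longrightarrow> (\<exists>w\<in>W. q w \<noteq> 0)))"
  obtains h where "h \<in> hol X P" "\<forall>y\<in>P. h y * q y = f y"
proof -
  have f_zero: "f y = 0" if "y \<in> P" "q y = 0" for y
  proof -
    have "(\<Sum>i<n. u i y * (f y ^ i * q y ^ (n - i))) = 0"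
      using that(2) by (intro sum.neutral) auto
    then have "f y ^ n = 0" using eq that(1) by force
    then show ?thesis by simp
  qed
  define I where "I = {y \<in> P. \<exists>W. openin (ctop X) W \<and> y \<in> W \<and> W \<subseteq> P \<and> (\<forall>w\<in>W. q w = 0)}"
  \<comment> \<open>The normalisation on \<open>I\<close> makes the local quotients unique.\<close>
  define good where "good = (\<lambda>N k. openin (ctop X) N \<and> N \<subseteq> P \<and> k \<in> hol X N \<and>
    (\<forall>y\<in>N. k y * q y = f y) \<and> (\<forall>y\<in>N \<inter> I. k y = 0))"
  have ex: "\<exists>N k. z \<in> N \<and> good N k" if z: "z \<in> P" for z
  proof -
    from dich[OF z] obtain N where N: "openin (ctop X) N" "z \<in> N" "N \<subseteq> P" and
      "(\<forall>y\<in>N. q y = 0) \<or>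
       (\<forall>W. openin (ctop X) W \<longrightarrow> W \<noteq> {} \<longrightarrow> W \<subseteq> N \<longrightarrow> (\<exists>w\<in>W. q w \<noteq> 0))"
      by blast
    then consider (zero) "\<forall>y\<in>N. q y = 0"
      | (dense) "\<forall>W. openin (ctop X) W \<longrightarrow> W \<noteq> {} \<longrightarrow> W \<subseteq> N \<longrightarrow> (\<exists>w\<in>W. q w \<noteq> 0)"
      by blast
    then show ?thesis
    proof cases
      case zero
      then have "good N (\<lambda>y\<in>N. 0)"
        unfolding good_def using N const_hol f_zero by (auto simp: subset_iff)
      then show ?thesis using N(2) by blast
    next
      case dense
      have "z \<in> topspace (ctop X)" using openin_subset[OF P] z by blast
      then interpret Z: holomorphic_space_point X z by unfold_locales
      have reg: "regular_germ X z N (restrict q N)"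
        unfolding regular_germ_def
      proof (intro allI impI)
        fix W c assume W: "openin (ctop X) W" "z \<in> W" "W \<subseteq> N" and c: "c \<in> hol X W"
          and cq: "\<forall>y\<in>W. c y * restrict q N y = 0"
        have "\<forall>y\<in>W. c y = 0"
        proof
          fix y assume "y \<in> W"
          show "c y = 0"
          proof (rule zero_if_zero_densely[OF W(1) c _ \<open>y \<in> W\<close>])
            fix V assume V: "openin (ctop X) V" "V \<subseteq> W" "V \<noteq> {}"
            then have "V \<subseteq> N" using W(3) by blast
            with dense V obtain w where w: "w \<in> V" "q w \<noteq> 0" by blast
            then have "restrict q N w = q w" "w \<in> W" using V W by auto
            then have "c w = 0" using cq w(2) by auto
            then show "\<exists>w\<in>V. c w = 0" using w(1) by blast
          qed
        qed
        then show "\<exists>W'. openin (ctop X) W' \<and> z \<in> W' \<and> W' \<subseteq> W \<and> (\<forall>y\<in>W'. c y = 0)"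
          using W by blast
      qed
      have fN: "restrict f N \<in> hol X N" and qN: "restrict q N \<in> hol X N"
        and uN: "\<And>i. i < n \<Longrightarrow> restrict (u i) N \<in> hol X N"
        using restrict_hol[OF P N(1,3)] f q u by blast+
      have eqN: "restrict f N y ^ n +
          (\<Sum>i<n. restrict (u i) N y * (restrict f N y ^ i * restrict q N y ^ (n - i))) = 0"
        if "y \<in> N" for y
        using eq that N(3) by (simp add: subset_iff)
      have "\<exists>W h. (openin (ctop X) W \<and> z \<in> W) \<and> W \<subseteq> N \<and> h \<in> hol X W \<and>
          (\<forall>y\<in>W. restrict f N y = h y * restrict q N y)"
        by (rule Z.integrally_closed_stalk_iff[THEN iffD1, OF normal[OF z], rule_format,
              OF conjI[OF N(1,2)] fN qN uN reg eqN])
      then obtain W h where W: "openin (ctop X) W" "z \<in> W" "W \<subseteq> N" and h: "h \<in> hol X W"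
        and fh: "\<forall>y\<in>W. restrict f N y = h y * restrict q N y"
        by (elim exE conjE) simp
      have "W \<inter> I = {}"
      proof (rule ccontr)
        assume "W \<inter> I \<noteq> {}"
        then obtain y V where y: "y \<in> W" "openin (ctop X) V" "y \<in> V" "\<forall>w\<in>V. q w = 0"
          unfolding I_def by blast
        then have "openin (ctop X) (V \<inter> W)" "V \<inter> W \<noteq> {}" "V \<inter> W \<subseteq> N" using W by auto
        then obtain w where "w \<in> V \<inter> W" "q w \<noteq> 0" using dense by blast
        then show False using y(4) by blast
      qed
      moreover have "h y * q y = f y" if "y \<in> W" for y
        using fh[rule_format, OF that] subsetD[OF W(3) that] by simp
      ultimately have "good W h"
        unfolding good_def using W h N(3) by auto
      then show ?thesis using W(2) by blast
    qed
  qed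
  have unique: "k y = k' y" if g: "good N k" "good N' k'" and y: "y \<in> N" "y \<in> N'" for N k N' k' y
  proof (rule ccontr)
    assume ne: "k y \<noteq> k' y"
    have o: "openin (ctop X) N" "openin (ctop X) N'" "N \<subseteq> P" "k \<in> hol X N" "k' \<in> hol X N'"
      using g unfolding good_def by blast+
    let ?M = "N \<inter> N'"
    have M: "openin (ctop X) ?M" using o by blast
    have "restrict k ?M \<in> hol X ?M" "restrict k' ?M \<in> hol X ?M"
      using restrict_hol[OF o(1) M _ o(4)] restrict_hol[OF o(2) M _ o(5)] by blast+
    then have d: "(\<lambda>w\<in>?M. k w - k' w) \<in> hol X ?M" using M by (intro diff_hol)
    let ?V = "{w \<in> ?M. (\<lambda>w\<in>?M. k w - k' w) w \<noteq> 0}"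
    have V: "openin (ctop X) ?V" by (rule open_nonzero[OF M d])
    have yV: "y \<in> ?V" using y ne by simp
    have "\<forall>w\<in>?V. q w = 0"
    proof
      fix w assume "w \<in> ?V"
      then have w: "w \<in> N" "w \<in> N'" "k w \<noteq> k' w" by auto
      then have "k w * q w = k' w * q w" using g unfolding good_def by metis
      then show "q w = 0" using w(3) by simp
    qed
    moreover have "?V \<subseteq> P" using o(3) by blast
    ultimately have "y \<in> I" unfolding I_def using V yV by blast
    then have "k y = 0" "k' y = 0" using g y unfolding good_def by blast+
    then show False using ne by simp
  qed
  from ex have "\<forall>z\<in>P. \<exists>M. z \<in> fst M \<and> good (fst M) (snd M)" by fastforce
  then obtain M where M: "\<And>z. z \<in> P \<Longrightarrow> z \<in> fst (M z) \<and> good (fst (M z)) (snd (M z))"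
    by metis
  define h where "h = (\<lambda>z\<in>P. snd (M z) z)"
  have h_eq: "h y = snd (M z) y" if "z \<in> P" "y \<in> fst (M z)" for y z
  proof -
    have "y \<in> P" using M[OF that(1)] that(2) unfolding good_def by blast
    then show ?thesis
      using unique[of "fst (M y)" "snd (M y)" "fst (M z)" "snd (M z)" y]
        M[OF that(1)] M[OF \<open>y \<in> P\<close>] that(2) by (simp add: h_def)
  qed
  have "h \<in> hol X P"
  proof (rule hol_if_locally_hol[OF P])
    show "h \<in> extensional P" by (simp add: h_def)
    fix z assume z: "z \<in> P"
    let ?N = "fst (M z)"
    have N: "openin (ctop X) ?N" "?N \<subseteq> P" "snd (M z) \<in> hol X ?N" "z \<in> ?N"
      using M[OF z] unfolding good_def by blast+
    have "restrict h ?N = restrict (snd (M z)) ?N"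
      by (rule restrict_ext) (rule h_eq[OF z])
    also have "\<dots> \<in> hol X ?N" using N by (simp only: restrict_hol_eq)
    finally show "\<exists>V. openin (ctop X) V \<and> z \<in> V \<and> V \<subseteq> P \<and> restrict h V \<in> hol X V"
      using N by blast
  qed
  moreover have "\<forall>y\<in>P. h y * q y = f y"
  proof
    fix y assume y: "y \<in> P"
    have "snd (M y) y * q y = f y" using M[OF y] unfolding good_def by blast
    then show "h y * q y = f y" using y by (simp add: h_def)
  qed
  ultimately show ?thesis using that by blast
qed

end


section \<open>Complex spaces in terms of charts\<close>

lemma hol_complex_affine_iff:
  "f \<in> hol (complex_affine n) U \<longleftrightarrow> f \<in> extensional U \<and> continuous_on U f \<and>
    (\<forall>z\<in>U. \<forall>i<n. (\<lambda>w. f (z(i := w))) field_differentiable at (z i))"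
  by (auto simp: complex_affine_def)

text \<open>
  Points near \<open>z\<close> on a coordinate line stay in \<open>U\<close>, so that the values of a function outside \<open>U\<close> do
  not affect its partial derivatives at \<open>z\<close>.
\<close>

lemma openin_complex_affine_line:
  assumes U: "openin (ctop (complex_affine n)) U" and z: "z \<in> U" and i: "i < n"
  obtains T where "open T" "z i \<in> T" "\<And>w. w \<in> T \<Longrightarrow> z(i := w) \<in> U"
proof -
  obtain V where V: "open V" "U = {z. \<forall>i\<ge>n. z i = 0} \<inter> V"
    using U by (auto simp: complex_affine_def openin_open)
  have "continuous_on UNIV (\<lambda>w. z(i := w))"
  proof (rule continuous_on_coordinatewise_then_product)
    show "continuous_on UNIV (\<lambda>w. (z(i := w)) j)" for j by (cases "j = i") simp_all
  qed
  then have o: "open ((\<lambda>w. z(i := w)) -` V)"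
    using V(1) open_vimage by blast
  show ?thesis
  proof (rule that[OF o])
    show "z i \<in> (\<lambda>w. z(i := w)) -` V" using z V(2) by simp
    fix w assume "w \<in> (\<lambda>w. z(i := w)) -` V"
    then show "z(i := w) \<in> U" using z i V(2) by auto
  qed
qed

lemma restrict_hol_complex_affineI:
  assumes U: "openin (ctop (complex_affine n)) U" and F: "continuous_on U F"
    and diff: "\<And>z i. z \<in> U \<Longrightarrow> i < n \<Longrightarrow> (\<lambda>w. F (z(i := w))) field_differentiable at (z i)"
  shows "restrict F U \<in> hol (complex_affine n) U"
  unfolding hol_complex_affine_iff
proof (intro conjI ballI allI impI)
  show "restrict F U \<in> extensional U" by simp
  show "continuous_on U (restrict F U)"
    using F by (subst continuous_on_cong[OF refl, of U _ F]) simp_all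
  fix z i assume z: "z \<in> U" and i: "i < n"
  obtain T where T: "open T" "z i \<in> T" "\<And>w. w \<in> T \<Longrightarrow> z(i := w) \<in> U"
    using openin_complex_affine_line[OF U z i] by blast
  obtain e where e: "0 < e" "ball (z i) e \<subseteq> T" using T(1,2) open_contains_ball by blast
  show "(\<lambda>w. restrict F U (z(i := w))) field_differentiable at (z i)"
  proof (rule field_differentiable_transform_within[OF e(1) UNIV_I _ diff[OF z i]])
    fix w assume "dist w (z i) < e"
    then have "w \<in> T" using e(2) by (auto simp: dist_commute)
    then show "F (z(i := w)) = restrict F U (z(i := w))" using T(3) by simp
  qed
qed

lemma restrict_hol_complex_affine:
  assumes "openin (ctop (complex_affine n)) W" "W \<subseteq> U" "g \<in> hol (complex_affine n) U"
  shows "restrict g W \<in> hol (complex_affine n) W"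
  using assms unfolding hol_complex_affine_iff[of g]
  by (intro restrict_hol_complex_affineI) (auto intro: continuous_on_subset)

text \<open>
  A chart identifies an open set with an analytic subset of an open set in affine space. All that
  matters for the sheaf is that its sections are locally the pullbacks of holomorphic functions.
\<close>

definition pulled_back_at ::
  "nat \<Rightarrow> ('a \<Rightarrow> nat \<Rightarrow> complex) \<Rightarrow> 'a set \<Rightarrow> ('a \<Rightarrow> complex) \<Rightarrow> 'a \<Rightarrow> bool" where
  "pulled_back_at n h V f y \<longleftrightarrow> (\<exists>W g. openin (ctop (complex_affine n)) W \<and> h y \<in> W \<and>
    g \<in> hol (complex_affine n) W \<and> (\<forall>v\<in>V. h v \<in> W \<longrightarrow> f v = g (h v)))"

definition chart :: "'a fspace \<Rightarrow> nat \<Rightarrow> 'a set \<Rightarrow> ('a \<Rightarrow> nat \<Rightarrow> complex) \<Rightarrow> bool" where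
  "chart X n U h \<longleftrightarrow> openin (ctop X) U \<and>
    continuous_map (subtopology (ctop X) U) (ctop (complex_affine n)) h \<and>
    (\<forall>V f. openin (ctop X) V \<longrightarrow> V \<subseteq> U \<longrightarrow> f \<in> extensional V \<longrightarrow>
      (f \<in> hol X V \<longleftrightarrow> (\<forall>y\<in>V. pulled_back_at n h V f y)))"

text \<open>
  Subspaces of second countable spaces are separable: pick a point in each basic open set that meets
  \<open>S\<close>.
\<close>

lemma countably_dense_in_top_of_set:
  fixes S :: "'a::second_countable_topology set"
  obtains D where "D \<subseteq> S" "countably_dense_in D (top_of_set S) S"
proof -
  obtain B :: "'a set set" where B: "countable B" "topological_basis B"
    using ex_countable_basis by blast
  define D where "D = (\<lambda>b. SOME x. x \<in> b \<inter> S) ` {b \<in> B. b \<inter> S \<noteq> {}}"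
  have pick: "(SOME x. x \<in> b \<inter> S) \<in> b \<inter> S" if "b \<inter> S \<noteq> {}" for b
    using that by (simp only: some_in_eq not_False_eq_True)
  have DS: "D \<subseteq> S" unfolding D_def
  proof (rule image_subsetI)
    fix b assume "b \<in> {b \<in> B. b \<inter> S \<noteq> {}}"
    then have "b \<inter> S \<noteq> {}" by simp
    from pick[OF this] show "(SOME x. x \<in> b \<inter> S) \<in> S" by (rule IntD2)
  qed
  have "countable D" unfolding D_def using B(1) by (intro countable_image countable_Collect)
  moreover have "W \<inter> D \<noteq> {}" if W: "openin (top_of_set S) W" "W \<noteq> {}" for W
  proof -
    obtain V where V: "open V" "W = S \<inter> V" using W(1) by (auto simp: openin_open)
    obtain x where x: "x \<in> V" "x \<in> S" using W(2) V(2) by blast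
    obtain b where b: "b \<in> B" "x \<in> b" "b \<subseteq> V"
      using topological_basisE[OF B(2) V(1) x(1)] by blast
    then have ne: "b \<inter> S \<noteq> {}" using x by blast
    then have "(SOME x. x \<in> b \<inter> S) \<in> D" unfolding D_def using b(1) by (intro imageI) simp
    moreover have "(SOME x. x \<in> b \<inter> S) \<in> W"
      unfolding V(2) using IntD1[OF pick[OF ne]] IntD2[OF pick[OF ne]] b(3) by (intro IntI) auto
    ultimately show ?thesis by (intro notI) (drule equalityD1, drule subsetD, rule IntI, simp_all)
  qed
  ultimately have "countably_dense_in D (top_of_set S) S"
    unfolding countably_dense_in_def by simp
  with DS show ?thesis by (rule that)
qed

text \<open>
  A biholomorphic map transports sections in both directions, and sections of the reduced structure on an
  analytic subset are by definition locally restrictions from the ambient space. A countable dense set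
  is transported from affine space.
\<close>

lemma complex_space_chart:
  assumes X: "complex_space X" and x: "x \<in> topspace (ctop X)"
  obtains U n h D where "x \<in> U" "chart X n U h" "countably_dense_in D (ctop X) U"
proof -
  have sheaf: "function_sheaf X" using X unfolding complex_space_def by (elim conjE)
  from X have "\<forall>x\<in>topspace (ctop X). \<exists>U n D A h. openin (ctop X) U \<and> x \<in> U \<and>
        openin (ctop (complex_affine n)) D \<and>
        analytic_subset (open_subspace (complex_affine n) D) A \<and>
        biholomorphic_map (open_subspace X U)
          (reduced_subspace (open_subspace (complex_affine n) D) A) h"
    unfolding complex_space_def by (elim conjE)
  from this[rule_format, OF x] obtain U n D A h where U: "openin (ctop X) U" "x \<in> U"
    and D: "openin (ctop (complex_affine n)) D"
    and bi: "biholomorphic_map (open_subspace X U)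
      (reduced_subspace (open_subspace (complex_affine n) D) A) h"
    by (elim exE conjE) simp
  define M where "M = reduced_subspace (open_subspace (complex_affine n) D) A"
  define T where "T = ctop (complex_affine n)"
  have ctop_M: "ctop M = subtopology T (D \<inter> A)"
    by (simp add: M_def reduced_subspace_def open_subspace_def subtopology_subtopology T_def)
  have hol_M: "f \<in> hol M V \<longleftrightarrow> f \<in> extensional V \<and> (\<forall>x\<in>V. \<exists>W g. openin T W \<and> W \<subseteq> D \<and>
      x \<in> W \<and> g \<in> hol (complex_affine n) W \<and> (\<forall>y\<in>W \<inter> V. f y = g y))" for f V
    using D by (auto simp: M_def reduced_subspace_def open_subspace_def T_def openin_open_subtopology)
  from bi obtain k where hk: "homeomorphic_maps (subtopology (ctop X) U) (ctop M) h k"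
    and hol_h: "hol_map (open_subspace X U) M h" and hol_k: "hol_map M (open_subspace X U) k"
    unfolding biholomorphic_map_def M_def[symmetric] by (auto simp: open_subspace_def)
  have topU: "topspace (subtopology (ctop X) U) = U" using openin_subset[OF U(1)] by auto
  have kh: "k (h v) = v" "h v \<in> topspace (ctop M)" if "v \<in> U" for v
    using hk that topU unfolding homeomorphic_maps_def continuous_map_def by auto
  have cont_h: "continuous_map (subtopology (ctop X) U) T h"
    using hk unfolding homeomorphic_maps_def ctop_M continuous_map_in_subtopology by blast
  have pull_k: "pullback M k V f \<in> hol M (preim M k V)"
    if "openin (ctop X) V" "V \<subseteq> U" "f \<in> hol X V" for V f
    using hol_k that U(1) unfolding hol_map_def by (simp add: open_subspace_def openin_open_subtopology)
  have pull_h: "pullback (open_subspace X U) h V f \<in> hol X (preim (open_subspace X U) h V)"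
    if "openin (ctop M) V" "f \<in> hol M V" for V f
    using hol_h that unfolding hol_map_def by (simp add: open_subspace_def)
  have preim_h: "preim (open_subspace X U) h V = {v \<in> U. h v \<in> V}" for V
    using topU by (simp add: preim_def open_subspace_def)
  have "chart X n U h"
    unfolding chart_def T_def[symmetric]
  proof (intro conjI U(1) cont_h allI impI iffI ballI)
    fix V f y assume V: "openin (ctop X) V" "V \<subseteq> U" and f: "f \<in> hol X V" and y: "y \<in> V"
    have "h y \<in> preim M k V" using y V(2) kh by (auto simp: preim_def)
    with pull_k[OF V f] obtain W g where W: "openin T W" "h y \<in> W" "g \<in> hol (complex_affine n) W"
      and eq: "\<forall>m\<in>W \<inter> preim M k V. pullback M k V f m = g m"
      unfolding hol_M by blast
    have "f v = g (h v)" if v: "v \<in> V" "h v \<in> W" for v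
    proof -
      have m: "h v \<in> preim M k V" "k (h v) = v" using v(1) V(2) kh by (auto simp: preim_def)
      then have "pullback M k V f (h v) = g (h v)" using eq v(2) by blast
      then show ?thesis using m by (simp add: pullback_def)
    qed
    then show "pulled_back_at n h V f y"
      unfolding pulled_back_at_def T_def[symmetric] using W by blast
  next
    fix V f assume V: "openin (ctop X) V" "V \<subseteq> U" and ext: "f \<in> extensional V"
      and loc: "\<forall>y\<in>V. pulled_back_at n h V f y"
    have glue: "f \<in> hol X V" if "\<forall>x\<in>V. \<exists>V'. openin (ctop X) V' \<and> x \<in> V' \<and> V' \<subseteq> V \<and> restrict f V' \<in> hol X V'"
      using sheaf[unfolded function_sheaf_def, THEN conjunct2, THEN conjunct2, rule_format, of V f]
        V(1) ext that by blast
    show "f \<in> hol X V"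
    proof (rule glue, rule ballI)
      fix y assume y: "y \<in> V"
      from loc[rule_format, OF y] obtain W g where W: "openin T W" "h y \<in> W"
        and g: "g \<in> hol (complex_affine n) W" and eq: "\<forall>v\<in>V. h v \<in> W \<longrightarrow> f v = g (h v)"
        unfolding pulled_back_at_def T_def[symmetric] by blast
      let ?W = "W \<inter> D" and ?N = "W \<inter> topspace (ctop M)"
      have WD: "openin T ?W" using W(1) D unfolding T_def by blast
      have gW: "restrict g ?W \<in> hol (complex_affine n) ?W"
        using restrict_hol_complex_affine[of n ?W W g] WD g unfolding T_def by blast
      have top_M: "topspace (ctop M) \<subseteq> D" unfolding ctop_M by auto
      have N: "openin (ctop M) ?N"
        unfolding ctop_M using W(1) by (auto simp: openin_subtopology openin_subset)
      have "restrict g ?N \<in> hol M ?N"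
        unfolding hol_M
      proof (intro conjI ballI)
        fix m assume "m \<in> ?N"
        then have "m \<in> ?W" using top_M by blast
        then show "\<exists>W' g'. openin T W' \<and> W' \<subseteq> D \<and> m \<in> W' \<and> g' \<in> hol (complex_affine n) W' \<and>
            (\<forall>y\<in>W' \<inter> ?N. restrict g ?N y = g' y)"
          using WD gW by (intro exI[of _ ?W] exI[of _ "restrict g ?W"]) auto
      qed simp
      from pull_h[OF N this] have pN: "pullback (open_subspace X U) h ?N (restrict g ?N) \<in>
          hol X {v \<in> U. h v \<in> ?N}" (is "?p \<in> hol X ?V") unfolding preim_h .
      have oV: "openin (ctop X) ?V"
      proof -
        have "continuous_map (subtopology (ctop X) U) (ctop M) h"
          using hk unfolding homeomorphic_maps_def by blast
        from openin_continuous_map_preimage[OF this N, unfolded topU]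
        show ?thesis using openin_open_subtopology[OF U(1)] by simp
      qed
      let ?V' = "?V \<inter> V"
      have V': "openin (ctop X) ?V'" using oV V(1) by blast
      have "restrict ?p ?V' \<in> hol X ?V'"
        using sheaf[unfolded function_sheaf_def, THEN conjunct2, THEN conjunct1, rule_format, of ?V ?V' ?p]
          oV V' pN by blast
      also have "restrict ?p ?V' = restrict f ?V'"
        using eq by (intro restrict_ext) (simp add: pullback_def preim_h)
      finally have "restrict f ?V' \<in> hol X ?V'" .
      moreover have "y \<in> ?V'" using y V(2) kh W(2) by auto
      ultimately show "\<exists>V'. openin (ctop X) V' \<and> y \<in> V' \<and> V' \<subseteq> V \<and> restrict f V' \<in> hol X V'"
        using V' by (intro exI[of _ ?V']) simp
    qed
  qed
  moreover
  have "\<exists>D'. countably_dense_in D' (ctop X) U"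
  proof -
    let ?B = "topspace (ctop M)"
    have M_set: "ctop M = top_of_set ?B"
      unfolding ctop_M T_def complex_affine_def by (simp add: subtopology_subtopology)
    obtain C where C: "C \<subseteq> ?B" "countably_dense_in C (top_of_set ?B) ?B"
      using countably_dense_in_top_of_set by blast
    have "W \<inter> k ` C \<noteq> {}" if W: "openin (ctop X) W" "W \<noteq> {}" "W \<subseteq> U" for W
    proof -
      have "continuous_map (ctop M) (subtopology (ctop X) U) k"
        using hk unfolding homeomorphic_maps_def by blast
      moreover have "openin (subtopology (ctop X) U) W"
        using W openin_open_subtopology[OF U(1)] by blast
      ultimately have "openin (ctop M) {m \<in> ?B. k m \<in> W}" by (rule openin_continuous_map_preimage)
      then have "openin (top_of_set ?B) {m \<in> ?B. k m \<in> W}" unfolding M_set[symmetric] .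
      moreover obtain w where w: "w \<in> W" using W(2) by blast
      then have "h w \<in> {m \<in> ?B. k m \<in> W}" using kh W(3) by auto
      ultimately have "{m \<in> ?B. k m \<in> W} \<inter> C \<noteq> {}"
        using C(2) unfolding countably_dense_in_def by blast
      then show ?thesis by blast
    qed
    moreover have "countable (k ` C)" using C(2) unfolding countably_dense_in_def by simp
    ultimately have "countably_dense_in (k ` C) (ctop X) U"
      unfolding countably_dense_in_def by simp
    then show ?thesis by (rule exI)
  qed
  ultimately show ?thesis using that[OF U(2)] by (elim exE)
qed

lemma hol_if_pulled_back:
  assumes X: "complex_space X" and V: "openin (ctop X) V" and f: "f \<in> extensional V"
    and loc: "\<And>n U h x. chart X n U h \<Longrightarrow> x \<in> V \<Longrightarrow> x \<in> U \<Longrightarrow> pulled_back_at n h (V \<inter> U) f x"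
  shows "f \<in> hol X V"
proof -
  have sheaf: "function_sheaf X" using X unfolding complex_space_def by (elim conjE)
  have "\<exists>V'. openin (ctop X) V' \<and> x \<in> V' \<and> V' \<subseteq> V \<and> restrict f V' \<in> hol X V'" if x: "x \<in> V" for x
  proof -
    have "x \<in> topspace (ctop X)" using openin_subset[OF V] x by blast
    then obtain U n h where U: "x \<in> U" and ch: "chart X n U h"
      using complex_space_chart[OF X] by metis
    have oU: "openin (ctop X) U" using ch unfolding chart_def by (elim conjE)
    have VU: "openin (ctop X) (V \<inter> U)" using V oU by blast
    have "pulled_back_at n h (V \<inter> U) (restrict f (V \<inter> U)) y" if y: "y \<in> V \<inter> U" for y
    proof -
      have "pulled_back_at n h (V \<inter> U) f y" using loc[OF ch, of y] y by simp
      then show ?thesis unfolding pulled_back_at_def by simp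
    qed
    then have "restrict f (V \<inter> U) \<in> hol X (V \<inter> U)"
      using ch VU unfolding chart_def by simp
    then show ?thesis using VU U x by blast
  qed
  then show ?thesis
    using sheaf[unfolded function_sheaf_def, THEN conjunct2, THEN conjunct2, rule_format, of V f]
      V f by blast
qed

lemma pulled_back_if_hol:
  assumes X: "complex_space X" and V: "openin (ctop X) V" and f: "f \<in> hol X V"
    and ch: "chart X n U h" and x: "x \<in> V" "x \<in> U"
  shows "pulled_back_at n h (V \<inter> U) f x"
proof -
  have sheaf: "function_sheaf X" using X unfolding complex_space_def by (elim conjE)
  have oU: "openin (ctop X) U" using ch unfolding chart_def by (elim conjE)
  have VU: "openin (ctop X) (V \<inter> U)" using V oU by blast
  have "restrict f (V \<inter> U) \<in> hol X (V \<inter> U)"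
    using sheaf[unfolded function_sheaf_def, THEN conjunct2, THEN conjunct1, rule_format, of V "V \<inter> U" f]
      V VU f by blast
  then have "\<forall>y\<in>V \<inter> U. pulled_back_at n h (V \<inter> U) (restrict f (V \<inter> U)) y"
    using ch VU unfolding chart_def by simp
  then have "pulled_back_at n h (V \<inter> U) (restrict f (V \<inter> U)) x" using x by blast
  then show ?thesis unfolding pulled_back_at_def by simp
qed

text \<open>
  Sums and products are formed after extending both functions to the ambient affine space of a chart.
\<close>

lemma hol_binary_operation:
  assumes X: "complex_space X" and V: "openin (ctop X) V"
    and f: "restrict f V \<in> hol X V" and g: "restrict g V \<in> hol X V"
    and affine: "\<And>n W a b. openin (ctop (complex_affine n)) W \<Longrightarrow> a \<in> hol (complex_affine n) W \<Longrightarrow>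
      b \<in> hol (complex_affine n) W \<Longrightarrow> (\<lambda>z\<in>W. F (a z) (b z)) \<in> hol (complex_affine n) W"
  shows "(\<lambda>x\<in>V. F (f x) (g x)) \<in> hol X V"
proof (rule hol_if_pulled_back[OF X V])
  fix n U h x assume ch: "chart X n U h" and x: "x \<in> V" "x \<in> U"
  from pulled_back_if_hol[OF X V f ch x] obtain W a where W: "openin (ctop (complex_affine n)) W"
      "h x \<in> W" "a \<in> hol (complex_affine n) W"
    and fa: "\<forall>v\<in>V \<inter> U. h v \<in> W \<longrightarrow> restrict f V v = a (h v)"
    unfolding pulled_back_at_def by blast
  from pulled_back_if_hol[OF X V g ch x] obtain W' b where W': "openin (ctop (complex_affine n)) W'"
      "h x \<in> W'" "b \<in> hol (complex_affine n) W'"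
    and gb: "\<forall>v\<in>V \<inter> U. h v \<in> W' \<longrightarrow> restrict g V v = b (h v)"
    unfolding pulled_back_at_def by blast
  let ?W = "W \<inter> W'"
  have oW: "openin (ctop (complex_affine n)) ?W" using W(1) W'(1) by blast
  have "(\<lambda>z\<in>?W. F (restrict a ?W z) (restrict b ?W z)) \<in> hol (complex_affine n) ?W"
    by (rule affine[OF oW restrict_hol_complex_affine[OF oW Int_lower1 W(3)]
          restrict_hol_complex_affine[OF oW Int_lower2 W'(3)]])
  moreover have "(\<lambda>x\<in>V. F (f x) (g x)) v = (\<lambda>z\<in>?W. F (restrict a ?W z) (restrict b ?W z)) (h v)"
    if "v \<in> V \<inter> U" "h v \<in> ?W" for v
    using fa[rule_format, OF that(1)] gb[rule_format, OF that(1)] that by simp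
  ultimately show "pulled_back_at n h (V \<inter> U) (\<lambda>x\<in>V. F (f x) (g x)) x"
    unfolding pulled_back_at_def using oW W(2) W'(2)
    by (intro exI[of _ ?W] exI[of _ "\<lambda>z\<in>?W. F (restrict a ?W z) (restrict b ?W z)"]) blast
qed simp

lemma holomorphic_space_if_complex_space:
  assumes X: "complex_space X"
  shows "holomorphic_space X"
proof
  show "function_sheaf X" using X unfolding complex_space_def by (elim conjE)
  fix U assume U: "openin (ctop X) U"
  show "(\<lambda>x\<in>U. c) \<in> hol X U" for c
  proof (rule hol_if_pulled_back[OF X U])
    fix n U' h x assume ch: "chart X n U' h" and x: "x \<in> U" "x \<in> U'"
    let ?W = "topspace (ctop (complex_affine n))"
    have oU: "openin (ctop X) U'" and cont: "continuous_map (subtopology (ctop X) U') (ctop (complex_affine n)) h"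
      using ch unfolding chart_def by blast+
    have "topspace (subtopology (ctop X) U') = U'" using openin_subset[OF oU] by auto
    then have hW: "h v \<in> ?W" if "v \<in> U'" for v using cont that unfolding continuous_map_def by auto
    have "(\<lambda>z\<in>?W. c) \<in> hol (complex_affine n) ?W"
      by (intro restrict_hol_complex_affineI) simp_all
    moreover have "(\<lambda>x\<in>U. c) v = (\<lambda>z\<in>?W. c) (h v)" if "v \<in> U \<inter> U'" for v
      using hW[of v] that by simp
    ultimately show "pulled_back_at n h (U \<inter> U') (\<lambda>x\<in>U. c) x"
      unfolding pulled_back_at_def using hW[OF x(2)]
      by (intro exI[of _ ?W] exI[of _ "\<lambda>z\<in>?W. c"]) simp
  qed simp
  show "(\<lambda>x\<in>U. f x + g x) \<in> hol X U" if "restrict f U \<in> hol X U" "restrict g U \<in> hol X U" for f g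
  proof (rule hol_binary_operation[OF X U that])
    fix n W a b assume "openin (ctop (complex_affine n)) W" "a \<in> hol (complex_affine n) W"
      "b \<in> hol (complex_affine n) W"
    then show "(\<lambda>z\<in>W. a z + b z) \<in> hol (complex_affine n) W"
      unfolding hol_complex_affine_iff[of a] hol_complex_affine_iff[of b]
      by (intro restrict_hol_complex_affineI) (auto intro!: continuous_intros field_differentiable_add)
  qed
  show "(\<lambda>x\<in>U. f x * g x) \<in> hol X U" if "restrict f U \<in> hol X U" "restrict g U \<in> hol X U" for f g
  proof (rule hol_binary_operation[OF X U that])
    fix n W a b assume "openin (ctop (complex_affine n)) W" "a \<in> hol (complex_affine n) W"
      "b \<in> hol (complex_affine n) W"
    then show "(\<lambda>z\<in>W. a z * b z) \<in> hol (complex_affine n) W"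
      unfolding hol_complex_affine_iff[of a] hol_complex_affine_iff[of b]
      by (intro restrict_hol_complex_affineI) (auto intro!: continuous_intros field_differentiable_mult)
  qed
  show "openin (ctop X) {x \<in> U. f x \<in> T}" if f: "f \<in> hol X U" and T: "open T" for f T
  proof (subst openin_subopen, intro ballI)
    fix x assume x: "x \<in> {x \<in> U. f x \<in> T}"
    then have "x \<in> topspace (ctop X)" using openin_subset[OF U] by blast
    then obtain U' n h where xU: "x \<in> U'" and ch: "chart X n U' h"
      using complex_space_chart[OF X] by metis
    have oU: "openin (ctop X) U'" and cont: "continuous_map (subtopology (ctop X) U') (ctop (complex_affine n)) h"
      using ch unfolding chart_def by blast+
    have top: "topspace (subtopology (ctop X) U') = U'" using openin_subset[OF oU] by auto
    have xU0: "x \<in> U" using x by simp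
    from pulled_back_if_hol[OF X U f ch xU0 xU] obtain W g where W: "openin (ctop (complex_affine n)) W"
        "h x \<in> W" and g: "g \<in> hol (complex_affine n) W"
      and fg: "\<forall>v\<in>U \<inter> U'. h v \<in> W \<longrightarrow> f v = g (h v)"
      unfolding pulled_back_at_def by blast
    have "continuous_on W g" using g unfolding hol_complex_affine_iff by blast
    then have "openin (top_of_set W) (W \<inter> g -` T)" using T by (rule continuous_openin_preimage_gen)
    then have oG: "openin (ctop (complex_affine n)) (W \<inter> g -` T)"
      using W(1) unfolding complex_affine_def by (simp add: openin_trans)
    have "openin (subtopology (ctop X) U') {v \<in> U'. h v \<in> W \<inter> g -` T}"
      using openin_continuous_map_preimage[OF cont oG] unfolding top .
    then have o: "openin (ctop X) (U \<inter> {v \<in> U'. h v \<in> W \<inter> g -` T})"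
      using openin_open_subtopology[OF oU] U by blast
    have "x \<in> U \<inter> {v \<in> U'. h v \<in> W \<inter> g -` T}" using x xU W(2) fg by auto
    moreover have "U \<inter> {v \<in> U'. h v \<in> W \<inter> g -` T} \<subseteq> {x \<in> U. f x \<in> T}" using fg by auto
    ultimately show "\<exists>T'. openin (ctop X) T' \<and> x \<in> T' \<and> T' \<subseteq> {x \<in> U. f x \<in> T}"
      using o by blast
  qed
qed


section \<open>Direct images trivialised over an open set\<close>

lemma openin_open_subspace:
  assumes "openin (ctop X) U"
  shows "openin (ctop (open_subspace X U)) V \<longleftrightarrow> openin (ctop X) V \<and> V \<subseteq> U"
  using openin_open_subtopology[OF assms] by (simp add: open_subspace_def)

lemma hol_open_subspace [simp]: "hol (open_subspace X U) = hol X"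
  by (simp add: open_subspace_def)

lemma free_sheaf_open_subspace [simp]: "free_sheaf (open_subspace X U) r = free_sheaf X r"
  by (simp add: free_sheaf_def)

text \<open>
  Near a point outside \<open>S\<close> one of the defining functions does not vanish.
\<close>

lemma (in holomorphic_space) openin_compl_analytic_subset:
  assumes "analytic_subset X S"
  shows "openin (ctop X) (topspace (ctop X) - S)"
proof (subst openin_subopen, intro ballI)
  fix x assume x: "x \<in> topspace (ctop X) - S"
  have "\<forall>x\<in>topspace (ctop X). \<exists>U Q. openin (ctop X) U \<and> x \<in> U \<and> finite Q \<and> Q \<subseteq> hol X U \<and>
        S \<inter> U = {y \<in> U. \<forall>f\<in>Q. f y = 0}"
    using assms unfolding analytic_subset_def by (elim conjE)
  from this[rule_format, OF DiffD1[OF x]] obtain U Q where U: "openin (ctop X) U" "x \<in> U"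
    and Q: "Q \<subseteq> hol X U" and S: "S \<inter> U = {y \<in> U. \<forall>f\<in>Q. f y = 0}"
    by (elim exE conjE) simp
  have "x \<notin> {y \<in> U. \<forall>f\<in>Q. f y = 0}" unfolding S[symmetric] using x by simp
  then obtain f where f: "f \<in> Q" "f x \<noteq> 0" using U(2) by auto
  let ?V = "{y \<in> U. f y \<noteq> 0}"
  have "openin (ctop X) ?V" using open_nonzero[OF U(1) subsetD[OF Q f(1)]] .
  moreover have "?V \<subseteq> topspace (ctop X) - S"
  proof
    fix y assume y: "y \<in> ?V"
    then have "y \<notin> S \<inter> U" unfolding S using f(1) by auto
    then show "y \<in> topspace (ctop X) - S" using y openin_subset[OF U(1)] by auto
  qed
  ultimately show "\<exists>T. openin (ctop X) T \<and> x \<in> T \<and> T \<subseteq> topspace (ctop X) - S"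
    using U(2) f(2) by (intro exI[of _ ?V]) simp
qed

text \<open>
  An isomorphism of the direct image of \<open>F\<close> with a free sheaf over \<open>U\<close>: the map \<open>\<Phi> V\<close> sends a section
  of \<open>F\<close> over the preimage of \<open>V\<close> to the tuple of its components.
\<close>

locale trivialised_direct_image = Y: holomorphic_space Y + Z: holomorphic_space Z
  for Y :: "'y fspace" and Z :: "'z fspace" +
  fixes p :: "'z \<Rightarrow> 'y" and F :: "('z, 'f) msheaf" and U :: "'y set" and r :: nat
    and \<Phi> :: "'y set \<Rightarrow> 'f \<Rightarrow> nat \<Rightarrow> 'y \<Rightarrow> complex"
  assumes F: "module_sheaf Z F" and p: "hol_map Z Y p"
    and open_U: "openin (ctop Y) U" and rank: "0 < r"
    and bij: "\<And>V. openin (ctop Y) V \<Longrightarrow> V \<subseteq> U \<Longrightarrow>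
      bij_betw (\<Phi> V) (carrier (sec F (preim Z p V))) ({..<r} \<rightarrow>\<^sub>E hol Y V)"
    and \<Phi>_smult: "\<And>V f s i x. openin (ctop Y) V \<Longrightarrow> V \<subseteq> U \<Longrightarrow> f \<in> hol Y V \<Longrightarrow>
      s \<in> carrier (sec F (preim Z p V)) \<Longrightarrow> i < r \<Longrightarrow> x \<in> V \<Longrightarrow>
      \<Phi> V (pullback Z p V f \<odot>\<^bsub>sec F (preim Z p V)\<^esub> s) i x = f x * \<Phi> V s i x"
    and \<Phi>_res: "\<And>V s i x. openin (ctop Y) V \<Longrightarrow> V \<subseteq> U \<Longrightarrow>
      s \<in> carrier (sec F (preim Z p U)) \<Longrightarrow> i < r \<Longrightarrow> x \<in> V \<Longrightarrow>
      \<Phi> V (res F (preim Z p U) (preim Z p V) s) i x = \<Phi> U s i x"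
begin

abbreviation P :: "'z set" where "P \<equiv> preim Z p U"

lemma sheaf_module: "openin (ctop Z) V \<Longrightarrow> Module.module (hol_ring Z V) (sec F V)"
  using F unfolding module_sheaf_def by (elim conjE) simp

lemma res_closed:
  assumes "openin (ctop Z) V" "openin (ctop Z) W" "W \<subseteq> V" "s \<in> carrier (sec F V)"
  shows "res F V W s \<in> carrier (sec F W)"
  using F[unfolded module_sheaf_def, THEN conjunct2, THEN conjunct1, rule_format, of V W] assms by simp

lemma res_smult:
  assumes "openin (ctop Z) V" "openin (ctop Z) W" "W \<subseteq> V" "s \<in> carrier (sec F V)" "f \<in> hol Z V"
  shows "res F V W (f \<odot>\<^bsub>sec F V\<^esub> s) = restrict f W \<odot>\<^bsub>sec F W\<^esub> res F V W s"
  using F[unfolded module_sheaf_def, THEN conjunct2, THEN conjunct1, rule_format, of V W] assms by simp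

lemma res_res:
  assumes "openin (ctop Z) V" "openin (ctop Z) W" "openin (ctop Z) W'" "W \<subseteq> V" "W' \<subseteq> W"
    "s \<in> carrier (sec F V)"
  shows "res F W W' (res F V W s) = res F V W' s"
  using F[unfolded module_sheaf_def, THEN conjunct2, THEN conjunct2, THEN conjunct2, THEN conjunct1,
      rule_format, of V W W'] assms by simp

lemma smult_closed:
  assumes "openin (ctop Z) V" "f \<in> hol Z V" "s \<in> carrier (sec F V)"
  shows "f \<odot>\<^bsub>sec F V\<^esub> s \<in> carrier (sec F V)"
  using Module.module.smult_closed[OF sheaf_module[OF assms(1)]] assms by (simp add: hol_ring_def)

lemma smult_smult:
  assumes "openin (ctop Z) V" "f \<in> hol Z V" "g \<in> hol Z V" "s \<in> carrier (sec F V)"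
  shows "f \<odot>\<^bsub>sec F V\<^esub> (g \<odot>\<^bsub>sec F V\<^esub> s) = (\<lambda>x\<in>V. f x * g x) \<odot>\<^bsub>sec F V\<^esub> s"
  using Module.module.smult_assoc1[OF sheaf_module[OF assms(1)], of f g s] assms
  by (simp add: hol_ring_def)

lemma smult_add_left:
  assumes "openin (ctop Z) V" "f \<in> hol Z V" "g \<in> hol Z V" "s \<in> carrier (sec F V)"
  shows "(\<lambda>x\<in>V. f x + g x) \<odot>\<^bsub>sec F V\<^esub> s = f \<odot>\<^bsub>sec F V\<^esub> s \<oplus>\<^bsub>sec F V\<^esub> g \<odot>\<^bsub>sec F V\<^esub> s"
  using Module.module.smult_l_distr[OF sheaf_module[OF assms(1)], of f g s] assms
  by (simp add: hol_ring_def)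

lemma smult_zero_left:
  assumes "openin (ctop Z) V" "s \<in> carrier (sec F V)"
  shows "(\<lambda>x\<in>V. 0) \<odot>\<^bsub>sec F V\<^esub> s = \<zero>\<^bsub>sec F V\<^esub>"
  using Module.module.smult_l_null[OF sheaf_module[OF assms(1)], of s] assms
  by (simp add: hol_ring_def)

lemma zero_closed: "openin (ctop Z) V \<Longrightarrow> \<zero>\<^bsub>sec F V\<^esub> \<in> carrier (sec F V)"
  by (rule abelian_monoid.zero_closed[OF abelian_group.axioms(1)[OF Module.module.axioms(2)[OF sheaf_module]]])

lemma open_preim: "openin (ctop Y) V \<Longrightarrow> openin (ctop Z) (preim Z p V)"
  using p unfolding hol_map_def preim_def by (elim conjE) (rule openin_continuous_map_preimage)

lemma pullback_hol: "openin (ctop Y) V \<Longrightarrow> f \<in> hol Y V \<Longrightarrow> pullback Z p V f \<in> hol Z (preim Z p V)"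
  using p unfolding hol_map_def by (elim conjE) simp

lemma open_P: "openin (ctop Z) P"
  using open_preim open_U by blast

lemma \<Phi>_component_hol:
  assumes "openin (ctop Y) V" "V \<subseteq> U" "s \<in> carrier (sec F (preim Z p V))" "i < r"
  shows "\<Phi> V s i \<in> hol Y V"
proof -
  have "\<Phi> V s \<in> {..<r} \<rightarrow>\<^sub>E hol Y V" using bij[OF assms(1,2)] assms(3) bij_betwE by blast
  then show ?thesis by (rule PiE_mem) (simp add: assms(4))
qed

lemma first_basis_section:
  obtains e where "e \<in> carrier (sec F P)" "\<forall>x\<in>U. \<Phi> U e 0 x = 1"
proof -
  have "(\<lambda>i\<in>{..<r}. \<lambda>x\<in>U. 1) \<in> {..<r} \<rightarrow>\<^sub>E hol Y U"
    using Y.const_hol[OF open_U] by simp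
  then obtain e where e: "e \<in> carrier (sec F P)" "\<Phi> U e = (\<lambda>i\<in>{..<r}. \<lambda>x\<in>U. 1)"
    using bij[OF open_U subset_refl] unfolding bij_betw_def by (metis (no_types, lifting) imageE)
  have "\<forall>x\<in>U. \<Phi> U e 0 x = 1" unfolding e(2) using rank by simp
  with e(1) show ?thesis by (rule that)
qed

lemma \<Phi>_zero:
  assumes V: "openin (ctop Y) V" "V \<subseteq> U" and "i < r" "x \<in> V"
  shows "\<Phi> V \<zero>\<^bsub>sec F (preim Z p V)\<^esub> i x = 0"
proof -
  let ?z = "\<zero>\<^bsub>sec F (preim Z p V)\<^esub>"
  have z: "?z \<in> carrier (sec F (preim Z p V))" using zero_closed open_preim V(1) by blast
  have "pullback Z p V (\<lambda>x\<in>V. 0) = (\<lambda>x\<in>preim Z p V. 0)"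
    unfolding pullback_def by (rule restrict_ext) (simp add: preim_def)
  then have "?z = pullback Z p V (\<lambda>x\<in>V. 0) \<odot>\<^bsub>sec F (preim Z p V)\<^esub> ?z"
    using smult_zero_left[OF open_preim[OF V(1)] z] by simp
  then have "\<Phi> V ?z i x = (\<lambda>x\<in>V. 0) x * \<Phi> V ?z i x"
    using \<Phi>_smult[OF V Y.const_hol[OF V(1)] z assms(3,4), of 0] by simp
  then show ?thesis using assms(4) by simp
qed

text \<open>
  Off the preimage of \<open>S\<close> an open set \<open>V\<close> is the full preimage of an open subset \<open>W\<close> of \<open>Y\<close>, and the function
  \<open>a\<close> is the pullback of a holomorphic function on \<open>W\<close>. So multiplication of sections by \<open>a\<close> is
  multiplication of tuples by that function, and the first component of \<open>e\<close> is \<open>1\<close>.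
\<close>

lemma first_basis_section_torsion_free_off:
  assumes S: "openin (ctop Y) (topspace (ctop Y) - S)"
    and bi: "biholomorphic_map (open_subspace Z (topspace (ctop Z) - preim Z p S))
      (open_subspace Y (topspace (ctop Y) - S)) p"
    and e: "e \<in> carrier (sec F P)" "\<forall>x\<in>U. \<Phi> U e 0 x = 1"
    and V: "openin (ctop Z) V" "V \<subseteq> P - preim Z p S" and a: "a \<in> hol Z V"
    and zero: "a \<odot>\<^bsub>sec F V\<^esub> res F P V e = \<zero>\<^bsub>sec F V\<^esub>" and z: "z \<in> V"
  shows "a z = 0"
proof -
  let ?Z = "topspace (ctop Z) - preim Z p S" and ?Y = "topspace (ctop Y) - S"
  have cont: "continuous_map (ctop Z) (ctop Y) p" using p unfolding hol_map_def by (elim conjE)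
  have oZ: "openin (ctop Z) ?Z"
  proof -
    have "preim Z p ?Y = ?Z"
      using cont unfolding preim_def continuous_map_def by auto
    then show ?thesis using open_preim[OF S] by simp
  qed
  have topZ: "topspace (subtopology (ctop Z) ?Z) = ?Z" and topY: "topspace (subtopology (ctop Y) ?Y) = ?Y"
    by auto
  obtain g where hom: "homeomorphic_maps (subtopology (ctop Z) ?Z) (subtopology (ctop Y) ?Y) p g"
    and g: "hol_map (open_subspace Y ?Y) (open_subspace Z ?Z) g"
    using bi unfolding biholomorphic_map_def by (auto simp: open_subspace_def)
  have gp: "g (p w) = w" if "w \<in> ?Z" for w
    using hom that topZ unfolding homeomorphic_maps_def by blast
  have pg: "p (g y) = y" if "y \<in> ?Y" for y
    using hom that topY unfolding homeomorphic_maps_def by blast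
  have VZ: "V \<subseteq> ?Z" using V openin_subset by blast
  \<comment> \<open>This is the image of \<open>V\<close>, written as a preimage under the inverse to see that it is open.\<close>
  define W where "W = preim (open_subspace Y ?Y) g V"
  have W_eq: "W = {y \<in> ?Y. g y \<in> V}"
    unfolding W_def preim_def using topY by (simp add: open_subspace_def)
  have oV: "openin (ctop (open_subspace Z ?Z)) V" using openin_open_subspace[OF oZ] V(1) VZ by blast
  have "openin (ctop (open_subspace Y ?Y)) W"
    unfolding W_def preim_def using g oV unfolding hol_map_def
    by (elim conjE) (rule openin_continuous_map_preimage)
  then have oW: "openin (ctop Y) W" using openin_open_subspace[OF S] by blast
  have pV: "p w \<in> W" if w: "w \<in> V" for w
  proof -
    have "w \<in> ?Z" using w VZ by blast
    then have "p w \<in> ?Y" using cont unfolding continuous_map_def preim_def by auto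
    then show ?thesis unfolding W_eq using gp[OF \<open>w \<in> ?Z\<close>] w by simp
  qed
  have WU: "W \<subseteq> U"
  proof
    fix y assume "y \<in> W"
    then have "y \<in> ?Y" "g y \<in> V" unfolding W_eq by blast+
    then have "p (g y) \<in> U" "p (g y) = y" using V(2) pg by (auto simp: preim_def)
    then show "y \<in> U" by simp
  qed
  have preim_W: "preim Z p W = V"
  proof
    show "V \<subseteq> preim Z p W" using pV VZ unfolding preim_def by blast
    show "preim Z p W \<subseteq> V"
    proof
      fix w assume "w \<in> preim Z p W"
      then have w: "w \<in> topspace (ctop Z)" "p w \<in> W" unfolding preim_def by blast+
      then have "w \<in> ?Z" "g (p w) \<in> V" unfolding W_eq preim_def by blast+
      then show "w \<in> V" using gp by simp
    qed
  qed
  define b where "b = pullback (open_subspace Y ?Y) g V a"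
  have b: "b \<in> hol Y W"
    using g oV a unfolding hol_map_def b_def W_def by simp
  have b_eq: "b y = a (g y)" if "y \<in> W" for y
    using that by (simp add: b_def pullback_def flip: W_def)
  have pull_b: "pullback Z p W b = a"
  proof -
    have "pullback Z p W b = restrict a V"
      unfolding pullback_def preim_W
    proof (rule restrict_ext)
      fix w assume w: "w \<in> V"
      then show "b (p w) = a w" using b_eq[OF pV[OF w]] gp VZ by auto
    qed
    then show ?thesis using Z.restrict_hol_eq[OF V(1) a] by simp
  qed
  have VP: "V \<subseteq> P" using V(2) by blast
  have e': "res F P V e \<in> carrier (sec F (preim Z p W))"
    unfolding preim_W by (rule res_closed[OF open_P V(1) VP e(1)])
  have zW: "p z \<in> W" by (rule pV[OF z])
  have "0 = \<Phi> W (pullback Z p W b \<odot>\<^bsub>sec F (preim Z p W)\<^esub> res F P V e) 0 (p z)"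
    unfolding pull_b preim_W zero using \<Phi>_zero[OF oW WU rank zW] unfolding preim_W by simp
  also have "\<dots> = b (p z) * \<Phi> W (res F P V e) 0 (p z)"
    by (rule \<Phi>_smult[OF oW WU b e' rank zW])
  also have "\<Phi> W (res F P V e) 0 (p z) = \<Phi> U e 0 (p z)"
    using \<Phi>_res[OF oW WU e(1) rank zW] unfolding preim_W .
  also have "\<dots> = 1" using e(2) zW WU by blast
  also have "b (p z) = a z" using b_eq[OF zW] gp VZ z by auto
  finally show ?thesis by simp
qed

end

locale trivialised_modification = trivialised_direct_image Y Z p F U r \<Phi>
  for Y :: "'y fspace" and Z :: "'z fspace" and p :: "'z \<Rightarrow> 'y" and F :: "('z, 'f) msheaf"
    and U :: "'y set" and r :: nat and \<Phi> :: "'y set \<Rightarrow> 'f \<Rightarrow> nat \<Rightarrow> 'y \<Rightarrow> complex" +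
  fixes e :: 'f
  assumes modification: "proper_modification Z Y p"
    and e: "e \<in> carrier (sec F P)" and e_one: "\<forall>x\<in>U. \<Phi> U e 0 x = 1"
begin

text \<open>
  The preimage of the exceptional set is nowhere dense, and a function vanishing off it vanishes.
\<close>

lemma first_basis_section_torsion_free:
  assumes V: "openin (ctop Z) V" "V \<subseteq> P" and a: "a \<in> hol Z V"
    and zero: "a \<odot>\<^bsub>sec F V\<^esub> res F P V e = \<zero>\<^bsub>sec F V\<^esub>" and z: "z \<in> V"
  shows "a z = 0"
proof (rule Z.zero_if_zero_densely[OF V(1) a _ z])
  obtain S where S: "analytic_subset Y S" "ctop Z interior_of (preim Z p S) = {}"
    and bi: "biholomorphic_map (open_subspace Z (topspace (ctop Z) - preim Z p S))
      (open_subspace Y (topspace (ctop Y) - S)) p"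
    using modification unfolding proper_modification_def by (elim conjE exE) (rule that; assumption)
  have oY: "openin (ctop Y) (topspace (ctop Y) - S)"
    by (rule Y.openin_compl_analytic_subset[OF S(1)])
  have cont: "continuous_map (ctop Z) (ctop Y) p" using p unfolding hol_map_def by (elim conjE)
  fix W assume W: "openin (ctop Z) W" "W \<subseteq> V" "W \<noteq> {}"
  have oW: "openin (ctop Z) (W - preim Z p S)"
  proof -
    have "W - preim Z p S = W \<inter> preim Z p (topspace (ctop Y) - S)"
      using cont openin_subset[OF W(1)] unfolding preim_def continuous_map_def by auto
    then show ?thesis using openin_Int[OF W(1) open_preim[OF oY]] by (simp only:)
  qed
  have "\<not> W \<subseteq> preim Z p S"
    using W(1,3) S(2) interior_of_maximal by blast
  then obtain w where w: "w \<in> W - preim Z p S" by blast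
  let ?W = "W - preim Z p S"
  have WV: "?W \<subseteq> V" "?W \<subseteq> P - preim Z p S" using W(2) V(2) by blast+
  have eV: "res F P V e \<in> carrier (sec F V)" by (rule res_closed[OF open_P V e])
  have aW: "restrict a ?W \<in> hol Z ?W" by (rule Z.restrict_hol[OF V(1) oW WV(1) a])
  have "restrict a ?W \<odot>\<^bsub>sec F ?W\<^esub> res F P ?W e = restrict a ?W \<odot>\<^bsub>sec F ?W\<^esub> res F V ?W (res F P V e)"
    by (simp only: res_res[OF open_P V(1) oW V(2) WV(1) e])
  also have "\<dots> = res F V ?W (a \<odot>\<^bsub>sec F V\<^esub> res F P V e)"
    by (rule res_smult[OF V(1) oW WV(1) eV a, symmetric])
  also have "\<dots> = res F V ?W ((\<lambda>x\<in>V. 0) \<odot>\<^bsub>sec F V\<^esub> res F P V e)"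
    by (simp only: zero smult_zero_left[OF V(1) eV])
  also have "\<dots> = restrict (\<lambda>x\<in>V. 0) ?W \<odot>\<^bsub>sec F ?W\<^esub> res F V ?W (res F P V e)"
    by (rule res_smult[OF V(1) oW WV(1) eV Z.const_hol[OF V(1)]])
  also have "restrict (\<lambda>x\<in>V. 0) ?W = (\<lambda>x\<in>?W. 0 :: complex)"
    using WV(1) by (intro restrict_ext) auto
  also have "(\<lambda>x\<in>?W. 0) \<odot>\<^bsub>sec F ?W\<^esub> res F V ?W (res F P V e) = \<zero>\<^bsub>sec F ?W\<^esub>"
    by (rule smult_zero_left[OF oW res_closed[OF V(1) oW WV(1) eV]])
  finally have "restrict a ?W w = 0"
    using first_basis_section_torsion_free_off[OF oY bi e e_one oW WV(2) aW _ w] by blast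
  then have "a w = 0" using w by simp
  then show "\<exists>w\<in>W. a w = 0" using w by blast
qed

lemma smult_first_basis_section_eq_zero_iff:
  assumes V: "openin (ctop Z) V" "V \<subseteq> P" and a: "a \<in> hol Z V"
  shows "a \<odot>\<^bsub>sec F V\<^esub> res F P V e = \<zero>\<^bsub>sec F V\<^esub> \<longleftrightarrow> (\<forall>z\<in>V. a z = 0)"
proof
  assume "\<forall>z\<in>V. a z = 0"
  then have "restrict a V = (\<lambda>x\<in>V. 0)" by (intro restrict_ext) simp
  then have "a = (\<lambda>x\<in>V. 0)" using Z.restrict_hol_eq[OF V(1) a] by simp
  then show "a \<odot>\<^bsub>sec F V\<^esub> res F P V e = \<zero>\<^bsub>sec F V\<^esub>"
    using smult_zero_left[OF V(1) res_closed[OF open_P V e]] by simp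
qed (use first_basis_section_torsion_free[OF V a] in blast)

end


context trivialised_modification
begin

text \<open>
  The section \<open>e\<close> being torsion free, the kernel of this homomorphism is the annihilator of \<open>q\<close> in the
  structure sheaf.
\<close>

lemma annihilator_free_sheaf_hom:
  assumes q: "q \<in> hol Z P"
  shows "sheaf_hom (open_subspace Z P) (free_sheaf Z 1) F
    (\<lambda>V s. (\<lambda>x\<in>V. s 0 x * q x) \<odot>\<^bsub>sec F V\<^esub> res F P V e)"
proof -
  have sq: "(\<lambda>x\<in>V. s 0 x * q x) \<in> hol Z V"
    if "openin (ctop Z) V" "V \<subseteq> P" "s \<in> {..<1} \<rightarrow>\<^sub>E hol Z V" for V and s :: "nat \<Rightarrow> 'z \<Rightarrow> complex"
  proof (rule Z.mult_hol[OF that(1)])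
    have "s 0 \<in> hol Z V" using that(3) by (rule PiE_mem) simp
    then show "restrict (s 0) V \<in> hol Z V" using Z.restrict_hol_eq[OF that(1)] by simp
    show "restrict q V \<in> hol Z V" by (rule Z.restrict_hol[OF open_P that(1,2) q])
  qed
  show ?thesis
    unfolding sheaf_hom_def openin_open_subspace[OF open_P] hol_open_subspace
  proof (intro conjI allI impI ballI; (elim conjE)?)
    fix V s assume V: "openin (ctop Z) V" "V \<subseteq> P" and s: "s \<in> carrier (sec (free_sheaf Z 1) V)"
    note eV = res_closed[OF open_P V e]
    have s': "s \<in> {..<1} \<rightarrow>\<^sub>E hol Z V" using s by (simp add: free_sheaf_def)
    show "(\<lambda>x\<in>V. s 0 x * q x) \<odot>\<^bsub>sec F V\<^esub> res F P V e \<in> carrier (sec F V)"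
      by (rule smult_closed[OF V(1) sq[OF V s'] eV])
    {
      fix t assume t: "t \<in> carrier (sec (free_sheaf Z 1) V)"
      have t': "t \<in> {..<1} \<rightarrow>\<^sub>E hol Z V" using t by (simp add: free_sheaf_def)
      have "(\<lambda>x\<in>V. (s \<oplus>\<^bsub>sec (free_sheaf Z 1) V\<^esub> t) 0 x * q x) =
          (\<lambda>x\<in>V. (\<lambda>x\<in>V. s 0 x * q x) x + (\<lambda>x\<in>V. t 0 x * q x) x)"
        by (rule restrict_ext) (simp add: free_sheaf_def distrib_right)
      then show "(\<lambda>x\<in>V. (s \<oplus>\<^bsub>sec (free_sheaf Z 1) V\<^esub> t) 0 x * q x) \<odot>\<^bsub>sec F V\<^esub> res F P V e =
          (\<lambda>x\<in>V. s 0 x * q x) \<odot>\<^bsub>sec F V\<^esub> res F P V e \<oplus>\<^bsub>sec F V\<^esub>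
          (\<lambda>x\<in>V. t 0 x * q x) \<odot>\<^bsub>sec F V\<^esub> res F P V e"
        using smult_add_left[OF V(1) sq[OF V s'] sq[OF V t'] eV] by (simp only:)
    }
    {
      fix f assume f: "f \<in> hol Z V"
      have "(\<lambda>x\<in>V. (f \<odot>\<^bsub>sec (free_sheaf Z 1) V\<^esub> s) 0 x * q x) =
          (\<lambda>x\<in>V. f x * (\<lambda>x\<in>V. s 0 x * q x) x)"
        by (rule restrict_ext) (simp add: free_sheaf_def)
      then show "(\<lambda>x\<in>V. (f \<odot>\<^bsub>sec (free_sheaf Z 1) V\<^esub> s) 0 x * q x) \<odot>\<^bsub>sec F V\<^esub> res F P V e =
          f \<odot>\<^bsub>sec F V\<^esub> ((\<lambda>x\<in>V. s 0 x * q x) \<odot>\<^bsub>sec F V\<^esub> res F P V e)"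
        using smult_smult[OF V(1) f sq[OF V s'] eV] by (simp only:)
    }
  next
    fix V W s assume V: "openin (ctop Z) V" "V \<subseteq> P" and W: "openin (ctop Z) W" "W \<subseteq> V"
      and s: "s \<in> carrier (sec (free_sheaf Z 1) V)"
    note eV = res_closed[OF open_P V e]
    have s': "s \<in> {..<1} \<rightarrow>\<^sub>E hol Z V" using s by (simp add: free_sheaf_def)
    have "res F V W ((\<lambda>x\<in>V. s 0 x * q x) \<odot>\<^bsub>sec F V\<^esub> res F P V e) =
        restrict (\<lambda>x\<in>V. s 0 x * q x) W \<odot>\<^bsub>sec F W\<^esub> res F V W (res F P V e)"
      by (rule res_smult[OF V(1) W eV sq[OF V s']])
    also have "res F V W (res F P V e) = res F P W e"
      by (rule res_res[OF open_P V(1) W(1) V(2) W(2) e])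
    also have "restrict (\<lambda>x\<in>V. s 0 x * q x) W = (\<lambda>x\<in>W. res (free_sheaf Z 1) V W s 0 x * q x)"
      using W(2) by (intro restrict_ext) (auto simp: free_sheaf_def)
    finally show "(\<lambda>x\<in>W. res (free_sheaf Z 1) V W s 0 x * q x) \<odot>\<^bsub>sec F W\<^esub> res F P W e =
        res F V W ((\<lambda>x\<in>V. s 0 x * q x) \<odot>\<^bsub>sec F V\<^esub> res F P V e)" ..
  qed
qed

end

text \<open>
  A homomorphism out of a free sheaf is determined by the images of the basis sections. The target \<open>G\<close> is
  required to have the operations of the structure sheaf, written as the free sheaf of rank \<open>1\<close>, but its
  sections may be any ideal; it is applied to the kernel above.
\<close>

lemma sheaf_hom_free_sheaf_expand:
  fixes \<psi> :: "'a set \<Rightarrow> (nat \<Rightarrow> 'a \<Rightarrow> complex) \<Rightarrow> nat \<Rightarrow> 'a \<Rightarrow> complex"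
  assumes X: "holomorphic_space X" and N: "openin (ctop X) N"
    and hom: "sheaf_hom (open_subspace X N) (free_sheaf X k) G \<psi>"
    and add_G: "\<And>V s t x. (s \<oplus>\<^bsub>sec G V\<^esub> t) = s \<oplus>\<^bsub>sec (free_sheaf X 1) V\<^esub> t"
    and smult_G: "\<And>V f s. (f \<odot>\<^bsub>sec G V\<^esub> s) = f \<odot>\<^bsub>sec (free_sheaf X 1) V\<^esub> s"
    and res_G: "res G = res (free_sheaf X 1)"
    and V: "openin (ctop X) V" "V \<subseteq> N"
    and s: "s \<in> {..<k} \<rightarrow>\<^sub>E hol X V" and x: "x \<in> V"
  shows "\<psi> V s 0 x = (\<Sum>i<k. s i x * \<psi> N (\<lambda>j\<in>{..<k}. \<lambda>y\<in>N. if j = i then 1 else 0) 0 x)"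
proof -
  interpret holomorphic_space X by (rule X)
  define \<delta> :: "'a set \<Rightarrow> nat \<Rightarrow> nat \<Rightarrow> 'a \<Rightarrow> complex"
    where "\<delta> = (\<lambda>W i. \<lambda>j\<in>{..<k}. \<lambda>y\<in>W. if j = i then 1 else 0 :: complex)"
  \<comment> \<open>The truncations of \<open>s\<close> allow an induction in which one basis section is added at a time.\<close>
  define part where "part = (\<lambda>m. \<lambda>j\<in>{..<k}. \<lambda>y\<in>V. if j < m then s j y else (0::complex))"
  have opens: "openin (ctop (open_subspace X N)) W \<longleftrightarrow> openin (ctop X) W \<and> W \<subseteq> N" for W
    by (rule openin_open_subspace[OF N])
  have \<delta>: "\<delta> W i \<in> carrier (sec (free_sheaf X k) W)" if "openin (ctop X) W" for W i
    using const_hol[OF that, of 0] const_hol[OF that, of 1]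
    by (auto simp: \<delta>_def free_sheaf_def)
  have s_hol: "s i \<in> hol X V" if "i < k" for i using s by (rule PiE_mem) (simp add: that)
  have part: "part m \<in> carrier (sec (free_sheaf X k) V)" for m
  proof -
    have "(\<lambda>y\<in>V. if j < m then s j y else (0::complex)) \<in> hol X V" if "j < k" for j
    proof (cases "j < m")
      case True
      then show ?thesis using restrict_hol_self[OF V(1) s_hol[OF that]] by simp
    next
      case False
      then show ?thesis using const_hol[OF V(1), of 0] by simp
    qed
    then show ?thesis by (auto simp: part_def free_sheaf_def)
  qed
  have hom_add: "\<psi> V (u \<oplus>\<^bsub>sec (free_sheaf X k) V\<^esub> v) = \<psi> V u \<oplus>\<^bsub>sec G V\<^esub> \<psi> V v"
    and hom_smult: "f \<in> hol X V \<Longrightarrow> \<psi> V (f \<odot>\<^bsub>sec (free_sheaf X k) V\<^esub> u) = f \<odot>\<^bsub>sec G V\<^esub> \<psi> V u"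
    if "u \<in> carrier (sec (free_sheaf X k) V)" "v \<in> carrier (sec (free_sheaf X k) V)" for u v f
    using hom[unfolded sheaf_hom_def, THEN conjunct1, rule_format, of V] opens V that by simp_all
  have hom_res: "\<psi> V (res (free_sheaf X k) N V u) = res G N V (\<psi> N u)"
    if "u \<in> carrier (sec (free_sheaf X k) N)" for u
    using hom[unfolded sheaf_hom_def, THEN conjunct2, rule_format, of N V] opens V N that by simp
  have add_eq: "u \<oplus>\<^bsub>sec (free_sheaf X l) W\<^esub> v = (\<lambda>i\<in>{..<l}. \<lambda>y\<in>W. u i y + v i y)"
    and smult_eq: "f \<odot>\<^bsub>sec (free_sheaf X l) W\<^esub> u = (\<lambda>i\<in>{..<l}. \<lambda>y\<in>W. f y * u i y)"
    and res_eq: "res (free_sheaf X l) W W' u = (\<lambda>i\<in>{..<l}. restrict (u i) W')" for l W W' u v f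
    by (simp_all add: free_sheaf_def)
  have \<delta>_V: "\<psi> V (\<delta> V i) 0 x = \<psi> N (\<delta> N i) 0 x" for i
  proof -
    have "res (free_sheaf X k) N V (\<delta> N i) = \<delta> V i"
      using V(2) unfolding \<delta>_def res_eq by (intro restrict_ext) (simp add: subset_iff Int_absorb1)
    then have "\<psi> V (\<delta> V i) = res (free_sheaf X 1) N V (\<psi> N (\<delta> N i))"
      using hom_res[OF \<delta>[OF N], of i] res_G by simp
    then show ?thesis using x by (simp add: res_eq)
  qed
  have sum_part: "\<psi> V (part m) 0 x = (\<Sum>i<m. s i x * \<psi> N (\<delta> N i) 0 x)" if "m \<le> k" for m
    using that
  proof (induction m)
    case 0
    have "part 0 = (\<lambda>y\<in>V. 0) \<odot>\<^bsub>sec (free_sheaf X k) V\<^esub> part 0"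
      unfolding part_def smult_eq by (intro restrict_ext) simp
    then have "\<psi> V (part 0) = (\<lambda>y\<in>V. 0) \<odot>\<^bsub>sec G V\<^esub> \<psi> V (part 0)"
      using hom_smult[OF part part const_hol[OF V(1)], of 0 0] by simp
    then have "\<psi> V (part 0) 0 x = ((\<lambda>y\<in>V. 0) \<odot>\<^bsub>sec (free_sheaf X 1) V\<^esub> \<psi> V (part 0)) 0 x"
      unfolding smult_G by (rule arg_cong[where f = "\<lambda>u. u 0 x"])
    also have "\<dots> = 0" using x by (simp add: smult_eq)
    finally show ?case by simp
  next
    case (Suc m)
    then have m: "m < k" by simp
    let ?d = "s m \<odot>\<^bsub>sec (free_sheaf X k) V\<^esub> \<delta> V m"
    have d: "?d \<in> carrier (sec (free_sheaf X k) V)"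
    proof -
      have "(\<lambda>y\<in>V. s m y * (if j = m then 1 else 0)) \<in> hol X V" for j
        using restrict_hol_self[OF V(1) s_hol[OF m]] const_hol[OF V(1), of 0] by (cases "j = m") simp_all
      moreover have "?d = (\<lambda>j\<in>{..<k}. \<lambda>y\<in>V. s m y * (if j = m then 1 else 0))"
        unfolding \<delta>_def smult_eq by (intro restrict_ext) simp
      ultimately show ?thesis by (simp add: free_sheaf_def)
    qed
    have "part (Suc m) = part m \<oplus>\<^bsub>sec (free_sheaf X k) V\<^esub> ?d"
      unfolding part_def \<delta>_def add_eq smult_eq by (intro restrict_ext) (auto simp: less_Suc_eq)
    then have "\<psi> V (part (Suc m)) = \<psi> V (part m) \<oplus>\<^bsub>sec G V\<^esub> (s m \<odot>\<^bsub>sec G V\<^esub> \<psi> V (\<delta> V m))"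
      using hom_add[OF part d] hom_smult[OF \<delta>[OF V(1)] \<delta>[OF V(1)] s_hol[OF m]] by simp
    then have "\<psi> V (part (Suc m)) 0 x = \<psi> V (part m) 0 x + s m x * \<psi> V (\<delta> V m) 0 x"
      using x unfolding add_G smult_G by (simp add: add_eq smult_eq)
    then show ?case using Suc \<delta>_V by simp
  qed
  have "part k = s"
  proof
    fix j
    show "part k j = s j"
    proof (cases "j < k")
      case True
      then show ?thesis using restrict_hol_eq[OF V(1) s_hol[OF True]] by (simp add: part_def)
    next
      case False
      then show ?thesis using PiE_arb[OF s, of j] by (simp add: part_def)
    qed
  qed
  then show ?thesis using sum_part[OF order_refl] unfolding \<delta>_def by (simp only:)
qed

context trivialised_modification
begin

text \<open>
  The annihilator of \<open>q\<close> is the kernel of a homomorphism from the structure sheaf to the coherent sheaf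
  \<open>F\<close>, hence of finite type.
\<close>

lemma annihilator_locally_finitely_generated:
  assumes coh: "coherent_sheaf Z F" and q: "q \<in> hol Z P" and z: "z \<in> P"
  obtains N and k :: nat and a where "openin (ctop Z) N" "z \<in> N" "N \<subseteq> P"
    "\<forall>i<k. a i \<in> hol Z N" "\<forall>i<k. \<forall>y\<in>N. a i y * q y = 0"
    "\<And>V c y. openin (ctop Z) V \<Longrightarrow> V \<subseteq> N \<Longrightarrow> c \<in> hol Z V \<Longrightarrow> \<forall>y\<in>V. c y * q y = 0 \<Longrightarrow> y \<in> V \<Longrightarrow>
      \<exists>W s. openin (ctop Z) W \<and> y \<in> W \<and> W \<subseteq> V \<and> (\<forall>w\<in>W. c w = (\<Sum>i<k. s i w * a i w))"
proof -
  define \<phi> where "\<phi> = (\<lambda>V s. (\<lambda>x\<in>V. s (0::nat) x * q x) \<odot>\<^bsub>sec F V\<^esub> res F P V e)"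
  define K where "K = sheaf_kernel (free_sheaf Z 1) F \<phi>"
  have "sheaf_hom (open_subspace Z P) (free_sheaf (open_subspace Z P) 1) F \<phi>"
    unfolding \<phi>_def free_sheaf_open_subspace by (rule annihilator_free_sheaf_hom[OF q])
  with coh[unfolded coherent_sheaf_def, THEN conjunct2, THEN conjunct2, rule_format, of P 1 \<phi>] open_P
  have "finite_type (open_subspace Z P) K" unfolding K_def by simp
  moreover have "z \<in> topspace (ctop (open_subspace Z P))"
    using z openin_subset[OF open_P] by (auto simp: open_subspace_def)
  ultimately have "\<exists>N k \<psi>. openin (ctop (open_subspace Z P)) N \<and> z \<in> N \<and>
      sheaf_epi (open_subspace (open_subspace Z P) N) (free_sheaf (open_subspace (open_subspace Z P) N) k) K \<psi>"
    unfolding finite_type_def by (rule bspec)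
  then obtain N k \<psi> where oN: "openin (ctop (open_subspace Z P)) N" and zN: "z \<in> N"
    and epi0: "sheaf_epi (open_subspace (open_subspace Z P) N) (free_sheaf Z k) K \<psi>"
    unfolding free_sheaf_open_subspace by (elim exE conjE) simp
  have N: "openin (ctop Z) N" "N \<subseteq> P" using oN openin_open_subspace[OF open_P] by blast+
  have sub: "open_subspace (open_subspace Z P) N = open_subspace Z N"
    using N(2) by (simp add: open_subspace_def subtopology_subtopology Int_absorb1)
  have epi: "sheaf_epi (open_subspace Z N) (free_sheaf Z k) K \<psi>" using epi0 unfolding sub .
  have hom: "sheaf_hom (open_subspace Z N) (free_sheaf Z k) K \<psi>"
    using epi unfolding sheaf_epi_def by (elim conjE)
  have opens: "openin (ctop (open_subspace Z N)) V \<longleftrightarrow> openin (ctop Z) V \<and> V \<subseteq> N" for V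
    by (rule openin_open_subspace[OF N(1)])
  have K_carrier: "s \<in> carrier (sec K V) \<longleftrightarrow>
      s \<in> {..<1} \<rightarrow>\<^sub>E hol Z V \<and> (\<forall>x\<in>V. s 0 x * q x = 0)"
    if V: "openin (ctop Z) V" "V \<subseteq> P" for V s
  proof -
    have "\<phi> V s = \<zero>\<^bsub>sec F V\<^esub> \<longleftrightarrow> (\<forall>x\<in>V. s 0 x * q x = 0)" if s: "s \<in> {..<1} \<rightarrow>\<^sub>E hol Z V"
    proof -
      have "s 0 \<in> hol Z V" using s by (rule PiE_mem) simp
      then have "(\<lambda>x\<in>V. s 0 x * q x) \<in> hol Z V"
        using Z.restrict_hol_self[OF V(1)] Z.restrict_hol[OF open_P V q] by (intro Z.mult_hol[OF V(1)])
      from smult_first_basis_section_eq_zero_iff[OF V this] show ?thesis unfolding \<phi>_def by simp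
    qed
    then show ?thesis by (auto simp: K_def sheaf_kernel_def free_sheaf_def)
  qed
  define \<delta> where "\<delta> = (\<lambda>i. \<lambda>j\<in>{..<k}. \<lambda>y\<in>N. if j = i then 1 else 0 :: complex)"
  define a where "a = (\<lambda>i. \<psi> N (\<delta> i) 0)"
  have \<psi>_N: "\<psi> N (\<delta> i) \<in> carrier (sec K N)" for i
  proof -
    have "\<delta> i \<in> carrier (sec (free_sheaf Z k) N)"
      using Z.const_hol[OF N(1), of 0] Z.const_hol[OF N(1), of 1] by (auto simp: \<delta>_def free_sheaf_def)
    then show ?thesis
      using hom[unfolded sheaf_hom_def, THEN conjunct1, rule_format, of N] opens N(1) by simp
  qed
  have a: "\<forall>i<k. a i \<in> hol Z N" "\<forall>i<k. \<forall>y\<in>N. a i y * q y = 0"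
    using \<psi>_N unfolding K_carrier[OF N] a_def by (auto intro: PiE_mem)
  have gen: "\<exists>W s. openin (ctop Z) W \<and> y \<in> W \<and> W \<subseteq> V \<and> (\<forall>w\<in>W. c w = (\<Sum>i<k. s i w * a i w))"
    if V: "openin (ctop Z) V" "V \<subseteq> N" and c: "c \<in> hol Z V" "\<forall>y\<in>V. c y * q y = 0" and y: "y \<in> V" for V c y
  proof -
    let ?t = "\<lambda>i\<in>{..<1::nat}. c"
    have "V \<subseteq> P" using V(2) N(2) by blast
    then have t: "?t \<in> carrier (sec K V)" using K_carrier[OF V(1)] c by simp
    from epi[unfolded sheaf_epi_def, THEN conjunct2, rule_format, of V ?t y] opens V t y
    obtain W s where W: "openin (ctop Z) W" "y \<in> W" "W \<subseteq> V" and s: "s \<in> carrier (sec (free_sheaf Z k) W)"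
      and eq: "\<psi> W s = res K V W ?t"
      by auto
    have WN: "W \<subseteq> N" using W(3) V(2) by blast
    have "c w = (\<Sum>i<k. s i w * a i w)" if w: "w \<in> W" for w
    proof -
      have "c w = res K V W ?t 0 w" using w by (simp add: K_def sheaf_kernel_def free_sheaf_def)
      also have "\<dots> = \<psi> W s 0 w" using eq by simp
      also have "\<dots> = (\<Sum>i<k. s i w * \<psi> N (\<delta> i) 0 w)"
        unfolding \<delta>_def
      proof (rule sheaf_hom_free_sheaf_expand[OF _ N(1) hom _ _ _ W(1) WN _ w])
        show "holomorphic_space Z" by unfold_locales
        show "s \<in> {..<k} \<rightarrow>\<^sub>E hol Z W" using s by (simp add: free_sheaf_def)
      qed (simp_all add: K_def sheaf_kernel_def)
      finally show ?thesis unfolding a_def .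
    qed
    then show ?thesis using W by blast
  qed
  show ?thesis by (rule that[OF N(1) zN N(2) a gen])
qed

text \<open>
  The quotient \<open>h\<close> of the pullbacks of \<open>f\<close> and \<open>g\<close> exists on \<open>P\<close> by normality of \<open>Z\<close>. It multiplies the
  section \<open>e\<close> of \<open>F\<close>, and the first component of the product is a holomorphic function on \<open>U\<close> that solves
  the division problem on \<open>Y\<close>.
\<close>

lemma integral_equation_solvable:
  fixes n :: nat
  assumes coh: "coherent_sheaf Z F" and normal: "normal_complex_space Z" and cZ: "complex_space Z"
    and f: "f \<in> hol Y U" and g: "g \<in> hol Y U" and u: "\<forall>i<n. u i \<in> hol Y U"
    and eq: "\<forall>y\<in>U. f y ^ n + (\<Sum>i<n. u i y * (f y ^ i * g y ^ (n - i))) = 0"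
  obtains b where "b \<in> hol Y U" "\<forall>y\<in>U. f y = b y * g y"
proof -
  let ?pb = "pullback Z p U"
  have pb: "?pb a z = a (p z)" if "z \<in> P" for a z using that by (simp add: pullback_def)
  have pU: "p z \<in> U" if "z \<in> P" for z using that unfolding preim_def by blast
  have nz: "integrally_closed (stalk Z z)" if "z \<in> P" for z
    using normal that openin_subset[OF open_P] unfolding normal_complex_space_def by blast
  have fg: "?pb f \<in> hol Z P" "?pb g \<in> hol Z P" "\<forall>i<n. ?pb (u i) \<in> hol Z P"
    using pullback_hol[OF open_U] f g u by simp_all
  have eqP: "\<forall>z\<in>P. ?pb f z ^ n + (\<Sum>i<n. ?pb (u i) z * (?pb f z ^ i * ?pb g z ^ (n - i))) = 0"
    using eq pU by (simp add: pb)
  have dich: "\<exists>N. openin (ctop Z) N \<and> z \<in> N \<and> N \<subseteq> P \<and> ((\<forall>y\<in>N. ?pb g y = 0) \<or>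
      (\<forall>W. openin (ctop Z) W \<longrightarrow> W \<noteq> {} \<longrightarrow> W \<subseteq> N \<longrightarrow> (\<exists>w\<in>W. ?pb g w \<noteq> 0)))" if z: "z \<in> P" for z
  proof -
    obtain N1 and k :: nat and a where N1: "openin (ctop Z) N1" "z \<in> N1" "N1 \<subseteq> P"
      and a: "\<forall>i<k. a i \<in> hol Z N1" "\<forall>i<k. \<forall>y\<in>N1. a i y * ?pb g y = 0"
      and gen: "\<And>V c y. openin (ctop Z) V \<Longrightarrow> V \<subseteq> N1 \<Longrightarrow> c \<in> hol Z V \<Longrightarrow> \<forall>y\<in>V. c y * ?pb g y = 0 \<Longrightarrow> y \<in> V \<Longrightarrow>
        \<exists>W s. openin (ctop Z) W \<and> y \<in> W \<and> W \<subseteq> V \<and> (\<forall>w\<in>W. c w = (\<Sum>i<k. s i w * a i w))"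
      by (rule annihilator_locally_finitely_generated[OF coh fg(2) z]) blast
    have "z \<in> topspace (ctop Z)" using z openin_subset[OF open_P] by blast
    then obtain C m h D where C: "z \<in> C" "chart Z m C h" and D: "countably_dense_in D (ctop Z) C"
      by (rule complex_space_chart[OF cZ])
    have oC: "openin (ctop Z) C" using C(2) unfolding chart_def by blast
    let ?N = "N1 \<inter> C"
    have N: "openin (ctop Z) ?N" "z \<in> ?N" using N1 oC C by auto
    have gN: "restrict (?pb g) ?N \<in> hol Z ?N"
      using Z.restrict_hol[OF open_P N(1) _ fg(2)] N1(3) by blast
    have aN: "\<forall>i<k. restrict (a i) ?N \<in> hol Z ?N"
      using Z.restrict_hol[OF N1(1) N(1) Int_lower1] a(1) by blast
    have genN: "\<exists>W s. openin (ctop Z) W \<and> y \<in> W \<and> W \<subseteq> V \<and>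
        (\<forall>w\<in>W. c w = (\<Sum>i<k. s i w * restrict (a i) ?N w))"
      if V: "openin (ctop Z) V" "V \<subseteq> ?N" and c: "c \<in> hol Z V" "\<forall>y\<in>V. c y * restrict (?pb g) ?N y = 0"
        and y: "y \<in> V" for V c y
    proof -
      have "\<forall>y\<in>V. c y * ?pb g y = 0" using c(2) V(2) by (auto simp: subset_iff)
      moreover have "V \<subseteq> N1" using V(2) by blast
      ultimately obtain W s where W: "openin (ctop Z) W" "y \<in> W" "W \<subseteq> V"
        and s: "\<forall>w\<in>W. c w = (\<Sum>i<k. s i w * a i w)"
        using gen[OF V(1) _ c(1) _ y] by blast
      have "\<forall>w\<in>W. c w = (\<Sum>i<k. s i w * restrict (a i) ?N w)"
      proof
        fix w assume w: "w \<in> W"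
        then have "w \<in> ?N" using W(3) V(2) by blast
        then show "c w = (\<Sum>i<k. s i w * restrict (a i) ?N w)" using s w by simp
      qed
      then show ?thesis using W by blast
    qed
    obtain N' where N': "openin (ctop Z) N'" "z \<in> N'" "N' \<subseteq> ?N"
      and alt: "(\<forall>y\<in>N'. restrict (?pb g) ?N y = 0) \<or>
        (\<forall>W. openin (ctop Z) W \<longrightarrow> W \<noteq> {} \<longrightarrow> W \<subseteq> N' \<longrightarrow> (\<exists>w\<in>W. restrict (?pb g) ?N w \<noteq> 0))"
    proof (rule Z.zero_or_nonzero_densely[OF nz[OF z] N gN aN _ genN])
      show "\<forall>i<k. \<forall>y\<in>?N. restrict (a i) ?N y * restrict (?pb g) ?N y = 0" using a(2) by simp
      show "countably_dense_in D (ctop Z) ?N" by (rule countably_dense_in_subset[OF D]) blast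
    qed
    have same: "restrict (?pb g) ?N w = ?pb g w" if "w \<in> N'" for w using that N'(3) by auto
    have "(\<forall>y\<in>N'. ?pb g y = 0) \<or>
        (\<forall>W. openin (ctop Z) W \<longrightarrow> W \<noteq> {} \<longrightarrow> W \<subseteq> N' \<longrightarrow> (\<exists>w\<in>W. ?pb g w \<noteq> 0))"
      using alt same by (metis subsetD)
    moreover have "N' \<subseteq> P" using N'(3) N1(3) by blast
    ultimately show ?thesis using N'(1,2) by blast
  qed
  obtain h where h: "h \<in> hol Z P" and hg: "\<forall>z\<in>P. h z * ?pb g z = ?pb f z"
    by (rule Z.divide_integral[OF nz open_P fg eqP dich])
  let ?s = "h \<odot>\<^bsub>sec F P\<^esub> e"
  have s: "?s \<in> carrier (sec F P)" by (rule smult_closed[OF open_P h e])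
  have "?pb g \<odot>\<^bsub>sec F P\<^esub> ?s = (\<lambda>z\<in>P. ?pb g z * h z) \<odot>\<^bsub>sec F P\<^esub> e"
    by (rule smult_smult[OF open_P fg(2) h e])
  also have "(\<lambda>z\<in>P. ?pb g z * h z) = restrict (?pb f) P"
    using hg by (intro restrict_ext) (simp add: mult.commute)
  also have "\<dots> = ?pb f" by (rule Z.restrict_hol_eq[OF open_P fg(1)])
  finally have s_eq: "?pb g \<odot>\<^bsub>sec F P\<^esub> ?s = ?pb f \<odot>\<^bsub>sec F P\<^esub> e" .
  have "f y = \<Phi> U ?s 0 y * g y" if y: "y \<in> U" for y
  proof -
    have "g y * \<Phi> U ?s 0 y = \<Phi> U (?pb g \<odot>\<^bsub>sec F P\<^esub> ?s) 0 y"
      by (rule \<Phi>_smult[OF open_U subset_refl g s rank y, symmetric])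
    also have "\<dots> = f y * \<Phi> U e 0 y"
      unfolding s_eq by (rule \<Phi>_smult[OF open_U subset_refl f e rank y])
    finally show ?thesis using e_one y by (simp add: mult.commute)
  qed
  then show ?thesis
    using that[OF \<Phi>_component_hol[OF open_U subset_refl s rank]] by blast
qed

end

section \<open>Normality of the base\<close>

text \<open>
  The open set has to be shrunk later to one on which given germs are represented, so the trivialisation
  is provided over all smaller open sets at once.
\<close>

lemma trivialised_direct_image_at:
  fixes Y :: "'y fspace" and Z :: "'z fspace" and E :: "('y, 'e) msheaf" and F :: "('z, 'f) msheaf"
  assumes Y: "holomorphic_space Y" and Z: "holomorphic_space Z"
    and E: "locally_free_positive_rank Y E" and F: "module_sheaf Z F" and p: "hol_map Z Y p"
    and iso: "sheaf_isomorphic Y (direct_image Z p F) E" and x: "x \<in> topspace (ctop Y)"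
  obtains U r \<Phi> where "x \<in> U" "openin (ctop Y) U"
    "\<And>V. openin (ctop Y) V \<Longrightarrow> V \<subseteq> U \<Longrightarrow> trivialised_direct_image Y Z p F V r \<Phi>"
proof -
  obtain \<phi> where hom_\<phi>: "sheaf_hom Y (direct_image Z p F) E \<phi>"
    and bij_\<phi>: "\<forall>V. openin (ctop Y) V \<longrightarrow>
      bij_betw (\<phi> V) (carrier (sec (direct_image Z p F) V)) (carrier (sec E V))"
    using iso unfolding sheaf_isomorphic_def by (elim exE conjE) simp
  have "\<exists>U r. openin (ctop Y) U \<and> x \<in> U \<and> 0 < r \<and>
       sheaf_isomorphic (open_subspace Y U) E (free_sheaf (open_subspace Y U) r)"
    using E[unfolded locally_free_positive_rank_def, THEN conjunct2] x by (rule bspec)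
  then obtain U r where U: "openin (ctop Y) U" "x \<in> U" and r: "0 < r"
    and iso': "sheaf_isomorphic (open_subspace Y U) E (free_sheaf Y r)"
    unfolding free_sheaf_open_subspace by (elim exE conjE) simp
  obtain \<theta> where hom_\<theta>: "sheaf_hom (open_subspace Y U) E (free_sheaf Y r) \<theta>"
    and bij_\<theta>: "\<forall>V. openin (ctop (open_subspace Y U)) V \<longrightarrow>
      bij_betw (\<theta> V) (carrier (sec E V)) (carrier (sec (free_sheaf Y r) V))"
    using iso' unfolding sheaf_isomorphic_def by (elim exE conjE) simp
  have opens: "openin (ctop (open_subspace Y U)) V \<longleftrightarrow> openin (ctop Y) V \<and> V \<subseteq> U" for V
    by (rule openin_open_subspace[OF U(1)])
  have carrier_di: "carrier (sec (direct_image Z p F) V) = carrier (sec F (preim Z p V))" for V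
    by (simp add: direct_image_def Let_def)
  have smult_di: "f \<odot>\<^bsub>sec (direct_image Z p F) V\<^esub> s = pullback Z p V f \<odot>\<^bsub>sec F (preim Z p V)\<^esub> s" for V f s
    by (simp add: direct_image_def Let_def)
  have res_di: "res (direct_image Z p F) V W = res F (preim Z p V) (preim Z p W)" for V W
    by (simp add: direct_image_def)
  define \<Phi> where "\<Phi> = (\<lambda>V s. \<theta> V (\<phi> V s))"
  have \<phi>_closed: "\<phi> V s \<in> carrier (sec E V)"
    if "openin (ctop Y) V" "s \<in> carrier (sec F (preim Z p V))" for V s
    using hom_\<phi>[unfolded sheaf_hom_def, THEN conjunct1, rule_format, of V] that carrier_di by simp
  show ?thesis
  proof (rule that[OF U(2,1), of r \<Phi>])
    fix V0 assume V0: "openin (ctop Y) V0" "V0 \<subseteq> U"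
    show "trivialised_direct_image Y Z p F V0 r \<Phi>"
    proof (intro trivialised_direct_image.intro Y Z trivialised_direct_image_axioms.intro F p V0(1) r)
      fix V assume V: "openin (ctop Y) V" "V \<subseteq> V0"
      have VU: "openin (ctop (open_subspace Y U)) V" using opens V V0(2) by blast
      have "bij_betw (\<theta> V \<circ> \<phi> V) (carrier (sec F (preim Z p V))) (carrier (sec (free_sheaf Y r) V))"
        using bij_\<phi>[rule_format, OF V(1)] bij_\<theta>[rule_format, OF VU] unfolding carrier_di
        by (rule bij_betw_trans)
      then show "bij_betw (\<Phi> V) (carrier (sec F (preim Z p V))) ({..<r} \<rightarrow>\<^sub>E hol Y V)"
        by (simp add: \<Phi>_def comp_def free_sheaf_def)
      {
        fix f s i y assume f: "f \<in> hol Y V" and s: "s \<in> carrier (sec F (preim Z p V))"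
          and i: "i < r" and y: "y \<in> V"
        have "\<phi> V (pullback Z p V f \<odot>\<^bsub>sec F (preim Z p V)\<^esub> s) = f \<odot>\<^bsub>sec E V\<^esub> \<phi> V s"
          using hom_\<phi>[unfolded sheaf_hom_def, THEN conjunct1, rule_format, of V] V f s
          by (simp add: carrier_di smult_di)
        moreover have "\<theta> V (f \<odot>\<^bsub>sec E V\<^esub> \<phi> V s) = f \<odot>\<^bsub>sec (free_sheaf Y r) V\<^esub> \<theta> V (\<phi> V s)"
          using hom_\<theta>[unfolded sheaf_hom_def, THEN conjunct1, rule_format, of V] VU f
            \<phi>_closed[OF V(1) s] by simp
        ultimately show "\<Phi> V (pullback Z p V f \<odot>\<^bsub>sec F (preim Z p V)\<^esub> s) i y = f y * \<Phi> V s i y"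
          using i y by (simp add: \<Phi>_def free_sheaf_def)
      }
      {
        fix s i y assume s: "s \<in> carrier (sec F (preim Z p V0))" and i: "i < r" and y: "y \<in> V"
        have V0U: "openin (ctop (open_subspace Y U)) V0" using opens V0 by blast
        have "\<phi> V (res F (preim Z p V0) (preim Z p V) s) = res E V0 V (\<phi> V0 s)"
          using hom_\<phi>[unfolded sheaf_hom_def, THEN conjunct2, rule_format, of V0 V] V V0 s
          by (simp add: carrier_di res_di)
        moreover have "\<theta> V (res E V0 V (\<phi> V0 s)) = res (free_sheaf Y r) V0 V (\<theta> V0 (\<phi> V0 s))"
          using hom_\<theta>[unfolded sheaf_hom_def, THEN conjunct2, rule_format, of V0 V] VU V0U V(2)
            \<phi>_closed[OF V0(1) s] by simp
        ultimately show "\<Phi> V (res F (preim Z p V0) (preim Z p V) s) i y = \<Phi> V0 s i y"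
          using i y by (simp add: \<Phi>_def free_sheaf_def)
      }
    qed
  qed
qed

theorem theorem4p7:
  fixes Y :: "'y fspace" and Z :: "'z fspace" and p :: "'z \<Rightarrow> 'y"
    and E :: "('y, 'e) msheaf" and F :: "('z, 'f) msheaf"
  assumes "complex_space Y"
    and "locally_irreducible Y"
    and "locally_free_positive_rank Y E"
    and "complex_space Z"
    and "normal_complex_space Z"
    and "proper_modification Z Y p"
    and "coherent_sheaf Z F"
    and "sheaf_isomorphic Y (direct_image Z p F) E"
  shows "normal_complex_space Y"
  unfolding normal_complex_space_def
proof
  fix x assume x: "x \<in> topspace (ctop Y)"
  have Y: "holomorphic_space Y" and Z: "holomorphic_space Z"
    using assms(1,4) by (simp_all add: holomorphic_space_if_complex_space)
  then interpret Y: holomorphic_space_point Y x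
    using x by (intro holomorphic_space_point.intro holomorphic_space_point_axioms.intro)
  have F: "module_sheaf Z F" using assms(7) unfolding coherent_sheaf_def by (elim conjE)
  have p: "hol_map Z Y p" using assms(6) unfolding proper_modification_def by (elim conjE)
  obtain U r \<Phi> where U: "x \<in> U" "openin (ctop Y) U"
    and triv: "\<And>V. openin (ctop Y) V \<Longrightarrow> V \<subseteq> U \<Longrightarrow> trivialised_direct_image Y Z p F V r \<Phi>"
    by (rule trivialised_direct_image_at[OF Y Z assms(3) F p assms(8) x]) blast
  show "integrally_closed (stalk Y x)"
    unfolding Y.integrally_closed_stalk_iff
  proof (intro allI impI)
    fix U0 f g u and n :: nat
    assume U0: "openin (ctop Y) U0 \<and> x \<in> U0" and f: "f \<in> hol Y U0" and g: "g \<in> hol Y U0"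
      and u: "\<forall>i<n. u i \<in> hol Y U0"
      and eq: "\<forall>y\<in>U0. f y ^ n + (\<Sum>i<n. u i y * (f y ^ i * g y ^ (n - i))) = 0"
    let ?V = "U0 \<inter> U"
    have V: "openin (ctop Y) ?V" "x \<in> ?V" using U0 U by auto
    interpret trivialised_direct_image Y Z p F ?V r \<Phi> by (rule triv[OF V(1) Int_lower2])
    obtain e where e: "e \<in> carrier (sec F (preim Z p ?V))" "\<forall>y\<in>?V. \<Phi> ?V e 0 y = 1"
      by (rule first_basis_section)
    interpret trivialised_modification Y Z p F ?V r \<Phi> e
      using assms(6) e by unfold_locales
    have res: "restrict a ?V \<in> hol Y ?V" if "a \<in> hol Y U0" for a
      using Y.restrict_hol[OF _ V(1) Int_lower1 that] U0 by blast
    have eqV: "\<forall>y\<in>?V. restrict f ?V y ^ n +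
        (\<Sum>i<n. restrict (u i) ?V y * (restrict f ?V y ^ i * restrict g ?V y ^ (n - i))) = 0"
      using eq by simp
    have uV: "\<forall>i<n. restrict (u i) ?V \<in> hol Y ?V" using res u by simp
    obtain b where b: "b \<in> hol Y ?V" "\<forall>y\<in>?V. restrict f ?V y = b y * restrict g ?V y"
      by (rule integral_equation_solvable[OF assms(7,5,4) res[OF f] res[OF g] uV eqV])
    then have "\<forall>y\<in>?V. f y = b y * g y" by simp
    then show "\<exists>W h. (openin (ctop Y) W \<and> x \<in> W) \<and> W \<subseteq> U0 \<and> h \<in> hol Y W \<and> (\<forall>y\<in>W. f y = h y * g y)"
      using V b(1) by (intro exI[of _ ?V] exI[of _ b]) simp
  qed
qed

end
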